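(* There is a function $f$ from the positive integers to the positive integers such that for every positive integer $r$, every multiplicative subgroup $\Gamma\subset\mathbb{C}^*$ with $\operatorname{rank}(\Gamma)\leq r$, and every finite set $A\subset\mathbb{C}$ with $A+A\subset\Gamma$, one has $|A|\leq f(r)$.
   Context: For a finite set $A\subset\mathbb{C}$, the sumset is $A+A=\{a+b : a,b\in A\}$ (with $a=b$ allowed). $\mathbb{C}^*$ is the multiplicative group of nonzero complex numbers. The rank of a multiplicative subgroup $\Gamma$ of $\mathbb{C}^*$ is its rank as an abelian group, i.e. the maximum number of multiplicatively independent elements of $\Gamma$ (equivalently $\dim_{\mathbb{Q}}(\Gamma\otimes_{\mathbb{Z}}\mathbb{Q})$). *)

theory Defs
  imports
    Complex_Main
    "HOL-Library.Extended_Nat"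
    "HOL-Library.Set_Algebras"
    "HOL-Algebra.FiniteProduct"
begin

definition complex_units :: "complex monoid" where
  "complex_units = \<lparr>carrier = - {0}, mult = (*), one = 1\<rparr>"

definition mult_independent :: "('a, 'b) monoid_scheme \<Rightarrow> 'a set \<Rightarrow> bool" where
  "mult_independent G S \<longleftrightarrow>
     S \<subseteq> carrier G \<and>
     (\<forall>T k. finite T \<longrightarrow> T \<subseteq> S \<longrightarrow>
        finprod G (\<lambda>x. x [^]\<^bsub>G\<^esub> (k x :: int)) T = \<one>\<^bsub>G\<^esub> \<longrightarrow> (\<forall>x\<in>T. k x = 0))"

text \<open>The rank is \<open>\<infinity>\<close> if there are arbitrarily large finite independent sets;
  it is intended for commutative groups only.\<close>

definition group_rank :: "('a, 'b) monoid_scheme \<Rightarrow> enat" where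
  "group_rank G = Sup {enat (card S) | S. finite S \<and> mult_independent G S}"

lemma complex_units_simps [simp]:
  "carrier complex_units = - {0}"
  "x \<otimes>\<^bsub>complex_units\<^esub> y = x * y"
  "\<one>\<^bsub>complex_units\<^esub> = 1"
  by (simp_all add: complex_units_def)

lemma comm_group_complex_units: "comm_group complex_units"
proof (rule comm_groupI)
  fix x assume "x \<in> carrier complex_units"
  then show "\<exists>y\<in>carrier complex_units. y \<otimes>\<^bsub>complex_units\<^esub> x = \<one>\<^bsub>complex_units\<^esub>"
    by (auto intro!: bexI[of _ "inverse x"])
qed auto

context
  fixes \<Gamma> :: "complex set"
  assumes \<Gamma>: "subgroup \<Gamma> complex_units"
begin

lemma comm_group_complex_subgroup: "comm_group (complex_units\<lparr>carrier := \<Gamma>\<rparr>)"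
proof -
  interpret comm_group complex_units by (rule comm_group_complex_units)
  show ?thesis
    using subgroup.subgroup_is_group[OF \<Gamma> is_group]
    by (rule group.group_comm_groupI) (simp add: mult.commute)
qed

lemma nat_pow_complex_subgroup: "x [^]\<^bsub>complex_units\<lparr>carrier := \<Gamma>\<rparr>\<^esub> (n::nat) = x ^ n"
  by (induction n) (simp_all add: nat_pow_def mult.commute)

lemma inv_complex_subgroup:
  assumes "x \<in> \<Gamma>"
  shows "inv\<^bsub>complex_units\<lparr>carrier := \<Gamma>\<rparr>\<^esub> x = inverse x"
proof -
  interpret comm_group "complex_units\<lparr>carrier := \<Gamma>\<rparr>" by (rule comm_group_complex_subgroup)
  have "inv\<^bsub>complex_units\<lparr>carrier := \<Gamma>\<rparr>\<^esub> x * x = 1"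
    using l_inv[of x] assms by simp
  then show ?thesis by (metis inverse_unique mult.commute)
qed

lemma int_pow_complex_subgroup:
  assumes "x \<in> \<Gamma>"
  shows "x [^]\<^bsub>complex_units\<lparr>carrier := \<Gamma>\<rparr>\<^esub> (k::int) = x powi k"
proof -
  interpret comm_group "complex_units\<lparr>carrier := \<Gamma>\<rparr>" by (rule comm_group_complex_subgroup)
  have "x ^ n \<in> \<Gamma>" for n
    using nat_pow_closed[of x n] assms by (simp add: nat_pow_complex_subgroup)
  then show ?thesis
    by (simp add: int_pow_def2 nat_pow_complex_subgroup inv_complex_subgroup power_int_def
        power_inverse)
qed

lemma finprod_complex_subgroup:
  assumes "finite T" "\<And>x. x \<in> T \<Longrightarrow> f x \<in> \<Gamma>"
  shows "finprod (complex_units\<lparr>carrier := \<Gamma>\<rparr>) f T = (\<Prod>x\<in>T. f x)"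
proof -
  interpret comm_group "complex_units\<lparr>carrier := \<Gamma>\<rparr>" by (rule comm_group_complex_subgroup)
  show ?thesis using assms
    by (induction T rule: finite_induct) (auto simp: Pi_def)
qed

lemma mult_independent_complex_iff:
  "mult_independent (complex_units\<lparr>carrier := \<Gamma>\<rparr>) S \<longleftrightarrow>
     S \<subseteq> \<Gamma> \<and>
     (\<forall>T k. finite T \<longrightarrow> T \<subseteq> S \<longrightarrow> (\<Prod>x\<in>T. x powi k x) = 1 \<longrightarrow> (\<forall>x\<in>T. k x = 0))"
proof -
  interpret comm_group "complex_units\<lparr>carrier := \<Gamma>\<rparr>" by (rule comm_group_complex_subgroup)
  have "finprod (complex_units\<lparr>carrier := \<Gamma>\<rparr>)
          (\<lambda>x. x [^]\<^bsub>complex_units\<lparr>carrier := \<Gamma>\<rparr>\<^esub> (k x :: int)) T = (\<Prod>x\<in>T. x powi k x)"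
    if "finite T" "T \<subseteq> \<Gamma>" for T k
  proof -
    have "x [^]\<^bsub>complex_units\<lparr>carrier := \<Gamma>\<rparr>\<^esub> (k x :: int) \<in> \<Gamma>" if "x \<in> T" for x
      using int_pow_closed[of x "k x"] that \<open>T \<subseteq> \<Gamma>\<close> by auto
    with that show ?thesis
      by (subst finprod_complex_subgroup) (auto intro!: prod.cong simp: int_pow_complex_subgroup)
  qed
  then show ?thesis
    by (auto simp: mult_independent_def subset_trans)
qed

end

end

theory Submission
  imports Defs "HOL-Computational_Algebra.Computational_Algebra"
begin

text \<open>
  Why the size of \<open>A\<close> is bounded. All sums \<open>a + b\<close> lie in a group of rank at most \<open>r\<close>, and
  \<open>a = (a + a) / 2\<close>, so the vectors of logarithmic absolute values of the elements and of the sums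
  of \<open>A\<close> span a rational space of dimension at most \<open>r + 1\<close>. Half the \<open>l\<^sup>1\<close> distance of two such
  vectors, normalised so that the archimedean absolute values have total weight 1, is a pseudometric
  \<open>hdist x y\<close>, the height of the projective point \<open>(x : y)\<close>. In dimension \<open>g\<close> a set of diameter at
  most \<open>(t - 1) * \<epsilon>\<close> contains at most \<open>t ^ g\<close> points with pairwise distances above \<open>\<epsilon>\<close>
  (\<open>separated_card_le\<close>). This estimate depends neither on the generators of the group nor on the
  field; it is the only way in which the rank enters, and it makes the bound uniform.

  Two arithmetic facts compete with it. The first is a gap principle: by Cramer's rule the equations
  \<open>k + a = s\<close> and \<open>k + b = t\<close> express \<open>k : a\<close> through \<open>a : b\<close> and \<open>s : t\<close>, so that
  \<open>hdist k a \<le> ln 2 + hdist a b + hdist s t\<close> (\<open>gap_principle\<close>). Theorems on unit equations also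
  need a bound in the other direction, from Diophantine approximation, because their solutions may
  thin out exponentially. Here every pair of elements of \<open>A\<close> gives an equation, and the freedom to
  choose the pairs replaces it: if \<open>A\<close> is large, there are many elements close to each other compared
  to the diameter \<open>D\<close> of \<open>A\<close>, some \<open>k\<close> is far from all of them, and two of the sums of \<open>k\<close> with these
  elements are close as well; the gap principle then gives \<open>D \<le> 5\<close> (\<open>bounded_diameter\<close>).

  The second fact disposes of small heights. When the diameter is bounded, many of the sums are within
  \<open>1/100\<close> of each other; by the pigeonhole principle there are \<open>a \<noteq> b\<close> and distinct \<open>c, d, e\<close> for
  which this holds for all six sums of one of \<open>a, b\<close> and one of \<open>c, d, e\<close>. With \<open>x = a + c\<close>,
  \<open>y = - (b + c)\<close>, \<open>z = b + d\<close> one has \<open>x + y + z = a + d\<close>, and for a prime \<open>p\<close> the number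
  \<open>(x + y + z) ^ p - x ^ p - y ^ p - z ^ p\<close> is \<open>p\<close> times an integral form. If \<open>p\<close> exceeds the
  number 4 of terms, this form is too small to be nonzero by the product formula
  (\<open>small_height_vanishes\<close>). The factorisations for \<open>p = 5\<close> and \<open>p = 7\<close> leave only \<open>z + x = 0\<close>, that
  is \<open>a + b + c + d = 0\<close> (\<open>close_rectangle\<close>). The same with \<open>e\<close> in place of \<open>d\<close> gives \<open>d = e\<close>, a
  contradiction.

  It remains to have absolute values with a product formula, although the elements of \<open>A\<close> may be
  transcendental and no number field is given. A finite set of complex numbers lies in a ring with
  finitely many homomorphisms to the complex numbers under which prescribed elements stay nonzero and
  whose sum takes rational values (\<open>specialization\<close>); then their product takes rational values too.
  The homomorphisms are composed with the usual absolute value and with an extension of each \<open>p\<close>-adic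
  absolute value to the algebraic numbers. The product formula for the rational norms is all that is
  needed (\<open>height_system_exists\<close>).
\<close>

section \<open>Newton's identities\<close>

definition monic_of_roots :: "complex list \<Rightarrow> complex poly" where
  "monic_of_roots xs = (\<Prod>x\<leftarrow>xs. [:- x, 1:])"

definition reversed_of_roots :: "complex list \<Rightarrow> complex poly" where
  "reversed_of_roots xs = (\<Prod>x\<leftarrow>xs. [:1, - x:])"

lemma monic_of_roots_simps [simp]:
  "monic_of_roots [] = 1" "monic_of_roots (x # xs) = [:- x, 1:] * monic_of_roots xs"
  by (simp_all add: monic_of_roots_def)

lemma reversed_of_roots_simps [simp]:
  "reversed_of_roots [] = 1" "reversed_of_roots (x # xs) = [:1, - x:] * reversed_of_roots xs"
  by (simp_all add: reversed_of_roots_def)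

lemma lead_coeff_monic_of_roots [simp]: "lead_coeff (monic_of_roots xs) = 1"
  by (induction xs) (simp_all add: lead_coeff_mult del: mult_pCons_left)

lemma monic_of_roots_nonzero [simp]: "monic_of_roots xs \<noteq> 0"
  using lead_coeff_monic_of_roots[of xs] by fastforce

lemma degree_monic_of_roots [simp]: "degree (monic_of_roots xs) = length xs"
  by (induction xs) (simp_all add: degree_mult_eq del: mult_pCons_left)

lemma poly_monic_of_roots: "poly (monic_of_roots xs) z = (\<Prod>x\<leftarrow>xs. z - x)"
  by (induction xs) (simp_all add: algebra_simps)

lemma reflect_monic_of_roots: "reflect_poly (monic_of_roots xs) = reversed_of_roots xs"
proof (induction xs)
  case (Cons x xs)
  have "reflect_poly [:- x, 1:] = [:1, - x:]" by (simp add: reflect_poly_def)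
  with Cons show ?case by (simp add: reflect_poly_mult del: mult_pCons_left)
qed simp

lemma coeff_reversed_of_roots:
  "coeff (reversed_of_roots xs) k = (if k > length xs then 0 else coeff (monic_of_roots xs) (length xs - k))"
  unfolding reflect_monic_of_roots[symmetric] by (simp add: coeff_reflect_poly)

text \<open>
  The generating function of the power sums is the sum of the series \<open>1 / (1 - x X)\<close>; multiplied by
  the product of the \<open>1 - x X\<close> it becomes a polynomial, which the logarithmic derivative of that
  product identifies. The induction on the list adds one geometric series \<open>?G\<close> at a time.
\<close>

lemma newton_identity_fps:
  "fps_of_poly (reversed_of_roots xs) * Abs_fps (\<lambda>k. \<Sum>x\<leftarrow>xs. x ^ k) =
     of_nat (length xs) * fps_of_poly (reversed_of_roots xs) -
     fps_X * fps_of_poly (pderiv (reversed_of_roots xs))"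
proof (induction xs)
  case Nil
  have "Abs_fps (\<lambda>k. 0 :: complex) = 0" by (simp add: fps_eq_iff)
  then show ?case by simp
next
  case (Cons x xs)
  let ?r = "fps_of_poly (reversed_of_roots xs)" and ?l = "fps_of_poly [:1, - x:]"
  let ?S = "Abs_fps (\<lambda>k. \<Sum>x\<leftarrow>xs. x ^ k)" and ?G = "Abs_fps (\<lambda>k. x ^ k)"
  have G: "?l * ?G = 1"
  proof (rule fps_ext)
    fix n
    have "?l * ?G = ?G - fps_X * (fps_const x * ?G)"
      by (simp add: fps_of_poly_pCons algebra_simps flip: fps_const_neg)
    then show "fps_nth (?l * ?G) n = fps_nth 1 n"
      by (cases n) simp_all
  qed
  have split: "Abs_fps (\<lambda>k. \<Sum>x\<leftarrow>x # xs. x ^ k) = ?G + ?S"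
    by (simp add: fps_eq_iff)
  have "fps_of_poly (reversed_of_roots (x # xs)) * Abs_fps (\<lambda>k. \<Sum>x\<leftarrow>x # xs. x ^ k) =
      ?l * ?r * (?G + ?S)"
    by (simp only: split reversed_of_roots_simps fps_of_poly_mult)
  also have "\<dots> = (?l * ?G) * ?r + ?l * (?r * ?S)"
    by (simp only: algebra_simps)
  also have "\<dots> = ?r + ?l * (of_nat (length xs) * ?r - fps_X * fps_of_poly (pderiv (reversed_of_roots xs)))"
    by (simp only: G Cons.IH mult_1)
  also have "\<dots> = of_nat (Suc (length xs)) * (?l * ?r) -
      fps_X * fps_of_poly (pderiv ([:1, - x:] * reversed_of_roots xs))"
  proof -
    have "?r = ?l * ?r - fps_X * (fps_of_poly [:- x:] * ?r)"
      by (simp add: fps_of_poly_pCons algebra_simps)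
    moreover have "fps_of_poly (pderiv ([:1, - x:] * reversed_of_roots xs)) =
        fps_of_poly [:- x:] * ?r + ?l * fps_of_poly (pderiv (reversed_of_roots xs))"
      by (simp only: pderiv_mult fps_of_poly_add fps_of_poly_mult) (simp add: pderiv_pCons algebra_simps fps_of_poly_mult)
    ultimately show ?thesis
      by (simp only: of_nat_Suc) (simp only: algebra_simps, simp)
  qed
  finally show ?case
    by (simp only: reversed_of_roots_simps fps_of_poly_mult length_Cons)
qed

lemma newton_identity:
  "(\<Sum>i\<le>k. coeff (reversed_of_roots xs) i * (\<Sum>x\<leftarrow>xs. x ^ (k - i))) =
     (of_nat (length xs) - of_nat k) * coeff (reversed_of_roots xs) k"
proof -
  have "fps_nth (fps_of_poly (reversed_of_roots xs) * Abs_fps (\<lambda>k. \<Sum>x\<leftarrow>xs. x ^ k)) k =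
     fps_nth (of_nat (length xs) * fps_of_poly (reversed_of_roots xs) -
     fps_X * fps_of_poly (pderiv (reversed_of_roots xs))) k"
    by (simp only: newton_identity_fps)
  moreover have nat: "fps_nth (of_nat n * F) k = of_nat n * fps_nth F k" for n and F :: "complex fps"
    by (simp flip: fps_of_nat)
  moreover have X: "fps_nth (fps_X * fps_of_poly (pderiv p)) k = of_nat k * coeff p k" for p :: "complex poly"
    by (cases k) (simp_all add: coeff_pderiv)
  moreover have "fps_nth (fps_of_poly (reversed_of_roots xs) * Abs_fps (\<lambda>k. \<Sum>x\<leftarrow>xs. x ^ k)) k =
      (\<Sum>i\<le>k. coeff (reversed_of_roots xs) i * (\<Sum>x\<leftarrow>xs. x ^ (k - i)))"
    by (simp add: fps_mult_nth atLeast0AtMost)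
  ultimately show ?thesis
    by (simp only: fps_sub_nth nat X fps_of_poly_nth left_diff_distrib)
qed

lemma coeff_0_reversed_of_roots [simp]: "coeff (reversed_of_roots xs) 0 = 1"
  by (induction xs) auto

lemma Rats_sum: "(\<And>x. x \<in> A \<Longrightarrow> f x \<in> \<rat>) \<Longrightarrow> sum f A \<in> (\<rat> :: 'a :: field_char_0 set)"
  by (induction A rule: infinite_finite_induct) auto

text \<open>
  In characteristic 0 Newton's identities can be solved for the coefficients.
\<close>

lemma rational_coeffs_of_power_sums:
  assumes "\<And>k. (\<Sum>x\<leftarrow>xs. x ^ k) \<in> \<rat>"
  shows "coeff (monic_of_roots xs) i \<in> \<rat>"
proof -
  let ?r = "coeff (reversed_of_roots xs)"
  have r: "?r k \<in> \<rat>" for k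
  proof (induction k rule: less_induct)
    case (less k)
    show ?case
    proof (cases "k = 0")
      case False
      have "{..k} = insert k {..<k}" by auto
      then have "- (of_nat k * ?r k) = (\<Sum>i<k. ?r i * (\<Sum>x\<leftarrow>xs. x ^ (k - i)))"
        using newton_identity[of xs k] by (simp add: algebra_simps sum_list_triv add_eq_0_iff)
      then have "of_nat k * ?r k = - (\<Sum>i<k. ?r i * (\<Sum>x\<leftarrow>xs. x ^ (k - i)))"
        by (metis minus_minus)
      then have "?r k = - (\<Sum>i<k. ?r i * (\<Sum>x\<leftarrow>xs. x ^ (k - i))) / of_nat k"
        using False by (simp add: field_simps)
      moreover have "(\<Sum>i<k. ?r i * (\<Sum>x\<leftarrow>xs. x ^ (k - i))) \<in> \<rat>"
        using less assms by (intro Rats_sum Rats_mult) auto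
      ultimately show ?thesis by simp
    qed simp
  qed
  show ?thesis
  proof (cases "i \<le> length xs")
    case True
    then have "coeff (monic_of_roots xs) i = ?r (length xs - i)" by (simp add: coeff_reversed_of_roots)
    then show ?thesis using r by simp
  next
    case False
    then show ?thesis by (simp add: coeff_eq_0)
  qed
qed

section \<open>Subrings of the complex numbers and their homomorphisms\<close>

text \<open>
  Rings of numbers are subsets of the complex numbers, and a homomorphism on such a ring is a function
  on all complex numbers that respects the operations there; its values elsewhere are arbitrary.
\<close>

definition rat_subring :: "complex set \<Rightarrow> bool" where
  "rat_subring R \<longleftrightarrow> \<rat> \<subseteq> R \<and> (\<forall>x\<in>R. \<forall>y\<in>R. x + y \<in> R \<and> x * y \<in> R)"

definition hom_on :: "complex set \<Rightarrow> (complex \<Rightarrow> complex) \<Rightarrow> bool" where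
  "hom_on R \<psi> \<longleftrightarrow> \<psi> 1 = 1 \<and> (\<forall>x\<in>R. \<forall>y\<in>R. \<psi> (x + y) = \<psi> x + \<psi> y \<and> \<psi> (x * y) = \<psi> x * \<psi> y)"

definition csubring :: "complex set \<Rightarrow> bool" where
  "csubring R \<longleftrightarrow> 1 \<in> R \<and> (\<forall>x\<in>R. \<forall>y\<in>R. x - y \<in> R \<and> x * y \<in> R)"

lemma
  assumes "csubring R"
  shows csubring_one: "1 \<in> R"
    and csubring_diff: "x \<in> R \<Longrightarrow> y \<in> R \<Longrightarrow> x - y \<in> R"
    and csubring_mult: "x \<in> R \<Longrightarrow> y \<in> R \<Longrightarrow> x * y \<in> R"
    and csubring_zero: "0 \<in> R"
    and csubring_uminus: "x \<in> R \<Longrightarrow> - x \<in> R"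
    and csubring_add: "x \<in> R \<Longrightarrow> y \<in> R \<Longrightarrow> x + y \<in> R"
    and csubring_power: "x \<in> R \<Longrightarrow> x ^ n \<in> R"
    and csubring_sum: "(\<And>i. i \<in> A \<Longrightarrow> f i \<in> R) \<Longrightarrow> sum f A \<in> R"
    and csubring_prod: "(\<And>i. i \<in> A \<Longrightarrow> f i \<in> R) \<Longrightarrow> prod f A \<in> R"
    and csubring_of_int: "of_int k \<in> R"
    and csubring_of_nat: "of_nat n \<in> R"
proof -
  show one: "1 \<in> R" using assms by (simp add: csubring_def)
  show diff: "x - y \<in> R" if "x \<in> R" "y \<in> R" for x y using assms that by (simp add: csubring_def)
  show mult: "x * y \<in> R" if "x \<in> R" "y \<in> R" for x y using assms that by (simp add: csubring_def)
  show zero: "0 \<in> R" using diff[OF one one] by simp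
  show um: "- x \<in> R" if "x \<in> R" for x using diff[OF zero that] by simp
  show add: "x + y \<in> R" if "x \<in> R" "y \<in> R" for x y using diff[OF that(1) um[OF that(2)]] by simp
  show "x ^ n \<in> R" if "x \<in> R" for x n by (induction n) (use that one mult in auto)
  show "sum f A \<in> R" if "\<And>i. i \<in> A \<Longrightarrow> f i \<in> R" for f A
    using that by (induction A rule: infinite_finite_induct) (auto simp: zero add)
  show "prod f A \<in> R" if "\<And>i. i \<in> A \<Longrightarrow> f i \<in> R" for f A
    using that by (induction A rule: infinite_finite_induct) (auto simp: one mult)
  show nat: "of_nat n \<in> R" for n by (induction n) (auto simp: zero one add)
  show "of_int k \<in> R" by (cases k rule: int_cases2) (auto simp: nat um)
qed

lemmas csubring_closed = csubring_one csubring_diff csubring_mult csubring_zero csubring_uminus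
  csubring_add csubring_power csubring_of_int csubring_of_nat

lemma rat_subring_Rats: "rat_subring R \<Longrightarrow> x \<in> \<rat> \<Longrightarrow> x \<in> R"
  by (auto simp: rat_subring_def)

lemma rat_subring_csubring: "rat_subring R \<Longrightarrow> csubring R"
proof -
  assume R: "rat_subring R"
  have "x - y \<in> R" if "x \<in> R" "y \<in> R" for x y
  proof -
    have "- 1 * y \<in> R" using R that Rats_minus_iff[of 1] unfolding rat_subring_def by (meson Rats_1 subsetD)
    with that have "x + - 1 * y \<in> R" using R unfolding rat_subring_def by blast
    then show ?thesis by simp
  qed
  with R show ?thesis by (auto simp: rat_subring_def csubring_def)
qed

lemma rat_subring_iff: "rat_subring R \<longleftrightarrow> \<rat> \<subseteq> R \<and> csubring R"
  using rat_subring_csubring[of R] csubring_add[of R] csubring_mult[of R] unfolding rat_subring_def by blast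

lemmas rat_subring_add = csubring_add[OF rat_subring_csubring]
lemmas rat_subring_mult = csubring_mult[OF rat_subring_csubring]
lemmas rat_subring_zero = csubring_zero[OF rat_subring_csubring]
lemmas rat_subring_one = csubring_one[OF rat_subring_csubring]
lemmas rat_subring_uminus = csubring_uminus[OF rat_subring_csubring]
lemmas rat_subring_diff = csubring_diff[OF rat_subring_csubring]
lemmas rat_subring_power = csubring_power[OF rat_subring_csubring]
lemmas rat_subring_sum = csubring_sum[OF rat_subring_csubring]
lemmas rat_subring_prod = csubring_prod[OF rat_subring_csubring]

lemmas rat_subring_closed = rat_subring_Rats rat_subring_add rat_subring_mult rat_subring_zero
  rat_subring_one rat_subring_uminus rat_subring_diff rat_subring_power

lemma
  assumes R: "rat_subring R" and h: "hom_on R \<psi>"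
  shows hom_on_add: "x \<in> R \<Longrightarrow> y \<in> R \<Longrightarrow> \<psi> (x + y) = \<psi> x + \<psi> y"
    and hom_on_mult: "x \<in> R \<Longrightarrow> y \<in> R \<Longrightarrow> \<psi> (x * y) = \<psi> x * \<psi> y"
    and hom_on_one: "\<psi> 1 = 1"
    and hom_on_zero: "\<psi> 0 = 0"
    and hom_on_uminus: "x \<in> R \<Longrightarrow> \<psi> (- x) = - \<psi> x"
    and hom_on_diff: "x \<in> R \<Longrightarrow> y \<in> R \<Longrightarrow> \<psi> (x - y) = \<psi> x - \<psi> y"
    and hom_on_power: "x \<in> R \<Longrightarrow> \<psi> (x ^ n) = \<psi> x ^ n"
    and hom_on_sum: "(\<And>i. i \<in> A \<Longrightarrow> f i \<in> R) \<Longrightarrow> \<psi> (sum f A) = (\<Sum>i\<in>A. \<psi> (f i))"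
    and hom_on_Rats: "q \<in> \<rat> \<Longrightarrow> \<psi> q = q"
proof -
  note [simp] = rat_subring_closed[OF R]
  show add: "\<psi> (x + y) = \<psi> x + \<psi> y" if "x \<in> R" "y \<in> R" for x y using h that by (auto simp: hom_on_def)
  show mult: "\<psi> (x * y) = \<psi> x * \<psi> y" if "x \<in> R" "y \<in> R" for x y using h that by (auto simp: hom_on_def)
  show one: "\<psi> 1 = 1" using h by (simp add: hom_on_def)
  show zero: "\<psi> 0 = 0" using add[of 0 0] by simp
  show um: "\<psi> (- x) = - \<psi> x" if "x \<in> R" for x
    using add[of x "- x"] that zero by (simp add: add_eq_0_iff)
  show "\<psi> (x - y) = \<psi> x - \<psi> y" if "x \<in> R" "y \<in> R" for x y
    using add[of x "- y"] um that by simp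
  show "\<psi> (x ^ n) = \<psi> x ^ n" if "x \<in> R" for x n
    by (induction n) (use that one mult in auto)
  show "\<psi> (sum f A) = (\<Sum>i\<in>A. \<psi> (f i))" if "\<And>i. i \<in> A \<Longrightarrow> f i \<in> R" for f A
    using that by (induction A rule: infinite_finite_induct) (auto simp: zero add rat_subring_sum[OF R])
  have nat: "\<psi> (of_nat n) = of_nat n" for n
    by (induction n) (auto simp: zero one add)
  have int: "\<psi> (of_int n) = of_int n" for n
    by (cases n rule: int_cases2) (auto simp: nat um)
  show "\<psi> q = q" if "q \<in> \<rat>"
  proof -
    from that obtain a b where ab: "b > 0" "q = of_int a / of_int b"
      by (metis Rats_cases')
    have "q \<in> R" using that by simp
    have "\<psi> (q * of_int b) = \<psi> q * of_int b"
      by (subst mult) (auto simp: \<open>q \<in> R\<close> int)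
    moreover have "q * of_int b = of_int a" using ab by simp
    ultimately have "\<psi> q * of_int b = of_int a" by (simp add: int)
    then have "\<psi> q = of_int a / of_int b" using ab(1) by (simp add: eq_divide_eq)
    then show ?thesis using ab by simp
  qed
qed

definition over :: "complex set \<Rightarrow> complex poly \<Rightarrow> bool" where
  "over R f \<longleftrightarrow> (\<forall>i. coeff f i \<in> R)"

lemma
  assumes R: "csubring R"
  shows csubring_over_0: "over R 0"
    and csubring_over_const: "c \<in> R \<Longrightarrow> over R [:c:]"
    and csubring_over_X: "over R [:0, 1:]"
    and csubring_over_add: "over R f \<Longrightarrow> over R g \<Longrightarrow> over R (f + g)"
    and csubring_over_diff: "over R f \<Longrightarrow> over R g \<Longrightarrow> over R (f - g)"
    and csubring_over_mult: "over R f \<Longrightarrow> over R g \<Longrightarrow> over R (f * g)"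
    and csubring_over_smult: "c \<in> R \<Longrightarrow> over R g \<Longrightarrow> over R (smult c g)"
    and csubring_over_monom: "c \<in> R \<Longrightarrow> over R (monom c n)"
    and csubring_poly_over: "over R f \<Longrightarrow> c \<in> R \<Longrightarrow> poly f c \<in> R"
  unfolding over_def
  by (auto simp: coeff_pCons csubring_closed[OF R] coeff_mult poly_altdef
      intro!: csubring_sum[OF R] split: nat.splits)

lemma poly_map_hom_altdef:
  assumes R: "rat_subring R" and h: "hom_on R \<psi>"
  shows "poly (map_poly \<psi> f) z = (\<Sum>i\<le>degree f. \<psi> (coeff f i) * z ^ i)"
proof -
  have c: "coeff (map_poly \<psi> f) i = \<psi> (coeff f i)" for i
    by (simp add: coeff_map_poly hom_on_zero[OF R h])
  have "degree (map_poly \<psi> f) \<le> degree f"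
    by (intro degree_le) (auto simp: c coeff_eq_0 hom_on_zero[OF R h])
  then have "(\<Sum>i\<le>degree f. \<psi> (coeff f i) * z ^ i) =
      (\<Sum>i\<le>degree (map_poly \<psi> f). \<psi> (coeff f i) * z ^ i)"
    by (intro sum.mono_neutral_right) (auto simp flip: c intro: coeff_eq_0)
  then show ?thesis by (simp add: poly_altdef c)
qed

lemmas over_0 = csubring_over_0[OF rat_subring_csubring]
lemmas over_const = csubring_over_const[OF rat_subring_csubring]
lemmas over_add = csubring_over_add[OF rat_subring_csubring]
lemmas over_diff = csubring_over_diff[OF rat_subring_csubring]
lemmas over_mult = csubring_over_mult[OF rat_subring_csubring]
lemmas over_smult = csubring_over_smult[OF rat_subring_csubring]
lemmas over_monom = csubring_over_monom[OF rat_subring_csubring]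
lemmas poly_over = csubring_poly_over[OF rat_subring_csubring]

lemma
  assumes R: "rat_subring R" and h: "hom_on R \<psi>"
  shows coeff_map_hom: "coeff (map_poly \<psi> f) i = \<psi> (coeff f i)"
    and map_hom_add: "over R f \<Longrightarrow> over R g \<Longrightarrow> map_poly \<psi> (f + g) = map_poly \<psi> f + map_poly \<psi> g"
    and map_hom_diff: "over R f \<Longrightarrow> over R g \<Longrightarrow> map_poly \<psi> (f - g) = map_poly \<psi> f - map_poly \<psi> g"
    and map_hom_mult: "over R f \<Longrightarrow> over R g \<Longrightarrow> map_poly \<psi> (f * g) = map_poly \<psi> f * map_poly \<psi> g"
    and map_hom_const: "map_poly \<psi> [:c:] = [:\<psi> c:]"
    and poly_map_hom: "over R f \<Longrightarrow> c \<in> R \<Longrightarrow> \<psi> (poly f c) = poly (map_poly \<psi> f) (\<psi> c)"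
proof -
  note 1 = rat_subring_closed[OF R] and 2 = hom_on_add[OF R h] hom_on_mult[OF R h] hom_on_zero[OF R h]
    hom_on_diff[OF R h] hom_on_power[OF R h]
  show c: "coeff (map_poly \<psi> f) i = \<psi> (coeff f i)" for f i
    by (simp add: coeff_map_poly 2)
  show "map_poly \<psi> (f + g) = map_poly \<psi> f + map_poly \<psi> g" if "over R f" "over R g" for f g
    using that by (auto simp: poly_eq_iff c 2 over_def)
  show "map_poly \<psi> (f - g) = map_poly \<psi> f - map_poly \<psi> g" if "over R f" "over R g" for f g
    using that by (auto simp: poly_eq_iff c 2 over_def)
  show "map_poly \<psi> (f * g) = map_poly \<psi> f * map_poly \<psi> g" if "over R f" "over R g" for f g
    using that by (auto simp: poly_eq_iff c 2 over_def coeff_mult 1 hom_on_sum[OF R h] intro!: sum.cong)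
  show "map_poly \<psi> [:c:] = [:\<psi> c:]"
    by (auto simp: poly_eq_iff c 2 coeff_pCons split: nat.splits)
  show "\<psi> (poly f c) = poly (map_poly \<psi> f) (\<psi> c)" if "over R f" "c \<in> R"
    using that unfolding poly_map_hom_altdef[OF R h]
    by (simp add: poly_altdef hom_on_sum[OF R h] 1 2 over_def)
qed

text \<open>
  The roots are listed with multiplicity, in some order.
\<close>

lemma complex_monic_splits:
  assumes "lead_coeff p = 1"
  shows "\<exists>xs. p = monic_of_roots xs"
proof -
  obtain xs where xs: "mset xs = proots p" using ex_mset by blast
  have "p = smult (lead_coeff p) (\<Prod>x\<in>#proots p. [:- x, 1:])"
    by (rule complex_poly_decompose_multiset[symmetric])
  also have "\<dots> = monic_of_roots xs"
    by (simp add: assms monic_of_roots_def flip: xs prod_mset_prod_list)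
  finally show ?thesis ..
qed

lemma sum_list_concat: "sum_list (concat xss) = (\<Sum>xs\<leftarrow>xss. sum_list xs)"
  by (induction xss) simp_all

lemma sum_list_sum_swap:
  "(\<Sum>x\<leftarrow>xs. \<Sum>i\<in>A. f i x) = (\<Sum>i\<in>A. \<Sum>x\<leftarrow>xs. f i x)"
  for f :: "_ \<Rightarrow> _ \<Rightarrow> 'a :: comm_monoid_add"
  by (induction xs) (simp_all add: sum.distrib)

text \<open>
  Division with remainder over a ring: a power of the leading coefficient clears the denominators.
\<close>

lemma pseudo_division:
  assumes R: "rat_subring R" and e: "over R e" "e \<noteq> 0" and f: "over R f"
  shows "\<exists>k q r. over R q \<and> over R r \<and> smult (lead_coeff e ^ k) f = q * e + r \<and> (r = 0 \<or> degree r < degree e)"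
  using f
proof (induction "if f = 0 then 0 else Suc (degree f)" arbitrary: f rule: less_induct)
  case (less f)
  show ?case
  proof (cases "f = 0 \<or> degree f < degree e")
    case True
    then show ?thesis using less.prems over_0[OF R]
      by (intro exI[of _ 0] exI[of _ 0] exI[of _ f]) auto
  next
    case False
    define t where "t = monom (lead_coeff f) (degree f - degree e)"
    define g where "g = smult (lead_coeff e) f - t * e"
    have t: "over R t" unfolding t_def using less.prems by (intro over_monom R) (auto simp: over_def)
    have g: "over R g" unfolding g_def using less.prems e t
      by (intro over_diff over_smult over_mult R) (auto simp: over_def)
    have "coeff (t * e) (degree f) = lead_coeff f * lead_coeff e"
      using False by (simp add: t_def coeff_monom_mult)
    then have top: "coeff g (degree f) = 0" by (simp add: g_def)
    have "degree (t * e) \<le> degree f"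
      using False e by (cases "t = 0") (auto simp: t_def degree_mult_eq degree_monom_eq)
    then have "degree g \<le> degree f" unfolding g_def
      by (intro degree_diff_le) (auto intro: order.trans[OF degree_smult_le])
    with top have "g = 0 \<or> degree g < degree f"
      by (metis leading_coeff_0_iff le_neq_implies_less)
    then have "(if g = 0 then 0 else Suc (degree g)) < (if f = 0 then 0 else Suc (degree f))"
      using False by auto
    from less.hyps[OF this g] obtain k q r where
      IH: "over R q" "over R r" "smult (lead_coeff e ^ k) g = q * e + r" "r = 0 \<or> degree r < degree e"
      by blast
    have "smult (lead_coeff e ^ Suc k) f = smult (lead_coeff e ^ k) (g + t * e)"
      by (simp add: g_def mult.commute)
    also have "\<dots> = (q + smult (lead_coeff e ^ k) t) * e + r"
      by (simp add: smult_add_right IH algebra_simps)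
    finally have "smult (lead_coeff e ^ Suc k) f = (q + smult (lead_coeff e ^ k) t) * e + r" .
    moreover have "over R (q + smult (lead_coeff e ^ k) t)"
      using e by (intro over_add over_smult R IH t rat_subring_power) (auto simp: over_def)
    ultimately show ?thesis using IH by blast
  qed
qed

text \<open>
  Newton's recursion for the power sums of \<open>n\<close> roots, where \<open>c\<close> gives the coefficients of the
  reversed monic polynomial. It makes the power sums of the roots of an image polynomial the images of
  fixed ring elements, independently of the homomorphism.
\<close>

fun power_sum_of_coeffs :: "(nat \<Rightarrow> complex) \<Rightarrow> nat \<Rightarrow> nat \<Rightarrow> complex" where
  "power_sum_of_coeffs c n k =
     of_int (int n - int k) * c k - (\<Sum>i\<in>{1..k}. c i * power_sum_of_coeffs c n (k - i))"

declare power_sum_of_coeffs.simps [simp del]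

lemma power_sum_eq:
  "(\<Sum>x\<leftarrow>xs. x ^ k) = power_sum_of_coeffs (coeff (reversed_of_roots xs)) (length xs) k"
proof (induction k rule: less_induct)
  case (less k)
  have "{..k} = insert 0 {1..k}" by auto
  then have "(\<Sum>x\<leftarrow>xs. x ^ k) = of_int (int (length xs) - int k) * coeff (reversed_of_roots xs) k -
      (\<Sum>i\<in>{1..k}. coeff (reversed_of_roots xs) i * (\<Sum>x\<leftarrow>xs. x ^ (k - i)))"
    using newton_identity[of xs k] by (simp add: algebra_simps)
  also have "\<dots> = power_sum_of_coeffs (coeff (reversed_of_roots xs)) (length xs) k"
    by (subst power_sum_of_coeffs.simps) (simp add: less)
  finally show ?case .
qed

lemma power_sums_of_image:
  assumes R: "rat_subring R" and m: "over R m" "lead_coeff m = 1"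
  shows "\<exists>s. (\<forall>k. s k \<in> R) \<and>
    (\<forall>\<psi> xs k. hom_on R \<psi> \<longrightarrow> map_poly \<psi> m = monic_of_roots xs \<longrightarrow> (\<Sum>x\<leftarrow>xs. x ^ k) = \<psi> (s k))"
proof -
  define c where "c i = (if i > degree m then 0 else coeff m (degree m - i))" for i
  define s where "s = power_sum_of_coeffs c (degree m)"
  note cl = rat_subring_closed[OF R]
  have c: "c i \<in> R" for i using m by (simp add: c_def over_def cl)
  have s_rec: "s k = of_int (int (degree m) - int k) * c k - (\<Sum>i\<in>{1..k}. c i * s (k - i))" for k
    unfolding s_def by (subst power_sum_of_coeffs.simps) (rule refl)
  have rat: "of_int i \<in> R" for i by (rule rat_subring_Rats[OF R]) simp
  have s: "s k \<in> R" for k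
  proof (induction k rule: less_induct)
    case (less k)
    have "(\<Sum>i\<in>{1..k}. c i * s (k - i)) \<in> R"
      using less c by (intro rat_subring_sum[OF R] rat_subring_mult[OF R]) auto
    then show ?case unfolding s_rec[of k]
      by (intro rat_subring_diff[OF R] rat_subring_mult[OF R rat c])
  qed
  moreover have "(\<Sum>x\<leftarrow>xs. x ^ k) = \<psi> (s k)" if h: "hom_on R \<psi>" and xs: "map_poly \<psi> m = monic_of_roots xs" for \<psi> xs k
  proof -
    have "degree (map_poly \<psi> m) = degree m"
      using m by (intro map_poly_degree_eq) (simp add: hom_on_one[OF R h])
    then have len: "length xs = degree m" by (simp add: xs)
    have r: "coeff (reversed_of_roots xs) i = \<psi> (c i)" for i
      by (simp add: coeff_reversed_of_roots len c_def hom_on_zero[OF R h] flip: xs coeff_map_hom[OF R h])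
    have "power_sum_of_coeffs (\<lambda>i. \<psi> (c i)) (degree m) k = \<psi> (s k)"
    proof (induction k rule: less_induct)
      case (less k)
      have "\<psi> (s k) = \<psi> (of_int (int (degree m) - int k) * c k) - \<psi> (\<Sum>i\<in>{1..k}. c i * s (k - i))"
        unfolding s_rec[of k]
        by (intro hom_on_diff[OF R h] rat_subring_mult[OF R rat c] rat_subring_sum[OF R] rat_subring_mult[OF R c s])
      also have "\<dots> = of_int (int (degree m) - int k) * \<psi> (c k) -
          (\<Sum>i\<in>{1..k}. \<psi> (c i) * \<psi> (s (k - i)))"
        using rat c s by (simp add: hom_on_sum[OF R h] hom_on_mult[OF R h] rat_subring_mult[OF R] hom_on_Rats[OF R h] del: of_int_diff)
      finally have "\<psi> (s k) = of_int (int (degree m) - int k) * \<psi> (c k) -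
          (\<Sum>i\<in>{1..k}. \<psi> (c i) * \<psi> (s (k - i)))" .
      then show ?case
        by (subst power_sum_of_coeffs.simps) (simp add: less)
    qed
    moreover have "coeff (reversed_of_roots xs) = (\<lambda>i. \<psi> (c i))" using r by blast
    ultimately show ?thesis by (simp add: power_sum_eq len)
  qed
  ultimately show ?thesis by blast
qed

section \<open>Specialization with rational traces\<close>

text \<open>
  The goal of this section is a substitute for the embeddings of a number field that also serves
  rings with transcendental elements. It is built up one generator at a time.
\<close>

definition adjoin :: "complex set \<Rightarrow> complex \<Rightarrow> complex set" where
  "adjoin R x = {poly g x | g. over R g}"

lemma
  assumes R: "csubring R"
  shows csubring_adjoin: "csubring (adjoin R x)"
    and csubring_subset_adjoin: "R \<subseteq> adjoin R x"
    and csubring_adjoin_self: "x \<in> adjoin R x"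
proof -
  show sub: "R \<subseteq> adjoin R x"
  proof
    fix c assume "c \<in> R"
    then show "c \<in> adjoin R x" unfolding adjoin_def
      by (intro CollectI exI[of _ "[:c:]"]) (simp add: csubring_over_const[OF R])
  qed
  show "x \<in> adjoin R x" unfolding adjoin_def
    by (intro CollectI exI[of _ "[:0, 1:]"]) (simp add: csubring_over_X[OF R])
  have "y - z \<in> adjoin R x" "y * z \<in> adjoin R x" if "y \<in> adjoin R x" "z \<in> adjoin R x" for y z
    using that csubring_over_diff[OF R] csubring_over_mult[OF R]
    unfolding adjoin_def by (auto simp flip: poly_diff poly_mult)
  with sub show "csubring (adjoin R x)"
    using csubring_one[OF R] by (auto simp: csubring_def)
qed

lemmas subset_adjoin = csubring_subset_adjoin[OF rat_subring_csubring]
lemmas adjoin_self = csubring_adjoin_self[OF rat_subring_csubring]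

lemma rat_subring_adjoin: "rat_subring R \<Longrightarrow> rat_subring (adjoin R x)"
  using csubring_adjoin[of R x] csubring_subset_adjoin[of R x] unfolding rat_subring_iff by blast

text \<open>
  The extension of \<open>\<psi>\<close> to the ring generated by \<open>x\<close> that sends \<open>x\<close> to \<open>z\<close>. The value does not depend
  on the chosen polynomial as soon as \<open>z\<close> is a root of the image of each polynomial that vanishes at \<open>x\<close>.
\<close>

definition extend_hom ::
  "complex set \<Rightarrow> complex \<Rightarrow> (complex \<Rightarrow> complex) \<Rightarrow> complex \<Rightarrow> complex \<Rightarrow> complex" where
  "extend_hom R x \<psi> z y = poly (map_poly \<psi> (SOME g. over R g \<and> poly g x = y)) z"

lemma
  assumes R: "rat_subring R" and h: "hom_on R \<psi>"
    and kernel: "\<And>g. over R g \<Longrightarrow> poly g x = 0 \<Longrightarrow> poly (map_poly \<psi> g) z = 0"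
  shows extend_hom_poly: "over R g \<Longrightarrow> extend_hom R x \<psi> z (poly g x) = poly (map_poly \<psi> g) z"
    and hom_on_extend_hom: "hom_on (adjoin R x) (extend_hom R x \<psi> z)"
proof -
  show eq: "extend_hom R x \<psi> z (poly g x) = poly (map_poly \<psi> g) z" if g: "over R g" for g
  proof -
    define f where "f = (SOME f. over R f \<and> poly f x = poly g x)"
    have f: "over R f" "poly f x = poly g x"
      using someI[of "\<lambda>f. over R f \<and> poly f x = poly g x" g] g unfolding f_def by auto
    then have "poly (map_poly \<psi> (f - g)) z = 0"
      using g by (intro kernel over_diff R) auto
    then show ?thesis
      by (simp add: extend_hom_def map_hom_diff[OF R h] f g flip: f_def)
  qed
  have "extend_hom R x \<psi> z (poly [:1:] x) = 1"
    by (subst eq) (simp_all add: over_const R rat_subring_one map_hom_const[OF R h] hom_on_one[OF R h])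
  moreover have "extend_hom R x \<psi> z (poly f x + poly g x) = extend_hom R x \<psi> z (poly f x) + extend_hom R x \<psi> z (poly g x)"
    if "over R f" "over R g" for f g
    by (simp add: eq that over_add[OF R] map_hom_add[OF R h] flip: poly_add)
  moreover have "extend_hom R x \<psi> z (poly f x * poly g x) = extend_hom R x \<psi> z (poly f x) * extend_hom R x \<psi> z (poly g x)"
    if "over R f" "over R g" for f g
    by (simp add: eq that over_mult[OF R] map_hom_mult[OF R h] flip: poly_mult)
  ultimately show "hom_on (adjoin R x) (extend_hom R x \<psi> z)"
    by (auto simp: hom_on_def adjoin_def)
qed

text \<open>
  A list, because a homomorphism may occur several times. Rationality is required of the traces and
  not of the norms since the trace is additive and therefore extends along a ring extension; the
  rationality of characteristic polynomials and norms follows by Newton's identities.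
\<close>

definition trace_family :: "complex set \<Rightarrow> (complex \<Rightarrow> complex) list \<Rightarrow> bool" where
  "trace_family R \<Psi> \<longleftrightarrow> \<Psi> \<noteq> [] \<and> (\<forall>\<psi>\<in>set \<Psi>. hom_on R \<psi>) \<and> (\<forall>x\<in>R. (\<Sum>\<psi>\<leftarrow>\<Psi>. \<psi> x) \<in> \<rat>)"

definition specializable :: "complex set \<Rightarrow> bool" where
  "specializable R \<longleftrightarrow> rat_subring R \<and>
     (\<forall>y\<in>R. y \<noteq> 0 \<longrightarrow> (\<exists>\<Psi>. trace_family R \<Psi> \<and> (\<forall>\<psi>\<in>set \<Psi>. \<psi> y \<noteq> 0)))"

lemma specializable_Rats: "specializable \<rat>"
proof -
  have "rat_subring \<rat>" by (auto simp: rat_subring_def)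
  moreover have "trace_family \<rat> [\<lambda>x. x]" by (auto simp: trace_family_def hom_on_def)
  ultimately show ?thesis unfolding specializable_def
    by (auto intro!: exI[of _ "[\<lambda>x. x]"])
qed

text \<open>
  A transcendental \<open>x\<close> may be sent to any number; a natural number keeps the values in the image of
  \<open>R\<close>, so that the traces remain traces of elements of \<open>R\<close>. All but finitely many choices preserve a
  given nonzero element.
\<close>

lemma specializable_adjoin_transcendental:
  assumes "specializable R" and tr: "\<And>g. over R g \<Longrightarrow> poly g x = 0 \<Longrightarrow> g = 0"
  shows "specializable (adjoin R x)"
proof -
  have R: "rat_subring R" using assms by (simp add: specializable_def)
  have "\<exists>\<Psi>. trace_family (adjoin R x) \<Psi> \<and> (\<forall>\<psi>\<in>set \<Psi>. \<psi> y \<noteq> 0)" if "y \<in> adjoin R x" "y \<noteq> 0" for y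
  proof -
    from that obtain f where f: "over R f" "y = poly f x" by (auto simp: adjoin_def)
    with that have "lead_coeff f \<in> R" "lead_coeff f \<noteq> 0" by (auto simp: over_def)
    with assms(1) obtain \<Psi> where \<Psi>: "trace_family R \<Psi>" "\<And>\<psi>. \<psi> \<in> set \<Psi> \<Longrightarrow> \<psi> (lead_coeff f) \<noteq> 0"
      unfolding specializable_def by blast
    have h: "hom_on R \<psi>" if "\<psi> \<in> set \<Psi>" for \<psi> using that \<Psi>(1) by (simp add: trace_family_def)
    have "map_poly \<psi> f \<noteq> 0" if "\<psi> \<in> set \<Psi>" for \<psi>
      using \<Psi>(2)[OF that] coeff_map_hom[OF R h[OF that], of f "degree f"] by auto
    then have "finite (\<Union>\<psi>\<in>set \<Psi>. {z. poly (map_poly \<psi> f) z = 0})"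
      by (intro finite_UN_I poly_roots_finite) auto
    moreover have "infinite (range of_nat :: complex set)"
      by (rule range_inj_infinite) (simp add: inj_on_def)
    ultimately obtain n :: nat where n: "of_nat n \<notin> (\<Union>\<psi>\<in>set \<Psi>. {z. poly (map_poly \<psi> f) z = 0})"
      by (meson finite_subset image_subsetI)
    let ?E = "\<lambda>\<psi>. extend_hom R x \<psi> (of_nat n)"
    have ker: "poly (map_poly \<psi> g) z = 0" if "over R g" "poly g x = 0" for g z \<psi>
      using tr[OF that] by simp
    have nR: "of_nat n \<in> R" by (simp add: rat_subring_Rats[OF R])
    have E: "?E \<psi> (poly g x) = \<psi> (poly g (of_nat n))" if "\<psi> \<in> set \<Psi>" "over R g" for \<psi> g
      by (simp add: extend_hom_poly[OF R h[OF that(1)] ker that(2)] nR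
          poly_map_hom[OF R h[OF that(1)] that(2)] hom_on_Rats[OF R h[OF that(1)]])
    have "(\<Sum>\<psi>\<leftarrow>map ?E \<Psi>. \<psi> z) \<in> \<rat>" if "z \<in> adjoin R x" for z
    proof -
      from that obtain g where g: "over R g" "z = poly g x" by (auto simp: adjoin_def)
      have "(\<Sum>\<psi>\<leftarrow>map ?E \<Psi>. \<psi> z) = (\<Sum>\<psi>\<leftarrow>\<Psi>. \<psi> (poly g (of_nat n)))"
        using g E by (auto simp: o_def intro!: arg_cong[where f = sum_list])
      then show ?thesis using \<Psi>(1) poly_over[OF R g(1) nR] by (simp add: trace_family_def)
    qed
    moreover have "hom_on (adjoin R x) (?E \<psi>)" if "\<psi> \<in> set \<Psi>" for \<psi>
      using hom_on_extend_hom[OF R h[OF that] ker] by blast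
    ultimately have "trace_family (adjoin R x) (map ?E \<Psi>)"
      using \<Psi>(1) by (auto simp: trace_family_def)
    moreover have "?E \<psi> y \<noteq> 0" if "\<psi> \<in> set \<Psi>" for \<psi>
      using n that extend_hom_poly[OF R h[OF that] ker f(1)] f(2) by auto
    ultimately show ?thesis by (intro exI[of _ "map ?E \<Psi>"]) auto
  qed
  with rat_subring_adjoin[OF R] show ?thesis by (simp add: specializable_def)
qed

text \<open>
  This transfers nonvanishing from the extension to the base ring: a homomorphism that does not kill
  the multiple \<open>c\<close> of \<open>y\<close> does not kill \<open>y\<close>. The constant arises as a nonzero polynomial \<open>e\<close> of
  least degree whose value at \<open>x\<close> is a multiple of \<open>y\<close>. By pseudo-division \<open>e\<close> divides \<open>m\<close> up to a
  constant, and the cofactor vanishes at \<open>x\<close>, hence has at least the degree of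
  \<open>m\<close>.
\<close>

lemma nonzero_divides_constant:
  assumes R: "rat_subring R" and m: "over R m" "m \<noteq> 0" "poly m x = 0"
    and minimal: "\<And>g. over R g \<Longrightarrow> poly g x = 0 \<Longrightarrow> g = 0 \<or> degree m \<le> degree g"
    and y: "y \<in> adjoin R x" "y \<noteq> 0"
  shows "\<exists>c\<in>R. c \<noteq> 0 \<and> (\<exists>u\<in>adjoin R x. c = u * y)"
proof -
  define P where "P g \<longleftrightarrow> over R g \<and> g \<noteq> 0 \<and> (\<exists>u\<in>adjoin R x. poly g x = u * y)" for g
  note A = rat_subring_adjoin[OF R, of x] 
  note cl = rat_subring_closed[OF A]
  have over_adjoin: "poly g x \<in> adjoin R x" if "over R g" for g
    using that by (auto simp: adjoin_def)
  obtain e where e: "P e" and e_min: "\<And>g. P g \<Longrightarrow> degree e \<le> degree g"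
  proof -
    have "P m" unfolding P_def using m y by (auto intro!: bexI[of _ 0] cl)
    then show ?thesis using that exists_least_lemma
      by (metis (no_types) ex_has_least_nat)
  qed
  have eo: "over R e" "e \<noteq> 0" using e by (auto simp: P_def)
  obtain u where u: "u \<in> adjoin R x" "poly e x = u * y" using e by (auto simp: P_def)
  have reduce: "\<exists>q k. over R q \<and> smult (lead_coeff e ^ k) g = q * e"
    if g: "over R g" "\<exists>w\<in>adjoin R x. poly g x = w * y" for g
  proof -
    obtain k q r where qr: "over R q" "over R r" "smult (lead_coeff e ^ k) g = q * e + r" "r = 0 \<or> degree r < degree e"
      using pseudo_division[OF R eo g(1)] by blast
    obtain w where w: "w \<in> adjoin R x" "poly g x = w * y" using g by blast
    have "poly r x = lead_coeff e ^ k * poly g x - poly q x * poly e x"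
      using arg_cong[OF qr(3), of "\<lambda>p. poly p x"] by simp
    also have "\<dots> = (lead_coeff e ^ k * w - poly q x * u) * y"
      by (simp add: u w algebra_simps)
    finally have "poly r x = (lead_coeff e ^ k * w - poly q x * u) * y" .
    moreover have "lead_coeff e \<in> adjoin R x" using eo subset_adjoin[OF R] by (auto simp: over_def)
    then have "lead_coeff e ^ k * w - poly q x * u \<in> adjoin R x"
      using w u over_adjoin[OF qr(1)] by (blast intro: cl(2-))
    ultimately have "r \<noteq> 0 \<Longrightarrow> P r" using qr by (auto simp: P_def)
    then have "r = 0" using e_min[of r] qr(4) by force
    then show ?thesis using qr by auto
  qed
  have "poly e x \<noteq> 0"
  proof
    assume ex: "poly e x = 0"
    obtain f where f: "over R f" "y = poly f x" using y by (auto simp: adjoin_def)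
    then obtain q k where "smult (lead_coeff e ^ k) f = q * e"
      using reduce[of f] cl(5) by (metis mult_1)
    from arg_cong[OF this, of "\<lambda>p. poly p x"] ex f y eo show False by simp
  qed
  moreover obtain q k where q: "over R q" "smult (lead_coeff e ^ k) m = q * e"
    using reduce[of m] m y by (auto intro!: bexI[of _ 0] cl)
  moreover have "poly q x * poly e x = 0"
    using arg_cong[OF q(2), of "\<lambda>p. poly p x"] by (simp add: m)
  ultimately have "poly q x = 0" by simp
  moreover have "q \<noteq> 0" using q m eo by auto
  ultimately have "degree m \<le> degree q" using minimal q by blast
  moreover have "degree m = degree q + degree e"
    using arg_cong[OF q(2), of degree] eo \<open>q \<noteq> 0\<close> by (simp add: degree_mult_eq)
  ultimately have "degree e = 0" by simp
  then obtain c where c: "e = [:c:]" by (rule degree_eq_zeroE)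
  then have "c \<in> R" "c \<noteq> 0" "c = u * y" using eo u by (auto simp: over_def dest: spec[of _ 0])
  then show ?thesis using u by blast
qed

text \<open>
  Each \<open>\<psi>\<close> is extended in all ways, sending \<open>x\<close> to the roots of the image of \<open>m\<close>. The trace over
  these roots is linear in the powers of \<open>x\<close>, and the power sums of the roots come from \<open>R\<close>. The
  degree of \<open>m\<close> is minimal among all polynomials over \<open>R\<close> that vanish at \<open>x\<close>, not only the monic ones,
  so that these are precisely the multiples of \<open>m\<close>.
\<close>

lemma specializable_adjoin_integral:
  assumes "specializable R" and m: "over R m" "lead_coeff m = 1" "poly m x = 0"
    and minimal: "\<And>g. over R g \<Longrightarrow> poly g x = 0 \<Longrightarrow> g = 0 \<or> degree m \<le> degree g"
  shows "specializable (adjoin R x)"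
proof -
  have R: "rat_subring R" using assms by (simp add: specializable_def)
  have m0: "m \<noteq> 0" using m by auto
  obtain s where s: "\<And>k. s k \<in> R"
    "\<And>\<psi> xs k. hom_on R \<psi> \<Longrightarrow> map_poly \<psi> m = monic_of_roots xs \<Longrightarrow> (\<Sum>x\<leftarrow>xs. x ^ k) = \<psi> (s k)"
    using power_sums_of_image[OF R m(1,2)] by blast
  define roots where "roots \<psi> = (SOME xs. map_poly \<psi> m = monic_of_roots xs)" for \<psi>
  have roots: "map_poly \<psi> m = monic_of_roots (roots \<psi>)" "length (roots \<psi>) = degree m" if h: "hom_on R \<psi>" for \<psi>
  proof -
    have deg: "degree (map_poly \<psi> m) = degree m"
      using m by (intro map_poly_degree_eq) (simp add: hom_on_one[OF R h])
    then have "lead_coeff (map_poly \<psi> m) = 1"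
      using m by (simp add: coeff_map_hom[OF R h] hom_on_one[OF R h])
    from someI_ex[OF complex_monic_splits[OF this]]
    show "map_poly \<psi> m = monic_of_roots (roots \<psi>)" by (simp add: roots_def)
    with deg show "length (roots \<psi>) = degree m" by simp
  qed
  have degm: "degree m > 0"
  proof (rule ccontr)
    assume "\<not> degree m > 0"
    then obtain c where "m = [:c:]" by (auto elim: degree_eq_zeroE)
    with m show False by auto
  qed
  have ker: "poly (map_poly \<psi> g) z = 0" if h: "hom_on R \<psi>" and z: "z \<in> set (roots \<psi>)" and g: "over R g" "poly g x = 0" for \<psi> z g
  proof -
    obtain k q r where qr: "over R q" "over R r" "smult (lead_coeff m ^ k) g = q * m + r" "r = 0 \<or> degree r < degree m"
      using pseudo_division[OF R m(1) m0 g(1)] by blast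
    have "poly r x = 0" using arg_cong[OF qr(3), of "\<lambda>p. poly p x"] m g by simp
    then have "r = 0" using minimal[OF qr(2)] qr(4) by force
    then have "map_poly \<psi> g = map_poly \<psi> q * map_poly \<psi> m"
      using qr m by (simp add: map_hom_mult[OF R h])
    moreover have "poly (map_poly \<psi> m) z = 0"
      using z by (auto simp: roots(1)[OF h] poly_monic_of_roots prod_list_zero_iff)
    ultimately show ?thesis by simp
  qed
  have "\<exists>\<Psi>. trace_family (adjoin R x) \<Psi> \<and> (\<forall>\<psi>\<in>set \<Psi>. \<psi> y \<noteq> 0)" if y: "y \<in> adjoin R x" "y \<noteq> 0" for y
  proof -
    obtain c u where c: "c \<in> R" "c \<noteq> 0" "u \<in> adjoin R x" "c = u * y"
      using nonzero_divides_constant[OF R m(1) m0 m(3) minimal y] by blast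
    with assms(1) obtain \<Psi> where \<Psi>: "trace_family R \<Psi>" "\<And>\<psi>. \<psi> \<in> set \<Psi> \<Longrightarrow> \<psi> c \<noteq> 0"
      unfolding specializable_def by blast
    have h: "hom_on R \<psi>" if "\<psi> \<in> set \<Psi>" for \<psi> using that \<Psi>(1) by (simp add: trace_family_def)
    define \<Psi>' where "\<Psi>' = concat (map (\<lambda>\<psi>. map (extend_hom R x \<psi>) (roots \<psi>)) \<Psi>)"
    have mem: "\<exists>\<psi>\<in>set \<Psi>. \<exists>z\<in>set (roots \<psi>). \<phi> = extend_hom R x \<psi> z" if "\<phi> \<in> set \<Psi>'" for \<phi>
      using that by (auto simp: \<Psi>'_def)
    have hom: "hom_on (adjoin R x) \<phi>" if "\<phi> \<in> set \<Psi>'" for \<phi>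
      using mem[OF that] hom_on_extend_hom[OF R h ker[OF h]] by blast
    have "(\<Sum>\<phi>\<leftarrow>\<Psi>'. \<phi> z) \<in> \<rat>" if "z \<in> adjoin R x" for z
    proof -
      from that obtain g where g: "over R g" "z = poly g x" by (auto simp: adjoin_def)
      have "(\<Sum>t\<leftarrow>roots \<psi>. extend_hom R x \<psi> t z) = \<psi> (\<Sum>i\<le>degree g. coeff g i * s i)" if "\<psi> \<in> set \<Psi>" for \<psi>
      proof -
        note h' = h[OF that]
        have "(\<Sum>t\<leftarrow>roots \<psi>. extend_hom R x \<psi> t z) = (\<Sum>t\<leftarrow>roots \<psi>. \<Sum>i\<le>degree g. \<psi> (coeff g i) * t ^ i)"
          using g by (intro arg_cong[where f = sum_list] map_cong)
            (auto simp: extend_hom_poly[OF R h' ker[OF h']] poly_map_hom_altdef[OF R h'])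
        also have "\<dots> = (\<Sum>i\<le>degree g. \<psi> (coeff g i) * \<psi> (s i))"
          by (simp add: sum_list_sum_swap sum_list_const_mult s(2)[OF h' roots(1)[OF h']])
        also have "\<dots> = \<psi> (\<Sum>i\<le>degree g. coeff g i * s i)"
          using g s(1) by (simp add: hom_on_sum[OF R h'] hom_on_mult[OF R h'] rat_subring_mult[OF R] over_def)
        finally show ?thesis .
      qed
      then have "(\<Sum>\<phi>\<leftarrow>\<Psi>'. \<phi> z) = (\<Sum>\<psi>\<leftarrow>\<Psi>. \<psi> (\<Sum>i\<le>degree g. coeff g i * s i))"
        unfolding \<Psi>'_def by (simp add: map_concat o_def sum_list_concat cong: map_cong)
      moreover have "(\<Sum>i\<le>degree g. coeff g i * s i) \<in> R"
        using g s(1) by (intro rat_subring_sum[OF R] rat_subring_mult[OF R]) (auto simp: over_def)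
      ultimately show ?thesis using \<Psi>(1) by (simp add: trace_family_def)
    qed
    moreover have "\<Psi>' \<noteq> []"
    proof -
      from \<Psi>(1) have "hd \<Psi> \<in> set \<Psi>" by (auto simp: trace_family_def)
      then have "hd \<Psi> \<in> set \<Psi>" "roots (hd \<Psi>) \<noteq> []" using roots(2)[OF h] degm by fastforce+
      then show ?thesis by (auto simp: \<Psi>'_def)
    qed
    ultimately have fam: "trace_family (adjoin R x) \<Psi>'" using hom by (auto simp: trace_family_def)
    have "\<phi> y \<noteq> 0" if \<phi>: "\<phi> \<in> set \<Psi>'" for \<phi>
    proof
      assume "\<phi> y = 0"
      then have "\<phi> c = 0" using hom_on_mult[OF rat_subring_adjoin[OF R] hom[OF \<phi>] c(3) y(1)] c(4) by simp
      moreover obtain \<psi> z where \<psi>: "\<psi> \<in> set \<Psi>" "z \<in> set (roots \<psi>)" "\<phi> = extend_hom R x \<psi> z"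
        using mem[OF \<phi>] by blast
      have "\<phi> (poly [:c:] x) = poly (map_poly \<psi> [:c:]) z" unfolding \<psi>(3)
        by (rule extend_hom_poly[OF R h[OF \<psi>(1)] ker[OF h[OF \<psi>(1)] \<psi>(2)]]) (use c in \<open>auto intro: over_const[OF R]\<close>)
      ultimately show False using \<Psi>(2)[OF \<psi>(1)] by (simp add: map_hom_const[OF R h[OF \<psi>(1)]])
    qed
    with fam show ?thesis by blast
  qed
  with rat_subring_adjoin[OF R] show ?thesis by (simp add: specializable_def)
qed

text \<open>
  If \<open>x\<close> is algebraic over \<open>R\<close> and \<open>l\<close> is the leading coefficient of a polynomial of least degree,
  then \<open>l * x\<close> is a root of a monic polynomial of the same degree. Adjoining \<open>l * x\<close> in place of \<open>x\<close>
  avoids a localization at each step; the denominators are dealt with once, at the end.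
\<close>

lemma specializable_extension:
  assumes "specializable R"
  shows "\<exists>R'. specializable R' \<and> R \<subseteq> R' \<and> (\<exists>D\<in>R'. D \<noteq> 0 \<and> D * x \<in> R')"
proof (cases "\<exists>g. over R g \<and> g \<noteq> 0 \<and> poly g x = 0")
  case False
  have R: "rat_subring R" using assms by (simp add: specializable_def)
  have "specializable (adjoin R x)"
    using False by (intro specializable_adjoin_transcendental assms) auto
  moreover have "1 \<in> adjoin R x" "x \<in> adjoin R x"
    using adjoin_self[OF R] rat_subring_one[OF rat_subring_adjoin[OF R]] by auto
  ultimately show ?thesis using subset_adjoin[OF R] by (intro exI[of _ "adjoin R x"]) (auto intro!: bexI[of _ 1])
next
  case True
  have R: "rat_subring R" using assms by (simp add: specializable_def)
  obtain g where g: "over R g" "g \<noteq> 0" "poly g x = 0"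
    and min: "\<And>f. over R f \<Longrightarrow> poly f x = 0 \<Longrightarrow> f = 0 \<or> degree g \<le> degree f"
    using True ex_has_least_nat[of "\<lambda>g. over R g \<and> g \<noteq> 0 \<and> poly g x = 0" _ degree] by metis
  define n where "n = degree g"
  define l where "l = lead_coeff g"
  have l: "l \<in> R" "l \<noteq> 0" using g by (auto simp: l_def over_def)
  have n: "n > 0"
  proof (rule ccontr)
    assume "\<not> n > 0"
    then obtain c where "g = [:c:]" by (auto simp: n_def elim: degree_eq_zeroE)
    with g show False by auto
  qed
  \<comment> \<open>The polynomial \<open>l ^ (n - 1) * g(X / l)\<close>.\<close>
  define m where "m = (\<Sum>i<n. monom (coeff g i * l ^ (n - 1 - i)) i) + monom 1 n"
  have cm: "coeff m i = (if i < n then coeff g i * l ^ (n - 1 - i) else if i = n then 1 else 0)" for i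
    by (auto simp: m_def coeff_sum)
  have "degree m = n"
    using cm by (intro antisym degree_le le_degree) auto
  then have lead: "lead_coeff m = 1" by (simp add: cm)
  have over_m: "over R m"
    unfolding over_def cm using g(1)
    by (simp add: over_def rat_subring_mult[OF R] rat_subring_power[OF R l(1)] rat_subring_one[OF R]
        rat_subring_zero[OF R])
  have "poly m (l * x) = (\<Sum>i\<le>n. coeff m i * (l * x) ^ i)"
    by (simp add: poly_altdef \<open>degree m = n\<close>)
  also have "\<dots> = (\<Sum>i\<le>n. l ^ (n - 1) * (coeff g i * x ^ i))"
  proof (intro sum.cong refl)
    fix i assume i: "i \<in> {..n}"
    show "coeff m i * (l * x) ^ i = l ^ (n - 1) * (coeff g i * x ^ i)"
    proof (cases "i < n")
      case True
      then have "l ^ (n - 1 - i) * l ^ i = l ^ (n - 1)" by (simp flip: power_add)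
      with True show ?thesis by (simp add: cm power_mult_distrib algebra_simps)
    next
      case False
      then have "i = n" using i by simp
      moreover have "l ^ n = l ^ (n - 1) * l" using n by (cases n) simp_all
      moreover have "coeff g n = l" by (simp add: l_def n_def)
      ultimately show ?thesis by (simp add: cm power_mult_distrib)
    qed
  qed
  also have "\<dots> = l ^ (n - 1) * poly g x"
    by (simp add: poly_altdef n_def sum_distrib_left)
  finally have root: "poly m (l * x) = 0" using g by simp
  have "specializable (adjoin R (l * x))"
  proof (rule specializable_adjoin_integral[OF assms over_m lead root])
    fix f assume f: "over R f" "poly f (l * x) = 0"
    let ?f = "\<Sum>i\<le>degree f. monom (coeff f i * l ^ i) i"
    have cf: "coeff ?f i = coeff f i * l ^ i" for i
      by (auto simp: coeff_sum coeff_eq_0)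
    have "over R ?f" using f(1) unfolding over_def cf
      by (simp add: rat_subring_mult[OF R] rat_subring_power[OF R l(1)])
    moreover have "poly ?f x = 0"
    proof -
      have "poly ?f x = poly f (l * x)"
        by (simp add: poly_sum poly_monom poly_altdef[of f] power_mult_distrib mult.assoc)
      with f show ?thesis by simp
    qed
    ultimately have "?f = 0 \<or> n \<le> degree ?f" using min by (simp add: n_def)
    moreover have "f = 0" if "?f = 0"
    proof (rule poly_eqI)
      fix i show "coeff f i = coeff 0 i" using cf[of i] l unfolding that by simp
    qed
    moreover have "degree ?f \<le> degree f" by (intro degree_le) (auto simp: cf coeff_eq_0)
    ultimately show "f = 0 \<or> degree m \<le> degree f" by (auto simp: \<open>degree m = n\<close>)
  qed
  then show ?thesis using subset_adjoin[OF R] adjoin_self[OF R] l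
    by (intro exI[of _ "adjoin R (l * x)"]) blast
qed

lemma specializable_fractions:
  assumes "finite B"
  shows "\<exists>R. specializable R \<and> (\<exists>D\<in>R. D \<noteq> 0 \<and> (\<forall>b\<in>B. D * b \<in> R))"
  using assms
proof (induction B rule: finite_induct)
  case empty
  show ?case using specializable_Rats by (intro exI[of _ \<rat>]) (auto intro!: bexI[of _ 1])
next
  case (insert b B)
  then obtain R D where R: "specializable R" "D \<in> R" "D \<noteq> 0" "\<forall>b\<in>B. D * b \<in> R" by blast
  obtain R' E where R': "specializable R'" "R \<subseteq> R'" "E \<in> R'" "E \<noteq> 0" "E * b \<in> R'"
    using specializable_extension[OF R(1)] by blast
  have mult: "x * y \<in> R'" if "x \<in> R'" "y \<in> R'" for x y
    using that R'(1) by (auto simp: specializable_def rat_subring_mult)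
  have "D * E * b \<in> R'" using mult[of D "E * b"] R R' by (auto simp: algebra_simps)
  moreover have "D * E * c \<in> R'" if "c \<in> B" for c using mult[of E "D * c"] R R' that by (auto simp: algebra_simps)
  ultimately show ?case using R R' mult[of D E] by (intro exI[of _ R'] conjI bexI[of _ "D * E"]) auto
qed

lemma char_poly_rational:
  assumes R: "rat_subring R" and \<Psi>: "trace_family R \<Psi>" and x: "x \<in> R"
  shows "coeff (monic_of_roots (map (\<lambda>\<psi>. \<psi> x) \<Psi>)) i \<in> \<rat>"
proof (rule rational_coeffs_of_power_sums)
  fix k
  have "(\<Sum>y\<leftarrow>map (\<lambda>\<psi>. \<psi> x) \<Psi>. y ^ k) = (\<Sum>\<psi>\<leftarrow>\<Psi>. \<psi> (x ^ k))"
    unfolding map_map o_def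
  proof (intro arg_cong[where f = sum_list] map_cong refl)
    fix \<psi> assume "\<psi> \<in> set \<Psi>"
    with \<Psi> have "hom_on R \<psi>" by (simp add: trace_family_def)
    from hom_on_power[OF R this x] show "\<psi> x ^ k = \<psi> (x ^ k)" by simp
  qed
  then show "(\<Sum>y\<leftarrow>map (\<lambda>\<psi>. \<psi> x) \<Psi>. y ^ k) \<in> \<rat>"
    using \<Psi> rat_subring_power[OF R x] by (simp add: trace_family_def)
qed

lemma norm_rational:
  assumes R: "rat_subring R" and \<Psi>: "trace_family R \<Psi>" and x: "x \<in> R"
  shows "(\<Prod>\<psi>\<leftarrow>\<Psi>. \<psi> x) \<in> \<rat>"
proof -
  have "(\<Prod>\<psi>\<leftarrow>\<Psi>. \<psi> x) = (\<Prod>\<psi>\<leftarrow>\<Psi>. 0 - \<psi> (- x))"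
  proof (intro arg_cong[where f = prod_list] map_cong refl)
    fix \<psi> assume "\<psi> \<in> set \<Psi>"
    with \<Psi> have "hom_on R \<psi>" by (simp add: trace_family_def)
    from hom_on_uminus[OF R this x] show "\<psi> x = 0 - \<psi> (- x)" by simp
  qed
  also have "\<dots> = coeff (monic_of_roots (map (\<lambda>\<psi>. \<psi> (- x)) \<Psi>)) 0"
    by (simp add: poly_monic_of_roots o_def flip: poly_0_coeff_0)
  finally show ?thesis using char_poly_rational[OF R \<Psi> rat_subring_uminus[OF R x], of 0] by simp
qed

lemma image_algebraic:
  assumes R: "rat_subring R" and \<Psi>: "trace_family R \<Psi>" and x: "x \<in> R" and \<psi>: "\<psi> \<in> set \<Psi>"
  shows "algebraic (\<psi> x)"
proof (rule algebraicI')
  show "poly (monic_of_roots (map (\<lambda>\<psi>. \<psi> x) \<Psi>)) (\<psi> x) = 0"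
    using \<psi> by (auto simp: poly_monic_of_roots prod_list_zero_iff)
qed (use char_poly_rational[OF R \<Psi> x] in auto)

text \<open>
  By Cayley-Hamilton the inverses of all \<open>\<psi> D\<close> are values of the same rational polynomial, hence the
  images of one ring element.
\<close>

lemma simultaneous_inverse:
  assumes R: "rat_subring R" and \<Psi>: "trace_family R \<Psi>" and D: "D \<in> R" and nz: "\<And>\<psi>. \<psi> \<in> set \<Psi> \<Longrightarrow> \<psi> D \<noteq> 0"
  shows "\<exists>e\<in>R. \<forall>\<psi>\<in>set \<Psi>. \<psi> e * \<psi> D = 1"
proof -
  define c where "c = monic_of_roots (map (\<lambda>\<psi>. \<psi> D) \<Psi>)"
  have c: "coeff c i \<in> \<rat>" for i unfolding c_def by (rule char_poly_rational[OF R \<Psi> D])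
  obtain a q where aq: "c = pCons a q" by (cases c)
  have q: "coeff q i \<in> \<rat>" for i using c[of "Suc i"] by (simp add: aq)
  have a: "a \<in> \<rat>" using c[of 0] by (simp add: aq)
  have "poly c 0 \<noteq> 0" using nz by (auto simp: c_def poly_monic_of_roots prod_list_zero_iff)
  then have a0: "a \<noteq> 0" by (simp add: aq)
  \<comment> \<open>The constant term \<open>a\<close> of the characteristic polynomial of \<open>D\<close> is not 0, and \<open>a = - D * q(D)\<close> under each \<open>\<psi>\<close>.\<close>
  define e where "e = - poly q D / a"
  have qD: "poly q D \<in> R" using q by (intro poly_over R D) (auto simp: over_def rat_subring_Rats[OF R])
  have "- inverse a \<in> R" using a by (intro rat_subring_Rats[OF R]) simp
  from rat_subring_mult[OF R this qD] have e: "e \<in> R" by (simp add: e_def field_simps)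
  have "\<psi> e * \<psi> D = 1" if \<psi>: "\<psi> \<in> set \<Psi>" for \<psi>
  proof -
    have h: "hom_on R \<psi>" using \<psi> \<Psi> by (simp add: trace_family_def)
    have "map_poly \<psi> q = q" by (rule poly_eqI) (simp add: coeff_map_hom[OF R h] hom_on_Rats[OF R h] q)
    then have pq: "\<psi> (poly q D) = poly q (\<psi> D)"
      using poly_map_hom[OF R h _ D, of q] q by (simp add: over_def rat_subring_Rats[OF R])
    have "poly c (\<psi> D) = 0" using \<psi> by (auto simp: c_def poly_monic_of_roots prod_list_zero_iff)
    then have "a + \<psi> D * poly q (\<psi> D) = 0" by (simp add: aq)
    moreover have "\<psi> (a * e) = a * \<psi> e"
      using hom_on_mult[OF R h rat_subring_Rats[OF R a] e] by (simp add: hom_on_Rats[OF R h a])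
    moreover have "a * e = - poly q D" using a0 by (simp add: e_def)
    ultimately have "a * \<psi> e = - poly q (\<psi> D)" by (simp add: hom_on_uminus[OF R h qD] pq)
    then have "a * (\<psi> e * \<psi> D) = - poly q (\<psi> D) * \<psi> D" by (simp only: mult.assoc[symmetric])
    also have "\<dots> = a" using \<open>a + \<psi> D * poly q (\<psi> D) = 0\<close> by (simp add: algebra_simps add_eq_0_iff)
    finally have "a * (\<psi> e * \<psi> D) = a" .
    then show ?thesis using a0 by simp
  qed
  with e show ?thesis by blast
qed

lemma specializable_finite:
  assumes "specializable R" and Y: "finite Y" "Y \<subseteq> R" "0 \<notin> Y"
  shows "\<exists>\<Psi>. trace_family R \<Psi> \<and> (\<forall>\<psi>\<in>set \<Psi>. \<forall>y\<in>Y. \<psi> y \<noteq> 0)"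
proof -
  have R: "rat_subring R" using assms by (simp add: specializable_def)
  have "\<Prod>Y \<in> R" using Y by (intro rat_subring_prod[OF R]) auto
  moreover have "\<Prod>Y \<noteq> 0" using Y by (simp add: prod_zero_iff)
  ultimately obtain \<Psi> where \<Psi>: "trace_family R \<Psi>" "\<forall>\<psi>\<in>set \<Psi>. \<psi> (\<Prod>Y) \<noteq> 0"
    using assms(1) unfolding specializable_def by blast
  have "\<psi> y \<noteq> 0" if "\<psi> \<in> set \<Psi>" "y \<in> Y" for \<psi> y
  proof -
    have h: "hom_on R \<psi>" using that \<Psi> by (simp add: trace_family_def)
    have "\<Prod>Y = y * \<Prod>(Y - {y})" using that Y by (simp add: prod.remove)
    moreover have "y \<in> R" "\<Prod>(Y - {y}) \<in> R" using that Y by (auto intro!: rat_subring_prod[OF R])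
    ultimately have "\<psi> (\<Prod>Y) = \<psi> y * \<psi> (\<Prod>(Y - {y}))" by (simp add: hom_on_mult[OF R h])
    then show ?thesis using \<Psi>(2) that by auto
  qed
  with \<Psi>(1) show ?thesis by blast
qed

text \<open>
  The ring is the localization of a specializable ring at a common denominator \<open>D\<close>. Multiplication
  with the element \<open>e\<close> of \<open>simultaneous_inverse\<close> plays the part of division by \<open>D\<close>, so each trace is again
  a trace of an element of the original ring.
\<close>

theorem specialization:
  assumes "finite B"
  shows "\<exists>R \<Psi>. rat_subring R \<and> B \<subseteq> R \<and> trace_family R \<Psi> \<and> (\<forall>\<psi>\<in>set \<Psi>. \<forall>b\<in>B. b \<noteq> 0 \<longrightarrow> \<psi> b \<noteq> 0)"
proof -
  obtain R D where RD: "specializable R" "D \<in> R" "D \<noteq> 0" "\<And>b. b \<in> B \<Longrightarrow> D * b \<in> R"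
    using specializable_fractions[OF assms] by blast
  have R: "rat_subring R" using RD by (simp add: specializable_def)
  define Y where "Y = insert D ((*) D ` (B - {0}))"
  have "finite Y" "Y \<subseteq> R" "0 \<notin> Y" using RD assms by (auto simp: Y_def)
  then obtain \<Psi> where \<Psi>: "trace_family R \<Psi>" and nz: "\<And>\<psi> y. \<psi> \<in> set \<Psi> \<Longrightarrow> y \<in> Y \<Longrightarrow> \<psi> y \<noteq> 0"
    using specializable_finite[OF RD(1)] by metis
  have nzD: "\<psi> D \<noteq> 0" if "\<psi> \<in> set \<Psi>" for \<psi> using nz[OF that] by (simp add: Y_def)
  obtain e where e: "e \<in> R" "\<And>\<psi>. \<psi> \<in> set \<Psi> \<Longrightarrow> \<psi> e * \<psi> D = 1"
    using simultaneous_inverse[OF R \<Psi> RD(2)] nzD by blast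
  have h: "hom_on R \<psi>" if "\<psi> \<in> set \<Psi>" for \<psi> using that \<Psi> by (simp add: trace_family_def)
  \<comment> \<open>The localization of \<open>R\<close> at \<open>D\<close>; the value of \<open>\<phi> \<psi>\<close> does not depend on the exponent \<open>k\<close>.\<close>
  define R' where "R' = {z. \<exists>k. D ^ k * z \<in> R}"
  define \<phi> where "\<phi> \<psi> z = \<psi> (D ^ (SOME k. D ^ k * z \<in> R) * z) * \<psi> e ^ (SOME k. D ^ k * z \<in> R)" for \<psi> :: "complex \<Rightarrow> complex" and z
  have Dk: "D ^ k \<in> R" for k by (rule rat_subring_power[OF R RD(2)])
  have up: "D ^ (k + l) * z \<in> R \<and> \<psi> (D ^ (k + l) * z) * \<psi> e ^ (k + l) = \<psi> (D ^ k * z) * \<psi> e ^ k"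
    if "\<psi> \<in> set \<Psi>" "D ^ k * z \<in> R" for \<psi> k l z
  proof -
    have eq: "D ^ (k + l) * z = D ^ l * (D ^ k * z)" by (simp add: power_add algebra_simps)
    have "\<psi> (D ^ (k + l) * z) * \<psi> e ^ (k + l) = \<psi> (D ^ k * z) * \<psi> e ^ k * (\<psi> e * \<psi> D) ^ l"
      unfolding eq hom_on_mult[OF R h[OF that(1)] Dk that(2)] hom_on_power[OF R h[OF that(1)] RD(2)]
      by (simp add: power_add power_mult_distrib algebra_simps)
    then show ?thesis using rat_subring_mult[OF R Dk that(2), of l] by (simp only: eq e(2)[OF that(1)] power_one) simp
  qed
  have \<phi>: "\<phi> \<psi> z = \<psi> (D ^ k * z) * \<psi> e ^ k" if \<psi>: "\<psi> \<in> set \<Psi>" and k: "D ^ k * z \<in> R" for \<psi> z k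
  proof -
    define l where "l = (SOME k. D ^ k * z \<in> R)"
    have l: "D ^ l * z \<in> R" unfolding l_def by (rule someI[of "\<lambda>k. D ^ k * z \<in> R", OF k])
    have "\<psi> (D ^ l * z) * \<psi> e ^ l = \<psi> (D ^ (l + k) * z) * \<psi> e ^ (l + k)" using up[OF \<psi> l, of k] by simp
    also have "\<dots> = \<psi> (D ^ k * z) * \<psi> e ^ k" using up[OF \<psi> k, of l] by (simp add: add.commute)
    finally show ?thesis by (simp add: \<phi>_def flip: l_def)
  qed
  have sub: "R \<subseteq> R'" by (auto simp: R'_def intro!: exI[of _ 0])
  have common: "\<exists>k. D ^ k * x \<in> R \<and> D ^ k * y \<in> R" if xy: "x \<in> R'" "y \<in> R'" for x y
  proof -
    from xy obtain k l where kl: "D ^ k * x \<in> R" "D ^ l * y \<in> R" by (auto simp: R'_def)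
    have "D ^ (k + l) * x = D ^ l * (D ^ k * x)" "D ^ (k + l) * y = D ^ k * (D ^ l * y)"
      by (simp_all add: power_add algebra_simps)
    then show ?thesis using rat_subring_mult[OF R Dk kl(1)] rat_subring_mult[OF R Dk kl(2)] by metis
  qed
  have add: "D ^ k * (x + y) \<in> R" if "D ^ k * x \<in> R" "D ^ k * y \<in> R" for k x y
    using rat_subring_add[OF R that] by (simp add: algebra_simps)
  have mult: "D ^ (k + k) * (x * y) \<in> R" if "D ^ k * x \<in> R" "D ^ k * y \<in> R" for k x y
    using rat_subring_mult[OF R that] by (simp add: algebra_simps power_add)
  have R': "rat_subring R'"
    unfolding rat_subring_def
  proof (intro conjI ballI)
    show "\<rat> \<subseteq> R'" using sub rat_subring_Rats[OF R] by auto
    fix x y assume "x \<in> R'" "y \<in> R'"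
    then obtain k where "D ^ k * x \<in> R" "D ^ k * y \<in> R" using common by blast
    with add mult show "x + y \<in> R'" "x * y \<in> R'" unfolding R'_def by blast+
  qed
  have hom: "hom_on R' (\<phi> \<psi>)" if \<psi>: "\<psi> \<in> set \<Psi>" for \<psi>
    unfolding hom_on_def
  proof (intro conjI ballI)
    show "\<phi> \<psi> 1 = 1" using \<phi>[OF \<psi>, of 0 1] by (simp add: rat_subring_one[OF R] hom_on_one[OF R h[OF \<psi>]])
    fix x y assume "x \<in> R'" "y \<in> R'"
    then obtain k where k: "D ^ k * x \<in> R" "D ^ k * y \<in> R" using common by blast
    show "\<phi> \<psi> (x + y) = \<phi> \<psi> x + \<phi> \<psi> y"
      using \<phi>[OF \<psi> add[OF k]] hom_on_add[OF R h[OF \<psi>] k] by (simp add: \<phi>[OF \<psi> k(1)] \<phi>[OF \<psi> k(2)] algebra_simps)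
    have "D ^ (k + k) * (x * y) = (D ^ k * x) * (D ^ k * y)" by (simp add: power_add algebra_simps)
    then show "\<phi> \<psi> (x * y) = \<phi> \<psi> x * \<phi> \<psi> y"
      using \<phi>[OF \<psi> mult[OF k]] hom_on_mult[OF R h[OF \<psi>] k]
      by (simp add: \<phi>[OF \<psi> k(1)] \<phi>[OF \<psi> k(2)] power_add algebra_simps)
  qed
  have "(\<Sum>\<psi>\<leftarrow>map \<phi> \<Psi>. \<psi> z) \<in> \<rat>" if "z \<in> R'" for z
  proof -
    from that obtain k where k: "D ^ k * z \<in> R" by (auto simp: R'_def)
    have "(\<Sum>\<psi>\<leftarrow>map \<phi> \<Psi>. \<psi> z) = (\<Sum>\<psi>\<leftarrow>\<Psi>. \<phi> \<psi> z)" by (simp add: o_def)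
    also have "\<dots> = (\<Sum>\<psi>\<leftarrow>\<Psi>. \<psi> (D ^ k * z * e ^ k))"
    proof (intro arg_cong[where f = sum_list] map_cong refl)
      fix \<psi> assume \<psi>: "\<psi> \<in> set \<Psi>"
      show "\<phi> \<psi> z = \<psi> (D ^ k * z * e ^ k)"
        unfolding \<phi>[OF \<psi> k] hom_on_mult[OF R h[OF \<psi>] k rat_subring_power[OF R e(1)]] hom_on_power[OF R h[OF \<psi>] e(1)] ..
    qed
    also have "\<dots> \<in> \<rat>" using \<Psi> rat_subring_mult[OF R k rat_subring_power[OF R e(1)]] by (simp add: trace_family_def)
    finally show ?thesis .
  qed
  then have "trace_family R' (map \<phi> \<Psi>)" using hom \<Psi> by (auto simp: trace_family_def)
  moreover have "B \<subseteq> R'" using RD(4) by (auto simp: R'_def intro!: exI[of _ 1])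
  moreover have "\<phi> \<psi> b \<noteq> 0" if "\<psi> \<in> set \<Psi>" "b \<in> B" "b \<noteq> 0" for \<psi> b
    using \<phi>[OF that(1), of 1 b] RD(4)[OF that(2)] nz[OF that(1), of "D * b"] e(2)[OF that(1)] that
    by (auto simp: Y_def)
  ultimately show ?thesis using R' by (intro exI[of _ R'] exI[of _ "map \<phi> \<Psi>"]) auto
qed

section \<open>Extending a p-adic absolute value\<close>

definition units_of_ring :: "complex set \<Rightarrow> complex set" where
  "units_of_ring V = {x \<in> V. x \<noteq> 0 \<and> inverse x \<in> V}"

lemma
  assumes V: "csubring V"
  shows unit_one: "1 \<in> units_of_ring V"
    and unit_mult: "x \<in> units_of_ring V \<Longrightarrow> y \<in> units_of_ring V \<Longrightarrow> x * y \<in> units_of_ring V"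
    and unit_inverse: "x \<in> units_of_ring V \<Longrightarrow> inverse x \<in> units_of_ring V"
    and unit_power: "x \<in> units_of_ring V \<Longrightarrow> x ^ n \<in> units_of_ring V"
proof -
  show one: "1 \<in> units_of_ring V" by (simp add: units_of_ring_def csubring_one[OF V])
  show mult: "x * y \<in> units_of_ring V" if "x \<in> units_of_ring V" "y \<in> units_of_ring V" for x y
    using that by (auto simp: units_of_ring_def csubring_mult[OF V])
  show inv: "inverse x \<in> units_of_ring V" if "x \<in> units_of_ring V" for x
    using that by (auto simp: units_of_ring_def)
  show "x ^ n \<in> units_of_ring V" if "x \<in> units_of_ring V" for x n
    by (induction n) (auto simp: that one mult)
qed

text \<open>
  A subring of the complex numbers that is maximal among those without \<open>1 / p\<close> is a valuation ring,
  and \<open>p\<close> is not a unit. Its valuation need not have rank one, but some power of a nonzero algebraic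
  number differs from a power of \<open>p\<close> by a unit only, which gives a real absolute value on these.
\<close>

locale maximal_ring =
  fixes p :: nat and V :: "complex set"
  assumes prime: "prime p" and V: "csubring V" and p_not_unit: "1 / of_nat p \<notin> V"
    and maximal: "\<And>W. csubring W \<Longrightarrow> V \<subseteq> W \<Longrightarrow> 1 / of_nat p \<notin> W \<Longrightarrow> W = V"
begin

lemma p_nonzero: "(of_nat p :: complex) \<noteq> 0"
  using prime by auto

lemma p_in: "of_nat p \<in> V"
  by (rule csubring_of_nat[OF V])

text \<open>
  Inverting \<open>1 - p b\<close> does not bring \<open>1 / p\<close> into the ring, because each of its powers is again of the
  form \<open>1 - p c\<close>.
\<close>

lemma one_minus_p_unit:
  assumes b: "b \<in> V"
  shows "1 - of_nat p * b \<in> units_of_ring V"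
proof -
  define u where "u = 1 - of_nat p * b"
  note cl = csubring_closed[OF V]
  have u: "u \<in> V" unfolding u_def by (intro cl p_in b)
  have u0: "u \<noteq> 0"
  proof
    assume "u = 0"
    then have "b = 1 / of_nat p" using p_nonzero by (simp add: u_def field_simps)
    with b p_not_unit show False by simp
  qed
  have pow: "\<exists>c\<in>V. u ^ k = 1 - of_nat p * c" for k
  proof (induction k)
    case 0
    show ?case by (intro bexI[of _ 0]) (auto intro: cl)
  next
    case (Suc k)
    then obtain c where c: "c \<in> V" "u ^ k = 1 - of_nat p * c" by blast
    have "u ^ Suc k = u * (1 - of_nat p * c)" using c by simp
    also have "\<dots> = 1 - of_nat p * (c + b - of_nat p * b * c)"
      by (simp add: u_def algebra_simps)
    finally have "u ^ Suc k = 1 - of_nat p * (c + b - of_nat p * b * c)" .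
    moreover have "c + b - of_nat p * b * c \<in> V" by (intro cl p_in b c)
    ultimately show ?case by blast
  qed
  \<comment> \<open>The localization of \<open>V\<close> at \<open>u\<close>.\<close>
  define W where "W = {x. \<exists>k. x * u ^ k \<in> V}"
  have uk: "u ^ k \<in> V" for k by (intro cl u)
  have common: "\<exists>k. x * u ^ k \<in> V \<and> y * u ^ k \<in> V" if xy: "x \<in> W" "y \<in> W" for x y
  proof -
    from xy obtain k l where kl: "x * u ^ k \<in> V" "y * u ^ l \<in> V" by (auto simp: W_def)
    have "x * u ^ (k + l) \<in> V" "y * u ^ (k + l) \<in> V"
      using csubring_mult[OF V kl(1) uk[of l]] csubring_mult[OF V kl(2) uk[of k]]
      by (simp_all add: power_add algebra_simps)
    then show ?thesis by blast
  qed
  have "csubring W"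
    unfolding csubring_def
  proof (intro conjI ballI)
    show "1 \<in> W" unfolding W_def using uk[of 0] by (auto intro!: exI[of _ 0])
    fix x y assume "x \<in> W" "y \<in> W"
    then obtain k where k: "x * u ^ k \<in> V" "y * u ^ k \<in> V" using common by blast
    have "(x - y) * u ^ k \<in> V" using csubring_diff[OF V k] by (simp add: algebra_simps)
    then show "x - y \<in> W" by (auto simp: W_def)
    have "(x * y) * u ^ (k + k) \<in> V" using csubring_mult[OF V k] by (simp add: power_add algebra_simps)
    then show "x * y \<in> W" unfolding W_def by blast
  qed
  moreover have "V \<subseteq> W" by (auto simp: W_def intro!: exI[of _ 0])
  moreover have "1 / of_nat p \<notin> W"
  proof
    assume "1 / of_nat p \<in> W"
    then obtain k where k: "1 / of_nat p * u ^ k \<in> V" by (auto simp: W_def)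
    obtain c where c: "c \<in> V" "u ^ k = 1 - of_nat p * c" using pow by blast
    have "1 / of_nat p = 1 / of_nat p * u ^ k + c"
      using p_nonzero by (simp add: c field_simps)
    also have "\<dots> \<in> V" by (intro cl k c)
    finally show False using p_not_unit by simp
  qed
  ultimately have "W = V" by (rule maximal)
  moreover have "inverse u \<in> W" unfolding W_def using u0 csubring_one[OF V] by (auto intro!: exI[of _ 1])
  ultimately show ?thesis using u u0 by (simp add: units_of_ring_def u_def)
qed

lemma one_in_p_adjoin:
  assumes "x \<notin> V"
  shows "\<exists>g. over V g \<and> of_nat p * poly g x = 1"
proof -
  have "1 / of_nat p \<in> adjoin V x"
    using maximal[OF csubring_adjoin[OF V, of x] csubring_subset_adjoin[OF V]] assms
      csubring_adjoin_self[OF V, of x] by auto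
  then obtain g where "over V g" "1 / of_nat p = poly g x" by (auto simp: adjoin_def)
  then show ?thesis using p_nonzero by (intro exI[of _ g]) (auto simp: field_simps)
qed

text \<open>
  If \<open>x\<close> and its inverse \<open>y\<close> are both outside \<open>V\<close>, then adjoining either of them yields \<open>1 / p\<close>, that
  is, relations \<open>p * g(x) = 1\<close> and \<open>p * h(y) = 1\<close>. The relation of lower degree is solved for
  \<open>1 - p * h(0)\<close>, a unit, and multiplied with \<open>x ^ n\<close>; this replaces the top term of the other one by
  terms of lower degree.
\<close>

lemma no_minimal_relations:
  assumes xy: "x * y = 1"
    and g: "over V g" "of_nat p * poly g x = 1"
    and g_min: "\<And>f. over V f \<Longrightarrow> of_nat p * poly f x = 1 \<Longrightarrow> degree g \<le> degree f"
    and h: "over V h" "of_nat p * poly h y = 1" and deg: "degree h \<le> degree g"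
  shows False
proof -
  note cl = csubring_closed[OF V]
  define n m where "n = degree g" and "m = degree h"
  have cg: "coeff g i \<in> V" and ch: "coeff h i \<in> V" for i using g h by (auto simp: over_def)
  have n: "n > 0"
  proof (rule ccontr)
    assume "\<not> n > 0"
    then obtain c where "g = [:c:]" by (auto simp: n_def elim: degree_eq_zeroE)
    with g cg[of 0] have "c \<in> V" "of_nat p * c = 1" by auto
    moreover from this have "c = 1 / of_nat p" using p_nonzero by (simp add: eq_divide_eq mult.commute)
    ultimately show False using p_not_unit by simp
  qed
  define u where "u = 1 - of_nat p * coeff h 0"
  have u: "u \<in> units_of_ring V" unfolding u_def by (rule one_minus_p_unit[OF ch])
  then have u': "u \<noteq> 0" "inverse u \<in> V" by (auto simp: units_of_ring_def)
  \<comment> \<open>The value of \<open>p * k\<close> at \<open>x\<close> is \<open>x ^ n\<close>, but its degree is less than \<open>n\<close>.\<close>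
  define k where "k = (\<Sum>i\<in>{1..m}. monom (inverse u * coeff h i) (n - i))"
  have k: "over V k" unfolding over_def
    by (auto simp: k_def coeff_sum intro!: csubring_sum[OF V] cl ch u')
  have degk: "degree k \<le> n - 1" unfolding k_def
    by (intro degree_sum_le) (auto intro!: order.trans[OF degree_monom_le])
  have hy: "poly h y = coeff h 0 + (\<Sum>i\<in>{1..m}. coeff h i * y ^ i)"
  proof -
    have "{..m} = insert 0 {1..m}" by auto
    then show ?thesis by (simp add: poly_altdef m_def)
  qed
  have "poly k x = inverse u * (\<Sum>i\<in>{1..m}. coeff h i * x ^ (n - i))"
    by (simp add: k_def poly_sum poly_monom sum_distrib_left mult.assoc)
  also have "\<dots> = inverse u * (\<Sum>i\<in>{1..m}. x ^ n * (coeff h i * y ^ i))"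
  proof -
    have "x ^ (n - i) = x ^ n * y ^ i" if "i \<in> {1..m}" for i
    proof -
      have "x ^ n = x ^ (n - i) * x ^ i" using that deg by (simp add: n_def m_def flip: power_add)
      then have "x ^ n * y ^ i = x ^ (n - i) * (x * y) ^ i" by (simp add: power_mult_distrib)
      then show ?thesis by (simp add: xy)
    qed
    then show ?thesis by (auto intro!: sum.cong)
  qed
  also have "\<dots> = x ^ n * (inverse u * (\<Sum>i\<in>{1..m}. coeff h i * y ^ i))"
    by (simp add: sum_distrib_left algebra_simps)
  finally have kx: "of_nat p * poly k x = x ^ n * (inverse u * (of_nat p * (\<Sum>i\<in>{1..m}. coeff h i * y ^ i)))"
    by (simp add: algebra_simps)
  have "of_nat p * (\<Sum>i\<in>{1..m}. coeff h i * y ^ i) = u"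
    using h(2) by (simp add: hy u_def algebra_simps)
  then have kx: "of_nat p * poly k x = x ^ n" using kx u' by simp
  define f where "f = g - monom (coeff g n) n + smult (of_nat p * coeff g n) k"
  have "over V f" unfolding f_def
    by (intro csubring_over_add[OF V] csubring_over_diff[OF V] csubring_over_smult[OF V]
        csubring_over_monom[OF V] g k cg cl p_in)
  moreover have "of_nat p * poly f x = 1"
    using g kx by (simp add: f_def poly_monom algebra_simps)
  moreover have "degree f \<le> n - 1"
    unfolding f_def
  proof (intro degree_add_le)
    have "degree (g - monom (coeff g n) n) \<le> n"
      by (intro degree_diff_le) (auto simp: n_def degree_monom_le)
    moreover have "coeff (g - monom (coeff g n) n) n = 0" by simp
    ultimately show "degree (g - monom (coeff g n) n) \<le> n - 1"
      by (metis (no_types) Suc_diff_1 coeff_eq_0 degree_0 leading_coeff_0_iff le_SucE le_zero_eq n nat_le_linear)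
    show "degree (smult (of_nat p * coeff g n) k) \<le> n - 1" using degk degree_smult_le[of _ k] by (rule order.trans[rotated])
  qed
  ultimately show False using g_min[of f] n by (simp add: n_def)
qed

lemma valuation_ring:
  assumes "x \<noteq> 0" "x \<notin> V"
  shows "inverse x \<in> V"
proof (rule ccontr)
  assume "inverse x \<notin> V"
  define P where "P y g \<longleftrightarrow> over V g \<and> of_nat p * poly g y = 1" for y g
  have ex: "\<exists>g. P y g \<and> (\<forall>f. P y f \<longrightarrow> degree g \<le> degree f)" if "y \<notin> V" for y
    using one_in_p_adjoin[OF that] ex_has_least_nat[of "P y" _ degree] unfolding P_def by blast
  obtain g where g: "P x g" "\<And>f. P x f \<Longrightarrow> degree g \<le> degree f" using ex[OF assms(2)] by blast
  obtain h where h: "P (inverse x) h" "\<And>f. P (inverse x) f \<Longrightarrow> degree h \<le> degree f"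
    using ex[OF \<open>inverse x \<notin> V\<close>] by blast
  show False
  proof (cases "degree h \<le> degree g")
    case True
    show False by (rule no_minimal_relations[of x "inverse x" g h]) (use g h True assms in \<open>auto simp: P_def\<close>)
  next
    case False
    show False by (rule no_minimal_relations[of "inverse x" x h g]) (use g h False assms in \<open>auto simp: P_def\<close>)
  qed
qed

abbreviation "U \<equiv> units_of_ring V"

lemma nonunit_add:
  assumes "x \<in> V - U" "y \<in> V - U"
  shows "x + y \<in> V - U"
proof -
  note cl = csubring_closed[OF V]
  have absorb: "a * b \<in> V - U" if a: "a \<in> V - U" and b: "b \<in> V" for a b
  proof -
    have "a * b \<notin> U"
    proof
      assume ab: "a * b \<in> U"
      then have "a \<noteq> 0" "b \<noteq> 0" "inverse (a * b) \<in> V" by (auto simp: units_of_ring_def)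
      moreover have "inverse (a * b) * b \<in> V" using calculation b by (intro cl)
      moreover have "inverse (a * b) * b = inverse a" using \<open>b \<noteq> 0\<close> by simp
      ultimately have "inverse a \<in> V" by metis
      with a \<open>a \<noteq> 0\<close> show False by (simp add: units_of_ring_def)
    qed
    with a b show ?thesis by (auto intro: cl)
  qed
  show ?thesis
  proof (cases "x = 0 \<or> y = 0")
    case True
    with assms show ?thesis by auto
  next
    case False
    show ?thesis
    proof (cases "x / y \<in> V")
      case True
      have "x + y = y * (1 + x / y)" using False by (simp add: field_simps)
      moreover have "1 + x / y \<in> V" by (intro cl True)
      ultimately show ?thesis using absorb[OF assms(2)] by simp
    next
      case xy: False
      then have "y / x \<in> V" using valuation_ring[of "x / y"] False by simp
      moreover have "x + y = x * (1 + y / x)" using False by (simp add: field_simps)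
      moreover have "1 + y / x \<in> V" by (intro cl calculation)
      ultimately show ?thesis using absorb[OF assms(1)] by simp
    qed
  qed
qed

lemma int_unit:
  assumes "\<not> int p dvd q"
  shows "of_int q \<in> U"
proof -
  have "coprime (int p) q" using prime assms by (simp add: prime_imp_coprime)
  then obtain a b where ab: "a * int p + b * q = 1" using bezout_int[of "int p" q] by auto
  have "b * q = 1 - int p * a" using ab by (simp add: algebra_simps)
  then have "of_int b * of_int q = 1 - of_nat p * (of_int a :: complex)"
    by (metis of_int_1 of_int_diff of_int_mult of_int_of_nat_eq)
  moreover have "1 - of_nat p * of_int a \<in> U" by (intro one_minus_p_unit csubring_of_int[OF V])
  ultimately have bq: "of_int b * of_int q \<in> U" by simp
  then have q: "q \<noteq> 0" and b: "b \<noteq> 0" by (auto simp: units_of_ring_def)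
  have "of_int b * inverse (of_int b * of_int q :: complex) \<in> V"
    using bq by (auto simp: units_of_ring_def intro!: csubring_closed[OF V])
  moreover have "of_int b * inverse (of_int b * of_int q :: complex) = inverse (of_int q)" using b by simp
  ultimately have "inverse (of_int q) \<in> V" by metis
  then show ?thesis using q csubring_of_int[OF V] by (simp add: units_of_ring_def)
qed

lemma p_powi_unit_iff: "of_nat p powi k \<in> U \<longleftrightarrow> k = 0"
proof
  assume k: "of_nat p powi k \<in> U"
  have "of_nat p ^ n \<notin> U" if "n > 0" for n
  proof
    assume "of_nat p ^ n \<in> U"
    then have "inverse (of_nat p ^ n) * of_nat p ^ (n - 1) \<in> V"
      by (intro csubring_mult[OF V] csubring_power[OF V] p_in) (auto simp: units_of_ring_def)
    moreover have "inverse (of_nat p ^ n) * of_nat p ^ (n - 1) = 1 / (of_nat p :: complex)"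
      using that p_nonzero by (cases n) (auto simp: field_simps)
    ultimately show False using p_not_unit by simp
  qed
  moreover have "of_nat p powi (- k) \<in> U" using unit_inverse[OF V k] by (simp add: power_int_minus)
  ultimately show "k = 0" using k
    by (cases k rule: int_cases3) auto
qed (simp add: unit_one[OF V])

lemma p_powi_in_iff: "of_nat p powi k \<in> V \<longleftrightarrow> k \<ge> 0"
proof
  assume k: "of_nat p powi k \<in> V"
  show "k \<ge> 0"
  proof (rule ccontr)
    assume "\<not> k \<ge> 0"
    then have "of_nat p powi (- k) \<in> V" using csubring_power[OF V p_in] by (simp add: power_int_def)
    with k have "of_nat p powi k \<in> U" using p_nonzero by (simp add: units_of_ring_def power_int_minus)
    with \<open>\<not> k \<ge> 0\<close> show False by (simp add: p_powi_unit_iff)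
  qed
qed (use csubring_power[OF V p_in] in \<open>simp add: power_int_def\<close>)

text \<open>
  The valuation of \<open>x\<close> is \<open>k / n\<close>, when that of \<open>p\<close> is 1.
\<close>

definition has_val :: "complex \<Rightarrow> nat \<Rightarrow> int \<Rightarrow> bool" where
  "has_val x n k \<longleftrightarrow> n > 0 \<and> x \<noteq> 0 \<and> x ^ n / of_nat p powi k \<in> U"

lemma has_val_scale:
  assumes "has_val x n k" "m > 0"
  shows "has_val x (n * m) (k * int m)"
proof -
  have "(x ^ n / of_nat p powi k) ^ m \<in> U" using assms by (intro unit_power[OF V]) (simp add: has_val_def)
  with assms show ?thesis by (simp add: has_val_def power_divide power_mult power_int_mult)
qed

lemma has_val_mult_same:
  assumes "has_val x n k" "has_val y n l"
  shows "has_val (x * y) n (k + l)"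
proof -
  have "(x ^ n / of_nat p powi k) * (y ^ n / of_nat p powi l) \<in> U"
    using assms by (intro unit_mult[OF V]) (simp_all add: has_val_def)
  with assms show ?thesis using p_nonzero by (simp add: has_val_def power_mult_distrib power_int_add)
qed

lemma has_val_inverse:
  assumes "has_val x n k"
  shows "has_val (inverse x) n (- k)"
  using assms unit_inverse[OF V, of "x ^ n / of_nat p powi k"] 
  by (auto simp: has_val_def power_int_minus field_simps)

lemma has_val_unique:
  assumes "has_val x n k" "has_val x m l"
  shows "k * int m = l * int n"
proof -
  have nm: "n > 0" "m > 0" using assms by (auto simp: has_val_def)
  have "has_val x (n * m) (k * int m)" "has_val x (n * m) (l * int n)"
    using has_val_scale[OF assms(1) nm(2)] has_val_scale[OF assms(2) nm(1)] by (simp_all add: mult.commute)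
  then have "has_val (inverse x * x) (n * m) (- (k * int m) + l * int n)"
    by (intro has_val_mult_same has_val_inverse)
  moreover have "x \<noteq> 0" using assms by (simp add: has_val_def)
  ultimately have "1 / of_nat p powi (- (k * int m) + l * int n) \<in> U" by (simp add: has_val_def)
  then have "of_nat p powi (- (- (k * int m) + l * int n)) \<in> U" by (simp only: power_int_minus_divide)
  then show ?thesis by (simp add: p_powi_unit_iff)
qed

definition padic_abs :: "complex \<Rightarrow> real" where
  "padic_abs x = (if \<exists>n k. has_val x n k
     then (let (n, k) = (SOME (n, k). has_val x n k) in p powr (- (of_int k / of_nat n))) else 0)"

lemma padic_abs_eq:
  assumes "has_val x n k"
  shows "padic_abs x = p powr (- (of_int k / of_nat n))"
proof -
  obtain m l where ml: "(SOME (n, k). has_val x n k) = (m, l)" by (cases "SOME (n, k). has_val x n k")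
  have "has_val x m l"
    using someI[of "\<lambda>(n, k). has_val x n k" "(n, k)"] assms unfolding ml by simp
  from has_val_unique[OF this assms] have "real_of_int l * real n = real_of_int k * real m"
    by (metis of_int_mult of_int_of_nat_eq)
  moreover have "n > 0" "m > 0" using assms \<open>has_val x m l\<close> by (auto simp: has_val_def)
  ultimately have "real_of_int l / real m = of_int k / of_nat n" by (simp add: field_simps)
  moreover have "padic_abs x = p powr (- (of_int l / of_nat m))"
    unfolding padic_abs_def ml using assms by auto
  ultimately show ?thesis by simp
qed

lemma padic_abs_nonneg: "padic_abs x \<ge> 0"
  by (simp add: padic_abs_def split: prod.splits)

lemma padic_abs_0 [simp]: "padic_abs 0 = 0"
  by (simp add: padic_abs_def has_val_def)

lemma rat_has_val:
  assumes "q \<in> \<rat>" "q \<noteq> 0"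
  shows "\<exists>k. has_val q 1 k"
proof -
  have int: "\<exists>k. has_val (of_int a) 1 k" if a0: "a \<noteq> 0" for a
  proof -
    have "\<not> is_unit (int p)" using prime_gt_1_nat[OF prime] by simp
    then obtain b where b: "a = int p ^ multiplicity (int p) a * b" "\<not> int p dvd b"
      using multiplicity_decompose'[OF a0] by blast
    then have "of_int a / of_nat p powi int (multiplicity (int p) a) = (of_int b :: complex)"
      using p_nonzero by (metis nonzero_mult_div_cancel_left of_int_mult of_int_of_nat_eq of_int_power power_int_of_nat power_not_zero)
    with int_unit[OF b(2)] a0 show ?thesis by (auto simp: has_val_def intro!: exI[of _ "int (multiplicity (int p) a)"])
  qed
  from assms obtain a b where ab: "b > 0" "q = of_int a / of_int b" by (metis Rats_cases')
  with assms have "a \<noteq> 0" "b \<noteq> 0" by auto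
  then obtain k l where "has_val (of_int a) 1 k" "has_val (of_int b) 1 l" using int by metis
  from has_val_mult_same[OF this(1) has_val_inverse[OF this(2)]] show ?thesis
    unfolding ab(2) divide_inverse by blast
qed

text \<open>
  In an equation \<open>f(x) = 0\<close> the terms of least valuation cannot be outweighed by the others, so there
  are at least two of them. Their quotient is a unit, and it is a rational number times a power of \<open>x\<close>.
\<close>

lemma algebraic_has_val:
  assumes "algebraic x" "x \<noteq> 0"
  shows "\<exists>n k. has_val x n k"
proof -
  obtain f where f: "\<And>i. coeff f i \<in> \<rat>" "f \<noteq> 0" "poly f x = 0"
    using assms unfolding algebraic_altdef by blast
  define S where "S = {i. i \<le> degree f \<and> coeff f i \<noteq> 0}"
  define t where "t i = coeff f i * x ^ i" for i
  have S: "finite S" "S \<noteq> {}" using f by (auto simp: S_def)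
  have t0: "t i \<noteq> 0" if "i \<in> S" for i using that assms by (auto simp: S_def t_def)
  note cl = csubring_closed[OF V]
  \<comment> \<open>An index whose term has least valuation.\<close>
  have "\<exists>i\<in>S. \<forall>j\<in>S. t j / t i \<in> V"
  proof -
    have "\<exists>i\<in>F. \<forall>j\<in>F. t j / t i \<in> V" if "finite F" "F \<noteq> {}" "F \<subseteq> S" for F
      using that
    proof (induction F rule: finite_ne_induct)
      case (singleton i)
      then show ?case using t0 by (auto simp: cl)
    next
      case (insert j F)
      then obtain i where i: "i \<in> F" "\<forall>k\<in>F. t k / t i \<in> V" by auto
      have nz: "t i \<noteq> 0" "t j \<noteq> 0" using t0 i insert by auto
      show ?case
      proof (cases "t j / t i \<in> V")
        case True
        with i show ?thesis by auto
      next
        case False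
        then have ij: "t i / t j \<in> V" using valuation_ring[of "t j / t i"] nz by simp
        have "t k / t j \<in> V" if "k \<in> F" for k
        proof -
          have "(t k / t i) * (t i / t j) \<in> V" using i ij that by (intro cl) auto
          then show ?thesis using nz by simp
        qed
        then show ?thesis using nz by (intro bexI[of _ j]) (auto simp: cl)
      qed
    qed
    with S show ?thesis by blast
  qed
  then obtain i where i: "i \<in> S" "\<And>j. j \<in> S \<Longrightarrow> t j / t i \<in> V" by blast
  \<comment> \<open>Otherwise \<open>- 1\<close> would be a sum of nonunits.\<close>
  have "\<exists>j\<in>S - {i}. t j / t i \<in> U"
  proof (rule ccontr)
    assume no: "\<not> ?thesis"
    have nonunit0: "0 \<in> V - U" by (auto simp: units_of_ring_def cl)
    have "(\<Sum>j\<in>F. t j / t i) \<in> V - U" if "finite F" "F \<subseteq> S - {i}" for F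
      using that by (induction F rule: finite_induct) (use nonunit0 nonunit_add no i in auto)
    from this[of "S - {i}"] S have sum: "(\<Sum>j\<in>S - {i}. t j / t i) \<in> V - U" by simp
    have "0 = (\<Sum>j\<le>degree f. t j)" using f by (simp add: poly_altdef t_def)
    also have "\<dots> = (\<Sum>j\<in>S. t j)" by (intro sum.mono_neutral_right) (auto simp: S_def t_def)
    also have "\<dots> = t i + (\<Sum>j\<in>S - {i}. t j)" using S i by (simp add: sum.remove)
    finally have "(\<Sum>j\<in>S - {i}. t j) = - t i" by (simp add: add_eq_0_iff)
    then have "(\<Sum>j\<in>S - {i}. t j / t i) = - 1" using t0[OF i(1)] by (simp flip: sum_divide_distrib)
    with sum have "(- 1 :: complex) \<notin> U" by simp
    then show False by (simp add: units_of_ring_def cl)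
  qed
  then obtain j where j: "j \<in> S" "j \<noteq> i" "t j / t i \<in> U" by blast
  have main: "\<exists>n k. has_val x n k" if ij: "i < j" "i \<in> S" "j \<in> S" "t j / t i \<in> U" for i j
  proof -
    define c where "c = coeff f j / coeff f i"
    have c: "c \<in> \<rat>" "c \<noteq> 0" using f ij by (auto simp: c_def S_def)
    obtain k where k: "has_val c 1 k" using rat_has_val[OF c] by blast
    have "x ^ j = x ^ i * x ^ (j - i)" using ij by (simp flip: power_add)
    then have "t j / t i = c * x ^ (j - i)" using assms by (simp add: t_def c_def)
    with ij have "c * x ^ (j - i) \<in> U" by simp
    then have "(c * x ^ (j - i)) * inverse (c / of_nat p powi k) \<in> U"
      using k by (intro unit_mult[OF V _ unit_inverse[OF V]]) (auto simp: has_val_def)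
    moreover have "(c * x ^ (j - i)) * inverse (c / of_nat p powi k) = x ^ (j - i) / of_nat p powi (- k)"
      using c by (simp add: field_simps power_int_minus)
    ultimately have "has_val x (j - i) (- k)" using ij assms by (simp add: has_val_def)
    then show ?thesis by blast
  qed
  have "t i / t j \<in> U" using unit_inverse[OF V j(3)] by simp
  with main[of i j] main[of j i] i j show ?thesis by (metis linorder_neqE_nat)
qed

lemma padic_abs_pos: "algebraic x \<Longrightarrow> x \<noteq> 0 \<Longrightarrow> padic_abs x > 0"
  using algebraic_has_val[of x] prime by (auto simp: padic_abs_eq prime_gt_0_nat)

lemma has_val_mult:
  assumes "has_val x n k" "has_val y m l"
  shows "has_val (x * y) (n * m) (k * int m + l * int n)"
  using has_val_scale[OF assms(1), of m] has_val_scale[OF assms(2), of n] assms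
  by (intro has_val_mult_same) (auto simp: has_val_def mult.commute)

lemma padic_abs_mult_has_val:
  assumes "has_val x n k" "has_val y m l"
  shows "padic_abs (x * y) = padic_abs x * padic_abs y"
proof -
  have "n > 0" "m > 0" using assms by (auto simp: has_val_def)
  then have "- (real_of_int (k * int m + l * int n) / real (n * m)) =
      - (real_of_int k / real n) + - (real_of_int l / real m)"
    by (simp add: field_simps)
  then show ?thesis
    unfolding padic_abs_eq[OF assms(1)] padic_abs_eq[OF assms(2)] padic_abs_eq[OF has_val_mult[OF assms]]
    by (simp only: powr_add)
qed

lemma padic_abs_mult:
  assumes "algebraic x" "algebraic y"
  shows "padic_abs (x * y) = padic_abs x * padic_abs y"
  using algebraic_has_val[OF assms(1)] algebraic_has_val[OF assms(2)]
  by (cases "x = 0 \<or> y = 0") (auto intro: padic_abs_mult_has_val)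

lemma padic_abs_le_1_iff_has_val:
  assumes v: "has_val x n k"
  shows "padic_abs x \<le> 1 \<longleftrightarrow> x \<in> V"
proof -
  note cl = csubring_closed[OF V]
  have n: "n > 0" and False: "x \<noteq> 0" and u: "x ^ n / of_nat p powi k \<in> U"
    using v by (auto simp: has_val_def)
  have p1: "real p > 1" using prime_gt_1_nat[OF prime] by simp
  have "padic_abs x \<le> 1 \<longleftrightarrow> k \<ge> 0"
    unfolding padic_abs_eq[OF v] using n p1 powr_le_cancel_iff[OF p1, of "- (of_int k / of_nat n)" 0]
    by (simp add: zero_le_divide_iff)
  also have "\<dots> \<longleftrightarrow> x \<in> V"
  proof
    assume k: "k \<ge> 0"
    have "x ^ n / of_nat p powi k * of_nat p powi k \<in> V"
      using u k p_powi_in_iff by (intro cl) (auto simp: units_of_ring_def)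
    then have xn: "x ^ n \<in> V" using p_nonzero by simp
    show "x \<in> V"
    proof (rule ccontr)
      assume "x \<notin> V"
      then have "inverse x \<in> V" using valuation_ring False by blast
      with xn have "x ^ n * inverse x ^ (n - 1) \<in> V"
        using csubring_mult[OF V] csubring_power[OF V] by blast
      moreover have "x ^ n * inverse x ^ (n - 1) = x" using n False by (cases n) (auto simp: field_simps)
      ultimately show False using \<open>x \<notin> V\<close> by metis
    qed
  next
    assume "x \<in> V"
    then have "x ^ n * inverse (x ^ n / of_nat p powi k) \<in> V"
      using u by (intro cl) (auto simp: units_of_ring_def)
    then have "of_nat p powi k \<in> V" using False by (simp add: field_simps)
    then show "k \<ge> 0" by (simp add: p_powi_in_iff)
  qed
  finally show ?thesis .
qed

lemma padic_abs_le_1_iff: "algebraic x \<Longrightarrow> padic_abs x \<le> 1 \<longleftrightarrow> x \<in> V"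
  using algebraic_has_val[of x] padic_abs_le_1_iff_has_val csubring_zero[OF V] by (cases "x = 0") auto

lemma padic_abs_inverse:
  assumes "algebraic x"
  shows "padic_abs (inverse x) = inverse (padic_abs x)"
proof (cases "x = 0")
  case False
  then obtain n k where "has_val x n k" using algebraic_has_val assms by blast
  then show ?thesis
    by (simp add: padic_abs_eq padic_abs_eq[OF has_val_inverse] powr_minus)
qed auto

lemma padic_abs_ultrametric:
  assumes "algebraic x" "algebraic y" "algebraic (x + y)"
  shows "padic_abs (x + y) \<le> max (padic_abs x) (padic_abs y)"
proof -
  have main: "padic_abs (x + y) \<le> padic_abs y"
    if alg: "algebraic x" "algebraic y" "algebraic (x + y)" and y: "y \<noteq> 0" and xy: "x / y \<in> V" for x y
  proof -
    obtain n k where v: "has_val (inverse y) n k"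
      using algebraic_has_val[of "inverse y"] alg y by auto
    have zV: "(x + y) * inverse y \<in> V"
      using csubring_add[OF V xy csubring_one[OF V]] y by (simp add: field_simps)
    have "padic_abs ((x + y) * inverse y) \<le> 1"
    proof (cases "x + y = 0")
      case False
      then obtain m l where "has_val (x + y) m l" using algebraic_has_val alg by blast
      from padic_abs_le_1_iff_has_val[OF has_val_mult[OF this v]] zV show ?thesis by simp
    qed simp
    also have "padic_abs ((x + y) * inverse y) = padic_abs (x + y) * inverse (padic_abs y)"
      using padic_abs_mult[OF alg(3), of "inverse y"] alg padic_abs_inverse by auto
    finally show ?thesis using padic_abs_pos[OF alg(2) y] by (simp add: field_simps)
  qed
  show ?thesis
  proof (cases "x = 0 \<or> y = 0")
    case True
    then show ?thesis using padic_abs_nonneg by (auto simp: max_def)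
  next
    case False
    show ?thesis
    proof (cases "x / y \<in> V")
      case True
      then show ?thesis using main[of x y] assms False by auto
    next
      case xy: False
      then have "y / x \<in> V" using valuation_ring[of "x / y"] False by simp
      then show ?thesis using main[of y x] assms False by (auto simp: add.commute)
    qed
  qed
qed

lemma padic_abs_unit: "x \<in> U \<Longrightarrow> padic_abs x = 1"
  using padic_abs_eq[of x 1 0] prime by (auto simp: has_val_def units_of_ring_def prime_gt_0_nat)

lemma padic_abs_p: "padic_abs (of_nat p) = 1 / p"
proof -
  have "has_val (of_nat p) 1 1" using p_nonzero unit_one[OF V] by (simp add: has_val_def)
  then show ?thesis using prime by (simp add: padic_abs_eq powr_minus prime_gt_0_nat field_simps)
qed

text \<open>
  The partial products are not known to be algebraic, so the induction carries the existence of a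
  valuation along.
\<close>

lemma padic_abs_prod:
  assumes "finite A" "\<And>i. i \<in> A \<Longrightarrow> algebraic (f i)" "\<And>i. i \<in> A \<Longrightarrow> f i \<noteq> 0"
  shows "padic_abs (prod f A) = (\<Prod>i\<in>A. padic_abs (f i))"
proof -
  have "(\<exists>n k. has_val (prod f A) n k) \<and> padic_abs (prod f A) = (\<Prod>i\<in>A. padic_abs (f i))"
    using assms
  proof (induction A rule: finite_induct)
    case empty
    have "has_val 1 1 0" by (simp add: has_val_def unit_one[OF V])
    then show ?case using padic_abs_unit[OF unit_one[OF V]] by auto
  next
    case (insert i A)
    obtain n k where 1: "has_val (f i) n k" using insert.prems algebraic_has_val by (metis insertI1)
    obtain m l where 2: "has_val (prod f A) m l" using insert by blast
    have "padic_abs (f i * prod f A) = padic_abs (f i) * padic_abs (prod f A)"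
      by (rule padic_abs_mult_has_val[OF 1 2])
    then show ?case using has_val_mult[OF 1 2] insert by auto
  qed
  then show ?thesis ..
qed

text \<open>
  Valuation rings are integrally closed.
\<close>

lemma integral_in_V:
  assumes f: "\<And>i. coeff f i \<in> \<int>" "poly f x = 0" "degree f > 0" and lead: "lead_coeff f \<in> U"
  shows "x \<in> V"
proof (rule ccontr)
  assume x: "x \<notin> V"
  then have x0: "x \<noteq> 0" using csubring_zero[OF V] by auto
  have cV: "coeff f i \<in> V" for i
    using f(1)[of i] csubring_of_int[OF V] by (metis Ints_cases)
  have ix: "inverse x \<in> V" by (rule valuation_ring[OF x0 x])
  define l n where "l = lead_coeff f" and "n = degree f"
  have l: "l \<noteq> 0" "inverse l \<in> V" using lead by (auto simp: units_of_ring_def l_def)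
  have "{..n} = insert n {..<n}" by auto
  then have sum: "(\<Sum>i<n. coeff f i * x ^ i) = - (l * x ^ n)"
    using f(2) by (simp add: poly_altdef n_def l_def add_eq_0_iff)
  have "x ^ (n - 1) * (coeff f i * inverse x ^ (n - 1 - i)) = coeff f i * x ^ i" if "i < n" for i
  proof -
    have "x ^ (n - 1) = x ^ i * x ^ (n - 1 - i)" using that by (simp flip: power_add)
    then show ?thesis using x0 by (simp add: power_inverse)
  qed
  then have "x ^ (n - 1) * (\<Sum>i<n. coeff f i * inverse x ^ (n - 1 - i)) = - (l * x ^ n)"
    unfolding sum_distrib_left sum[symmetric] by (intro sum.cong) auto
  moreover have "x ^ n = x ^ (n - 1) * x" using f(3) by (cases n) (simp_all add: n_def)
  ultimately have "x ^ (n - 1) * (\<Sum>i<n. coeff f i * inverse x ^ (n - 1 - i)) = x ^ (n - 1) * (- (l * x))"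
    by simp
  then have "(\<Sum>i<n. coeff f i * inverse x ^ (n - 1 - i)) = - (l * x)"
    using x0 mult_left_cancel[of "x ^ (n - 1)"] power_not_zero by blast
  then have "x = - (inverse l * (\<Sum>i<n. coeff f i * inverse x ^ (n - 1 - i)))" using l by simp
  also have "\<dots> \<in> V"
    by (intro csubring_uminus[OF V] csubring_mult[OF V] csubring_sum[OF V] csubring_power[OF V] l ix cV)
  finally show False using x by simp
qed

end

lemma maximal_ring_exists:
  assumes "prime p"
  shows "\<exists>V. maximal_ring p V"
proof -
  define A where "A = {V. csubring V \<and> 1 / of_nat p \<notin> V}"
  have "\<int> \<in> A"
  proof -
    have "1 / of_nat p \<notin> (\<int> :: complex set)"
    proof
      assume "1 / of_nat p \<in> (\<int> :: complex set)"
      then obtain k :: int where "1 / of_nat p = (of_int k :: complex)" by (auto elim: Ints_cases)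
      then have "of_int (k * int p) = (1 :: complex)" using assms by (auto simp: field_simps)
      then have "k * int p = 1" by (simp only: of_int_eq_1_iff)
      then have "int p dvd 1" by (metis dvd_triv_right)
      then show False using assms by (auto simp: prime_gt_1_nat)
    qed
    then show ?thesis by (auto simp: A_def csubring_def)
  qed
  moreover have "\<Union> C \<in> A" if C: "C \<noteq> {}" "subset.chain A C" for C
  proof -
    have CA: "C \<subseteq> A" and lin: "\<And>X Y. X \<in> C \<Longrightarrow> Y \<in> C \<Longrightarrow> X \<subseteq> Y \<or> Y \<subseteq> X"
      using C(2) by (auto simp: subset_chain_def)
    have "csubring (\<Union> C)" unfolding csubring_def
    proof (intro conjI ballI)
      show "1 \<in> \<Union> C" using C(1) CA csubring_one unfolding A_def by blast
      fix x y assume "x \<in> \<Union> C" "y \<in> \<Union> C"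
      then obtain X Y where XY: "X \<in> C" "Y \<in> C" "x \<in> X" "y \<in> Y" by blast
      then obtain Z where "Z \<in> C" "x \<in> Z" "y \<in> Z" using lin[OF XY(1,2)] by blast
      moreover have "csubring Z" using \<open>Z \<in> C\<close> CA by (auto simp: A_def)
      ultimately show "x - y \<in> \<Union> C" "x * y \<in> \<Union> C"
        using csubring_diff csubring_mult by blast+
    qed
    with CA show ?thesis by (auto simp: A_def)
  qed
  ultimately obtain V where "V \<in> A" "\<forall>W\<in>A. V \<subseteq> W \<longrightarrow> W = V"
    using subset_Zorn_nonempty[of A] by (metis empty_iff)
  then have "maximal_ring p V" using assms by unfold_locales (auto simp: A_def)
  then show ?thesis ..
qed

section \<open>Places and the product formula\<close>

definition chosen_ring :: "nat \<Rightarrow> complex set" where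
  "chosen_ring p = (SOME V. maximal_ring p V)"

text \<open>
  One extension of the \<open>p\<close>-adic absolute value for each prime; precomposing it with different
  homomorphisms gives the places above \<open>p\<close>.
\<close>

definition pabs :: "nat \<Rightarrow> complex \<Rightarrow> real" where
  "pabs p = maximal_ring.padic_abs p (chosen_ring p)"

lemma maximal_ring_chosen: "prime p \<Longrightarrow> maximal_ring p (chosen_ring p)"
  unfolding chosen_ring_def using maximal_ring_exists by (rule someI_ex)

lemma pabs_nonneg: "prime p \<Longrightarrow> pabs p x \<ge> 0"
  unfolding pabs_def by (rule maximal_ring.padic_abs_nonneg[OF maximal_ring_chosen])

lemma pabs_pos: "prime p \<Longrightarrow> algebraic x \<Longrightarrow> x \<noteq> 0 \<Longrightarrow> pabs p x > 0"
  unfolding pabs_def by (rule maximal_ring.padic_abs_pos[OF maximal_ring_chosen])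

lemma pabs_mult: "prime p \<Longrightarrow> algebraic x \<Longrightarrow> algebraic y \<Longrightarrow> pabs p (x * y) = pabs p x * pabs p y"
  unfolding pabs_def by (rule maximal_ring.padic_abs_mult[OF maximal_ring_chosen])

lemma pabs_ultrametric:
  "prime p \<Longrightarrow> algebraic x \<Longrightarrow> algebraic y \<Longrightarrow> algebraic (x + y) \<Longrightarrow> pabs p (x + y) \<le> max (pabs p x) (pabs p y)"
  unfolding pabs_def by (rule maximal_ring.padic_abs_ultrametric[OF maximal_ring_chosen])

lemma pabs_inverse: "prime p \<Longrightarrow> algebraic x \<Longrightarrow> pabs p (inverse x) = inverse (pabs p x)"
  unfolding pabs_def by (rule maximal_ring.padic_abs_inverse[OF maximal_ring_chosen])

lemma pabs_prod:
  assumes "prime p" "finite A" "\<And>i. i \<in> A \<Longrightarrow> algebraic (f i)" "\<And>i. i \<in> A \<Longrightarrow> f i \<noteq> 0"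
  shows "pabs p (prod f A) = (\<Prod>i\<in>A. pabs p (f i))"
  unfolding pabs_def using maximal_ring.padic_abs_prod[OF maximal_ring_chosen] assms by blast

lemma pabs_int_coprime: "prime p \<Longrightarrow> \<not> int p dvd k \<Longrightarrow> pabs p (of_int k) = 1"
  unfolding pabs_def
  using maximal_ring.padic_abs_unit[OF maximal_ring_chosen] maximal_ring.int_unit[OF maximal_ring_chosen] by blast

lemma pabs_self: "prime p \<Longrightarrow> pabs p (of_nat p) = 1 / p"
  unfolding pabs_def by (rule maximal_ring.padic_abs_p[OF maximal_ring_chosen])

lemma pabs_prime: 
  assumes "prime p" "prime q"
  shows "pabs p (of_nat q) = (if p = q then 1 / p else 1)"
  using pabs_self[OF assms(1)] pabs_int_coprime[OF assms(1), of "int q"] primes_dvd_imp_eq[OF assms]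
  by auto

lemma pabs_1: "prime p \<Longrightarrow> pabs p 1 = 1"
  using pabs_int_coprime[of p 1] prime_gt_1_nat[of p] by simp

lemma pabs_minus: 
  assumes "prime p" "algebraic x" shows "pabs p (- x) = pabs p x"
proof -
  have "pabs p (- 1) = 1" using pabs_int_coprime[of p "- 1"] prime_gt_1_nat[of p] assms by simp
  then show ?thesis using pabs_mult[OF assms(1) _ assms(2), of "- 1"] by simp
qed

lemma pabs_of_int_le:
  assumes "prime p" shows "pabs p (of_int k) \<le> 1"
  unfolding pabs_def
  using maximal_ring.padic_abs_le_1_iff[OF maximal_ring_chosen[OF assms], of "of_int k"]
    csubring_of_int[OF maximal_ring.V[OF maximal_ring_chosen[OF assms]]] by simp

lemma pabs_le_1_of_integral:
  assumes "prime p" "algebraic x" and f: "\<And>i. coeff f i \<in> \<int>" "poly f x = 0" "degree f > 0"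
    and lead: "lead_coeff f = of_int l" "\<not> int p dvd l"
  shows "pabs p x \<le> 1"
proof -
  interpret maximal_ring p "chosen_ring p" by (rule maximal_ring_chosen[OF assms(1)])
  have "x \<in> chosen_ring p" using integral_in_V[OF f] lead int_unit by simp
  then show ?thesis unfolding pabs_def using padic_abs_le_1_iff[OF assms(2)] by simp
qed

lemma finite_prime_divisors:
  assumes "l \<noteq> 0"
  shows "finite {p :: nat. prime p \<and> int p dvd l}"
proof (rule finite_subset)
  show "{p :: nat. prime p \<and> int p dvd l} \<subseteq> {..nat \<bar>l\<bar>}"
  proof
    fix p assume "p \<in> {p :: nat. prime p \<and> int p dvd l}"
    then have "\<bar>int p\<bar> \<le> \<bar>l\<bar>" using dvd_imp_le_int[OF assms] by blast
    then show "p \<in> {..nat \<bar>l\<bar>}" by simp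
  qed
qed simp

text \<open>
  Only primes dividing the leading coefficient of an integer polynomial for \<open>x\<close>, or of one for its
  inverse, are exceptions.
\<close>

lemma finite_pabs_neq_1:
  assumes "algebraic x" "x \<noteq> 0"
  shows "finite {p. prime p \<and> pabs p x \<noteq> 1}"
proof -
  have main: "finite {p. prime p \<and> pabs p x > 1}" if alg: "algebraic x" and x: "x \<noteq> 0" for x
  proof -
    obtain g :: "int poly" where g: "coeff g 0 \<noteq> 0" "poly (map_poly of_int g) x = 0"
      using algebraicE'_nonzero[OF alg x] by metis
    define f :: "complex poly" where "f = map_poly of_int g"
    have f: "\<And>i. coeff f i \<in> \<int>" "poly f x = 0" "coeff f 0 \<noteq> 0"
      using g by (simp_all add: f_def coeff_map_poly)
    have "f \<noteq> 0" using f by auto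
    have deg: "degree f > 0"
    proof (rule ccontr)
      assume "\<not> degree f > 0"
      then obtain c where "f = [:c:]" by (auto elim: degree_eq_zeroE)
      with f show False by auto
    qed
    obtain l where l: "lead_coeff f = of_int l" using f(1) by (auto elim: Ints_cases)
    have "l \<noteq> 0" using l \<open>f \<noteq> 0\<close> by auto
    moreover have "{p. prime p \<and> pabs p x > 1} \<subseteq> {p. prime p \<and> int p dvd l}"
    proof (intro subsetI CollectI, elim CollectE conjE, intro conjI)
      fix p assume p: "prime p" "pabs p x > 1"
      show "int p dvd l"
        by (rule ccontr) (use pabs_le_1_of_integral[OF p(1) alg f(1,2) deg l] p in auto)
    qed
    ultimately show ?thesis using finite_prime_divisors finite_subset by blast
  qed
  have "{p. prime p \<and> pabs p x \<noteq> 1} \<subseteq> {p. prime p \<and> pabs p x > 1} \<union> {p. prime p \<and> pabs p (inverse x) > 1}"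
    using pabs_inverse[OF _ assms(1)] pabs_pos[OF _ assms]
    by (auto simp: one_less_inverse_iff)
  moreover have "finite ({p. prime p \<and> pabs p x > 1} \<union> {p. prime p \<and> pabs p (inverse x) > 1})"
    using main[OF assms] main[of "inverse x"] assms by auto
  ultimately show ?thesis by (rule finite_subset)
qed

text \<open>
  By unique factorisation this is the part of \<open>n\<close> prime to \<open>S\<close>.
\<close>

definition int_defect :: "nat set \<Rightarrow> nat \<Rightarrow> real" where
  "int_defect S n = real n * (\<Prod>p\<in>S. pabs p (of_nat n))"

lemma int_defect_mult:
  assumes "finite S" "\<And>p. p \<in> S \<Longrightarrow> prime p"
  shows "int_defect S (m * n) = int_defect S m * int_defect S n"
  using assms by (simp add: int_defect_def pabs_mult prod.distrib)

lemma int_defect_prime: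
  assumes "finite S" "\<And>p. p \<in> S \<Longrightarrow> prime p" "prime q"
  shows "int_defect S q = (if q \<in> S then 1 else real q)"
proof -
  have "(\<Prod>p\<in>S. pabs p (of_nat q)) = (\<Prod>p\<in>S. if p = q then 1 / real q else 1)"
    using assms by (intro prod.cong refl) (simp add: pabs_prime)
  then show ?thesis using assms prime_gt_0_nat[of q] by (simp add: int_defect_def)
qed

lemma
  assumes S: "finite S" "\<And>p. p \<in> S \<Longrightarrow> prime p" and n: "n > 0"
  shows int_defect_ge_1: "int_defect S n \<ge> 1"
    and int_defect_eq_1: "(\<And>p. prime p \<Longrightarrow> p dvd n \<Longrightarrow> p \<in> S) \<Longrightarrow> int_defect S n = 1"
proof -
  have one: "int_defect S 1 = 1" using S by (simp add: int_defect_def pabs_1)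
  have "int_defect S n \<ge> 1 \<and> ((\<forall>p. prime p \<longrightarrow> p dvd n \<longrightarrow> p \<in> S) \<longrightarrow> int_defect S n = 1)"
    using n
  proof (induction n rule: prime_divisors_induct)
    case zero
    then show ?case by simp
  next
    case (unit n)
    then show ?case using one by simp
  next
    case (factor q n)
    have "int_defect S q \<ge> 1" using int_defect_prime[OF S factor(1)] prime_ge_1_nat[OF factor(1)] by simp
    moreover have "n > 0" using factor(3) by simp
    then have IH: "int_defect S n \<ge> 1" "(\<forall>p. prime p \<longrightarrow> p dvd n \<longrightarrow> p \<in> S) \<longrightarrow> int_defect S n = 1"
      using factor(2) by auto
    have eq: "int_defect S (q * n) = int_defect S q * int_defect S n"
      by (rule int_defect_mult[OF S])
    have "int_defect S (q * n) \<ge> 1"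
      unfolding eq using mult_mono[of 1 "int_defect S q" 1 "int_defect S n"] IH calculation by simp
    moreover have "int_defect S (q * n) = 1" if "\<forall>p. prime p \<longrightarrow> p dvd q * n \<longrightarrow> p \<in> S"
      unfolding eq using that IH(2) factor(1) by (simp add: int_defect_prime[OF S factor(1)])
    ultimately show ?case by blast
  qed
  then show "int_defect S n \<ge> 1" "(\<And>p. prime p \<Longrightarrow> p dvd n \<Longrightarrow> p \<in> S) \<Longrightarrow> int_defect S n = 1" by auto
qed

lemma rational_product_formula:
  assumes S: "finite S" "\<And>p. p \<in> S \<Longrightarrow> prime p" and q: "q \<in> \<rat>" "q \<noteq> 0"
    and integral: "\<And>p. prime p \<Longrightarrow> p \<notin> S \<Longrightarrow> pabs p q \<le> 1"
  shows "cmod q * (\<Prod>p\<in>S. pabs p q) \<ge> 1"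
proof -
  obtain a b :: int where ab: "b > 0" "coprime a b" "q = of_int a / of_int b"
    using q(1) by (metis Rats_cases')
  have a0: "a \<noteq> 0" using ab q by auto
  define m n where "m = nat \<bar>a\<bar>" and "n = nat b"
  have mn: "m > 0" "n > 0" using a0 ab by (auto simp: m_def n_def)
  have pm: "pabs p (of_int a) = pabs p (of_nat m)" if "prime p" for p
    using pabs_minus[OF that, of "of_int a"] by (cases "a \<ge> 0") (simp_all add: m_def)
  have nb: "of_int b = (of_nat n :: complex)" using ab by (simp add: n_def)
  have pq: "pabs p q = pabs p (of_nat m) / pabs p (of_nat n)" if "prime p" for p
    using pabs_mult[OF that, of "of_int a" "inverse (of_nat n)"] pabs_inverse[OF that, of "of_nat n"] pm[OF that]
    by (auto simp: ab(3) nb divide_inverse)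
  have "p \<in> S" if "prime p" "p dvd n" for p
  proof (rule ccontr)
    assume "p \<notin> S"
    have "\<not> p dvd m"
    proof
      assume "p dvd m"
      then have "int p dvd a" by (simp add: m_def)
      moreover have "int p dvd int n" using that by simp
      then have "int p dvd b" using ab(1) by (simp add: n_def)
      ultimately have "is_unit (int p)" using ab(2) coprime_common_divisor by blast
      then show False using prime_gt_1_nat[OF that(1)] by simp
    qed
    then have "pabs p (of_nat m) = 1" using pabs_int_coprime[OF that(1), of "int m"] by simp
    obtain n' where n': "n = p * n'" using \<open>p dvd n\<close> by (rule dvdE)
    have "pabs p (of_nat n) = 1 / p * pabs p (of_nat n')"
      using that by (simp add: n' pabs_mult pabs_self)
    also have "\<dots> \<le> 1 / p * 1"
      using pabs_of_int_le[OF that(1), of "int n'"] by (intro mult_left_mono) auto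
    also have "\<dots> < 1" using prime_gt_1_nat[OF that(1)] by simp
    finally have "pabs p (of_nat n) < 1" .
    moreover have "pabs p (of_nat n) > 0" using mn that by (intro pabs_pos) auto
    ultimately have "pabs p q > 1" using pq[OF that(1)] \<open>pabs p (of_nat m) = 1\<close> by simp
    with integral[OF that(1) \<open>p \<notin> S\<close>] show False by simp
  qed
  then have "int_defect S n = 1" by (intro int_defect_eq_1 S mn)
  moreover have "int_defect S m \<ge> 1" by (intro int_defect_ge_1 S mn)
  moreover have "cmod q * (\<Prod>p\<in>S. pabs p q) = int_defect S m / int_defect S n"
  proof -
    have "(\<Prod>p\<in>S. pabs p q) = (\<Prod>p\<in>S. pabs p (of_nat m)) / (\<Prod>p\<in>S. pabs p (of_nat n))"
      using S pq by (simp add: prod_dividef)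
    moreover have "cmod q = real m / real n"
      using ab by (simp add: norm_divide m_def n_def)
    ultimately show ?thesis by (simp add: int_defect_def)
  qed
  ultimately show ?thesis by simp
qed

lemma prod_list_map_nth: "(\<Prod>x\<leftarrow>xs. f x) = (\<Prod>j<length xs. f (xs ! j))"
  for f :: "_ \<Rightarrow> 'a :: comm_monoid_mult"
  by (simp add: prod.list_conv_set_nth atLeast0LessThan)

text \<open>
  A place \<open>(j, p)\<close> combines the homomorphism number \<open>j\<close> with the prime \<open>p\<close>, or with the usual absolute
  value if \<open>p = 0\<close>.
\<close>

definition place_abs :: "(complex \<Rightarrow> complex) list \<Rightarrow> nat \<times> nat \<Rightarrow> complex \<Rightarrow> real" where
  "place_abs \<Psi> = (\<lambda>(j, p) x. if p = 0 then cmod ((\<Psi> ! j) x) else pabs p ((\<Psi> ! j) x))"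

text \<open>
  \<open>I\<close> consists of the archimedean places, \<open>J\<close> of finitely many nonarchimedean ones, outside which the
  elements of \<open>U\<close> have absolute value 1. The elements of \<open>R\<close> are integral at all remaining places, so for them the product formula becomes an
  inequality, and it is an equality on \<open>U\<close>. Since there is no field, a nonzero element may vanish at
  some place; the inequality is therefore restricted to elements of a set \<open>N\<close> fixed in advance.
\<close>

locale height_system =
  fixes R :: "complex set" and I J :: "'i set" and v :: "'i \<Rightarrow> complex \<Rightarrow> real"
    and U N :: "complex set"
  assumes ring: "csubring R"
    and finite: "finite I" "finite J" and disjoint: "I \<inter> J = {}" and arch: "I \<noteq> {}"
    and nonneg: "\<And>i x. i \<in> I \<union> J \<Longrightarrow> x \<in> R \<Longrightarrow> v i x \<ge> 0"
    and mult: "\<And>i x y. i \<in> I \<union> J \<Longrightarrow> x \<in> R \<Longrightarrow> y \<in> R \<Longrightarrow> v i (x * y) = v i x * v i y"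
    and uminus: "\<And>i x. i \<in> I \<union> J \<Longrightarrow> x \<in> R \<Longrightarrow> v i (- x) = v i x"
    and triangle: "\<And>i x y. i \<in> I \<Longrightarrow> x \<in> R \<Longrightarrow> y \<in> R \<Longrightarrow> v i (x + y) \<le> v i x + v i y"
    and ultrametric: "\<And>i x y. i \<in> J \<Longrightarrow> x \<in> R \<Longrightarrow> y \<in> R \<Longrightarrow> v i (x + y) \<le> max (v i x) (v i y)"
    and arch_nat: "\<And>i n. i \<in> I \<Longrightarrow> v i (of_nat n) = real n"
    and U: "U \<subseteq> R" "\<And>i u. i \<in> I \<union> J \<Longrightarrow> u \<in> U \<Longrightarrow> v i u > 0"
    and unit_product: "\<And>u. u \<in> U \<Longrightarrow> (\<Prod>i\<in>I \<union> J. v i u) = 1"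
    and product: "\<And>x. x \<in> R \<Longrightarrow> x \<in> N \<Longrightarrow> x \<noteq> 0 \<Longrightarrow> (\<Prod>i\<in>I \<union> J. v i x) \<ge> 1"

text \<open>
  The finitely many primes at which an element of \<open>U\<close> has an absolute value different from 1 form \<open>S\<close>,
  and \<open>O'\<close> consists of the elements that are integral outside \<open>S\<close>. The product over all places of \<open>x\<close> is
  the product over the absolute values of the rational number \<open>\<Prod>\<psi>\<leftarrow>\<Psi>. \<psi> x\<close>.
\<close>

theorem height_system_exists:
  assumes fin: "finite U" "finite N" and U0: "0 \<notin> U"
  shows "\<exists>R I J (v :: nat \<times> nat \<Rightarrow> complex \<Rightarrow> real). height_system R I J v U N"
proof -
  obtain R \<Psi> where R: "rat_subring R" "U \<union> N \<subseteq> R" and \<Psi>: "trace_family R \<Psi>"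
    and nz: "\<And>\<psi> b. \<psi> \<in> set \<Psi> \<Longrightarrow> b \<in> U \<union> N \<Longrightarrow> b \<noteq> 0 \<Longrightarrow> \<psi> b \<noteq> 0"
    using specialization[of "U \<union> N"] fin by (metis finite_UnI)
  define d where "d = length \<Psi>"
  have d: "d > 0" using \<Psi> by (simp add: d_def trace_family_def)
  have mem: "\<Psi> ! j \<in> set \<Psi>" if "j < d" for j using that by (simp add: d_def)
  have h: "hom_on R (\<Psi> ! j)" if "j < d" for j using mem[OF that] \<Psi> by (simp add: trace_family_def)
  have alg: "algebraic ((\<Psi> ! j) x)" if "j < d" "x \<in> R" for j x
    by (rule image_algebraic[OF R(1) \<Psi> that(2) mem[OF that(1)]])
  define S where "S = (\<Union>u\<in>U. \<Union>j<d. {p. prime p \<and> pabs p ((\<Psi> ! j) u) \<noteq> 1})"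
  have S: "finite S" "\<And>p. p \<in> S \<Longrightarrow> prime p"
  proof -
    show "finite S" unfolding S_def
    proof (intro finite_UN_I fin finite_lessThan)
      fix u j assume "u \<in> U" "j \<in> {..<d}"
      then show "finite {p. prime p \<and> pabs p ((\<Psi> ! j) u) \<noteq> 1}"
        using R(2) alg[of j u] nz[OF mem, of j u] U0 by (intro finite_pabs_neq_1) auto
    qed
  qed (auto simp: S_def)
  define O' where "O' = {x \<in> R. \<forall>j<d. \<forall>p. prime p \<longrightarrow> p \<notin> S \<longrightarrow> pabs p ((\<Psi> ! j) x) \<le> 1}"
  define I J :: "(nat \<times> nat) set" where "I = {..<d} \<times> {0}" and "J = {..<d} \<times> S"
  have S0: "0 \<notin> S" using S(2) by force
  note cl = csubring_closed[OF rat_subring_csubring[OF R(1)]]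
  have O'R: "O' \<subseteq> R" by (auto simp: O'_def)
  have UO: "U \<subseteq> O'" using R(2) by (auto simp: O'_def S_def)
  have uminus: "pabs p ((\<Psi> ! j) (- x)) = pabs p ((\<Psi> ! j) x)" if "prime p" "j < d" "x \<in> R" for p j x
    by (simp add: hom_on_uminus[OF R(1) h that(3)] pabs_minus alg that)
  have plus: "pabs p ((\<Psi> ! j) (x + y)) \<le> max (pabs p ((\<Psi> ! j) x)) (pabs p ((\<Psi> ! j) y))"
    if "prime p" "j < d" "x \<in> R" "y \<in> R" for p j x y
    using pabs_ultrametric[OF that(1) alg[OF that(2,3)] alg[OF that(2,4)]]
      alg[OF that(2) csubring_add[OF rat_subring_csubring[OF R(1)] that(3,4)]]
    by (simp add: hom_on_add[OF R(1) h[OF that(2)] that(3,4)])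
  have times: "pabs p ((\<Psi> ! j) (x * y)) = pabs p ((\<Psi> ! j) x) * pabs p ((\<Psi> ! j) y)"
    if "prime p" "j < d" "x \<in> R" "y \<in> R" for p j x y
    by (simp add: hom_on_mult[OF R(1) h that(3,4)] pabs_mult alg that)
  have "csubring O'"
    unfolding csubring_def
  proof (intro conjI ballI)
    show "1 \<in> O'" by (auto simp: O'_def cl hom_on_one[OF R(1) h] pabs_1)
    fix x y assume xy: "x \<in> O'" "y \<in> O'"
    then have xyR: "x \<in> R" "y \<in> R" by (auto simp: O'_def)
    have le: "pabs p ((\<Psi> ! j) x) \<le> 1" "pabs p ((\<Psi> ! j) y) \<le> 1" if "j < d" "prime p" "p \<notin> S" for j p
      using xy that by (auto simp: O'_def)
    have "pabs p ((\<Psi> ! j) (x - y)) \<le> 1" if "j < d" "prime p" "p \<notin> S" for j p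
    proof -
      have "- y \<in> R" using cl xyR by blast
      from plus[OF that(2,1) xyR(1) this] le[OF that] uminus[OF that(2,1) xyR(2)] show ?thesis by simp
    qed
    then show "x - y \<in> O'" using cl(2)[OF xyR] by (auto simp: O'_def)
    have "pabs p ((\<Psi> ! j) (x * y)) \<le> 1" if "j < d" "prime p" "p \<notin> S" for j p
      unfolding times[OF that(2,1) xyR] using le[OF that] pabs_nonneg[OF that(2)] by (intro mult_le_one) auto
    then show "x * y \<in> O'" using cl(3)[OF xyR] by (auto simp: O'_def)
  qed
  have total: "(\<Prod>i\<in>I \<union> J. place_abs \<Psi> i x) =
      cmod (\<Prod>\<psi>\<leftarrow>\<Psi>. \<psi> x) * (\<Prod>p\<in>S. pabs p (\<Prod>\<psi>\<leftarrow>\<Psi>. \<psi> x))"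
    if x: "x \<in> R" "\<And>j. j < d \<Longrightarrow> (\<Psi> ! j) x \<noteq> 0" for x
  proof -
    have cart: "(\<Prod>i\<in>A \<times> B. f i) = (\<Prod>a\<in>A. \<Prod>b\<in>B. f (a, b))" for A B and f :: "nat \<times> nat \<Rightarrow> real"
      by (simp add: prod.cartesian_product)
    have norm: "(\<Prod>\<psi>\<leftarrow>\<Psi>. \<psi> x) = (\<Prod>j<d. (\<Psi> ! j) x)"
      by (simp add: prod_list_map_nth d_def)
    have "(\<Prod>i\<in>I \<union> J. place_abs \<Psi> i x) = (\<Prod>i\<in>I. place_abs \<Psi> i x) * (\<Prod>i\<in>J. place_abs \<Psi> i x)"
      using S S0 by (intro prod.union_disjoint) (auto simp: I_def J_def)
    also have "(\<Prod>i\<in>I. place_abs \<Psi> i x) = (\<Prod>j<d. cmod ((\<Psi> ! j) x))"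
      unfolding I_def cart by (simp add: place_abs_def)
    also have "(\<Prod>i\<in>J. place_abs \<Psi> i x) = (\<Prod>j<d. \<Prod>p\<in>S. pabs p ((\<Psi> ! j) x))"
      unfolding J_def cart using S0 by (intro prod.cong refl) (auto simp: place_abs_def)
    also have "\<dots> = (\<Prod>p\<in>S. \<Prod>j<d. pabs p ((\<Psi> ! j) x))" by (rule prod.swap)
    also have "\<dots> = (\<Prod>p\<in>S. pabs p (\<Prod>j<d. (\<Psi> ! j) x))"
      using S x alg by (intro prod.cong refl pabs_prod[symmetric]) auto
    finally show ?thesis by (simp add: norm prod_norm)
  qed
  have norm_nz: "(\<Prod>\<psi>\<leftarrow>\<Psi>. \<psi> x) \<noteq> 0" if "x \<in> U \<union> N" "x \<noteq> 0" for x
    using nz that by (auto simp: prod_list_zero_iff)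
  have norm_pabs: "pabs p (\<Prod>\<psi>\<leftarrow>\<Psi>. \<psi> x) = (\<Prod>j<d. pabs p ((\<Psi> ! j) x))" if "x \<in> U \<union> N" "x \<noteq> 0" "prime p" for x p
  proof -
    have "pabs p (\<Prod>j<d. (\<Psi> ! j) x) = (\<Prod>j<d. pabs p ((\<Psi> ! j) x))"
      using that alg R(2) nz mem by (intro pabs_prod) auto
    then show ?thesis by (simp add: prod_list_map_nth d_def)
  qed
  have prodge: "(\<Prod>i\<in>I \<union> J. place_abs \<Psi> i x) \<ge> 1" if x: "x \<in> O'" "x \<in> U \<union> N" "x \<noteq> 0" for x
  proof -
    have "cmod (\<Prod>\<psi>\<leftarrow>\<Psi>. \<psi> x) * (\<Prod>p\<in>S. pabs p (\<Prod>\<psi>\<leftarrow>\<Psi>. \<psi> x)) \<ge> 1"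
    proof (rule rational_product_formula[OF S])
      show "(\<Prod>\<psi>\<leftarrow>\<Psi>. \<psi> x) \<in> \<rat>" using norm_rational[OF R(1) \<Psi>] x O'R by blast
      show "(\<Prod>\<psi>\<leftarrow>\<Psi>. \<psi> x) \<noteq> 0" by (rule norm_nz[OF x(2,3)])
      fix p assume p: "prime p" "p \<notin> S"
      show "pabs p (\<Prod>\<psi>\<leftarrow>\<Psi>. \<psi> x) \<le> 1"
        unfolding norm_pabs[OF x(2,3) p(1)] using x(1) p pabs_nonneg[OF p(1)]
        by (intro prod_le_1) (auto simp: O'_def)
    qed
    then show ?thesis using total[of x] x O'R nz mem by (metis subsetD)
  qed
  have prod_U: "(\<Prod>i\<in>I \<union> J. place_abs \<Psi> i u) = 1" if u: "u \<in> U" for u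
  proof (rule antisym)
    have u0: "u \<noteq> 0" using u U0 by auto
    let ?n = "\<Prod>\<psi>\<leftarrow>\<Psi>. \<psi> u"
    have nrat: "?n \<in> \<rat>" "?n \<noteq> 0" using norm_rational[OF R(1) \<Psi>, of u] u R(2) norm_nz[of u] u0 by auto
    have "cmod (inverse ?n) * (\<Prod>p\<in>S. pabs p (inverse ?n)) \<ge> 1"
    proof (rule rational_product_formula[OF S])
      fix p assume p: "prime p" "p \<notin> S"
      have "pabs p ?n = (\<Prod>j<d. 1)"
        unfolding norm_pabs[OF UnI1[OF u] u0 p(1)] using u p by (intro prod.cong) (auto simp: S_def)
      then show "pabs p (inverse ?n) \<le> 1" using pabs_inverse[OF p(1) rat_imp_algebraic[OF nrat(1)]] by simp
    qed (use nrat in auto)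
    also have "cmod (inverse ?n) * (\<Prod>p\<in>S. pabs p (inverse ?n)) = inverse (cmod ?n * (\<Prod>p\<in>S. pabs p ?n))"
      using S pabs_inverse[OF _ rat_imp_algebraic[OF nrat(1)]]
      by (simp add: norm_inverse prod_inversef[unfolded o_def])
    also have "cmod ?n * (\<Prod>p\<in>S. pabs p ?n) = (\<Prod>i\<in>I \<union> J. place_abs \<Psi> i u)"
      using total[of u] u R(2) nz[OF mem, of _ u] u0 by auto
    finally have *: "1 \<le> inverse (\<Prod>i\<in>I \<union> J. place_abs \<Psi> i u)" .
    show ge: "1 \<le> (\<Prod>i\<in>I \<union> J. place_abs \<Psi> i u)" using prodge[of u] u UO u0 by auto
    from * show "(\<Prod>i\<in>I \<union> J. place_abs \<Psi> i u) \<le> 1"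
      using ge by (simp add: one_le_inverse_iff)
  qed
  have "height_system O' I J (place_abs \<Psi>) U N"
  proof
    show "csubring O'" by fact
    show "finite I" "finite J" using S by (auto simp: I_def J_def)
    show "I \<inter> J = {}" using S0 by (auto simp: I_def J_def)
    show "I \<noteq> {}" using d by (auto simp: I_def)
    show "U \<subseteq> O'" by fact
    fix i x assume i: "i \<in> I \<union> J"
    show "place_abs \<Psi> i x \<ge> 0" using i S by (auto simp: place_abs_def I_def J_def pabs_nonneg)
    { assume x: "x \<in> O'"
      then show "place_abs \<Psi> i (- x) = place_abs \<Psi> i x"
        using i O'R S uminus by (auto simp: place_abs_def I_def J_def hom_on_uminus[OF R(1) h])
      fix y assume "y \<in> O'"
      with x show "place_abs \<Psi> i (x * y) = place_abs \<Psi> i x * place_abs \<Psi> i y"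
        using i O'R S times S0 by (auto simp: place_abs_def I_def J_def hom_on_mult[OF R(1) h] norm_mult subset_iff)
    }
    { assume "x \<in> U"
      then have "x \<noteq> 0" "x \<in> R" using U0 R(2) by auto
      then show "place_abs \<Psi> i x > 0"
        using i S0 S(2) nz[OF mem, of _ x] alg[of _ x] \<open>x \<in> U\<close>
        by (auto simp: place_abs_def I_def J_def intro!: pabs_pos)
    }
  next
    fix i x y assume i: "i \<in> I" and xy: "x \<in> O'" "y \<in> O'"
    then show "place_abs \<Psi> i (x + y) \<le> place_abs \<Psi> i x + place_abs \<Psi> i y"
      using O'R by (auto simp: place_abs_def I_def hom_on_add[OF R(1) h] subset_iff norm_triangle_ineq)
  next
    fix i x y assume i: "i \<in> J" and xy: "x \<in> O'" "y \<in> O'"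
    then show "place_abs \<Psi> i (x + y) \<le> max (place_abs \<Psi> i x) (place_abs \<Psi> i y)"
      using O'R S0 S plus by (force simp: place_abs_def J_def subset_iff)
  next
    fix i n assume "i \<in> I"
    then show "place_abs \<Psi> i (of_nat n) = real n"
      by (auto simp: place_abs_def I_def hom_on_Rats[OF R(1) h])
  qed (use prod_U prodge in auto)
  then show ?thesis by blast
qed

section \<open>Separated points in bounded dimension\<close>

text \<open>
  Sums of points weighted with powers of \<open>t\<close> determine the points, like digits: the contributions
  below the top position where two words differ are at most
  \<open>(t - 1) * \<epsilon> * (1 + t + ... + t ^ (k - 1)) < t ^ k * \<epsilon>\<close> in norm and cannot compensate the top one.
\<close>

lemma separated_words_injective:
  fixes x :: "'a \<Rightarrow> 'i \<Rightarrow> real" and t :: real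
  assumes K: "finite K" and sep: "\<And>a b. a \<in> X \<Longrightarrow> b \<in> X \<Longrightarrow> a \<noteq> b \<Longrightarrow> (\<Sum>i\<in>K. \<bar>x a i - x b i\<bar>) > \<epsilon>"
    and diam: "\<And>a b. a \<in> X \<Longrightarrow> b \<in> X \<Longrightarrow> (\<Sum>i\<in>K. \<bar>x a i - x b i\<bar>) \<le> (t - 1) * \<epsilon>"
    and t: "t \<ge> 1" and \<epsilon>: "\<epsilon> \<ge> 0"
    and f: "\<And>j. j < k \<Longrightarrow> f j \<in> X" and g: "\<And>j. j < k \<Longrightarrow> g j \<in> X"
    and eq: "\<And>i. i \<in> K \<Longrightarrow> (\<Sum>j<k. t ^ j * x (f j) i) = (\<Sum>j<k. t ^ j * x (g j) i)"
  shows "\<forall>j<k. f j = g j"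
  using f g eq
proof (induction k)
  case (Suc k)
  define y where "y j i = x (f j) i - x (g j) i" for j i
  have top: "f k = g k"
  proof (rule ccontr)
    assume "f k \<noteq> g k"
    have geo: "(t - 1) * (\<Sum>j<k. t ^ j) = t ^ k - 1" by (rule power_diff_1_eq[symmetric])
    have "t ^ k * \<epsilon> < t ^ k * (\<Sum>i\<in>K. \<bar>y k i\<bar>)"
      using sep[OF _ _ \<open>f k \<noteq> g k\<close>] Suc.prems t by (intro mult_strict_left_mono) (auto simp: y_def)
    also have "\<dots> = (\<Sum>i\<in>K. \<bar>t ^ k * y k i\<bar>)"
      using t by (simp add: sum_distrib_left abs_mult)
    also have "\<dots> = (\<Sum>i\<in>K. \<bar>\<Sum>j<k. t ^ j * y j i\<bar>)"
    proof (rule sum.cong)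
      fix i assume "i \<in> K"
      then have "t ^ k * y k i = - (\<Sum>j<k. t ^ j * y j i)"
        using Suc.prems(3)[of i] by (simp add: y_def sum_subtractf algebra_simps)
      then show "\<bar>t ^ k * y k i\<bar> = \<bar>\<Sum>j<k. t ^ j * y j i\<bar>" by simp
    qed simp
    also have "\<dots> \<le> (\<Sum>i\<in>K. \<Sum>j<k. \<bar>t ^ j * y j i\<bar>)"
      by (intro sum_mono sum_abs)
    also have "\<dots> = (\<Sum>j<k. t ^ j * (\<Sum>i\<in>K. \<bar>y j i\<bar>))"
      using t by (subst sum.swap) (simp add: sum_distrib_left abs_mult)
    also have "\<dots> \<le> (\<Sum>j<k. t ^ j * ((t - 1) * \<epsilon>))"
      using diam Suc.prems t unfolding y_def by (intro sum_mono mult_left_mono) auto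
    also have "\<dots> = ((t - 1) * (\<Sum>j<k. t ^ j)) * \<epsilon>"
      by (simp add: sum_distrib_left sum_distrib_right algebra_simps)
    also have "\<dots> = t ^ k * \<epsilon> - \<epsilon>" unfolding geo by (simp add: algebra_simps)
    finally show False using \<epsilon> by simp
  qed
  have "\<forall>j<k. f j = g j"
  proof (rule Suc.IH)
    show "(\<Sum>j<k. t ^ j * x (f j) i) = (\<Sum>j<k. t ^ j * x (g j) i)" if "i \<in> K" for i
      using Suc.prems(3)[OF that] top by simp
  qed (use Suc.prems in auto)
  with top show ?case by (auto simp: less_Suc_eq)
qed simp

lemma bounded_powers_imp_le:
  assumes "\<And>k. N ^ k \<le> c * t ^ k"
  shows "N \<le> (t :: nat)"
proof (rule ccontr)
  assume "\<not> N \<le> t"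
  then have N: "N > t" by simp
  show False
  proof (cases "t = 0")
    case True
    then show False using assms[of 1] N by simp
  next
    case False
    then have "real N / real t > 1" using N by simp
    then obtain k where k: "real c < (real N / real t) ^ k" using real_arch_pow by blast
    then have "real c * real t ^ k < real N ^ k" using False by (simp add: power_divide field_simps)
    then have "c * t ^ k < N ^ k" by (metis of_nat_less_iff of_nat_mult of_nat_power)
    then show False using assms[of k] by simp
  qed
qed

text \<open>
  The points may be assumed to be integer combinations of the \<open>card G\<close> generators. The weighted sums of
  words of length \<open>k\<close> are \<open>card X ^ k\<close> different combinations with coefficients bounded by a constant
  times \<open>t ^ k\<close>, of which there are at most a constant times \<open>(t ^ card G) ^ k\<close>. The constants, which depend on
  the generators, disappear as \<open>k\<close> grows.
\<close>

lemma separated_card_le: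
  fixes x :: "'a \<Rightarrow> 'i \<Rightarrow> real" and t :: nat and g :: "'b \<Rightarrow> 'i \<Rightarrow> real"
  assumes fin: "finite K" "finite X" "finite G"
    and sep: "\<And>a b. a \<in> X \<Longrightarrow> b \<in> X \<Longrightarrow> a \<noteq> b \<Longrightarrow> (\<Sum>i\<in>K. \<bar>x a i - x b i\<bar>) > \<epsilon>"
    and diam: "\<And>a b. a \<in> X \<Longrightarrow> b \<in> X \<Longrightarrow> (\<Sum>i\<in>K. \<bar>x a i - x b i\<bar>) \<le> (real t - 1) * \<epsilon>"
    and t: "t \<ge> 2" and \<epsilon>: "\<epsilon> \<ge> 0"
    and span: "\<And>a. a \<in> X \<Longrightarrow> \<exists>n>0. \<exists>e. \<forall>i\<in>K. real n * x a i = (\<Sum>b\<in>G. of_int (e b) * g b i)"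
  shows "card X \<le> t ^ card G"
proof -
  obtain n0 e0 where ne0: "\<And>a. a \<in> X \<Longrightarrow> n0 a > (0 :: nat)"
    "\<And>a i. a \<in> X \<Longrightarrow> i \<in> K \<Longrightarrow> real (n0 a) * x a i = (\<Sum>b\<in>G. of_int (e0 a b) * g b i)"
    using span by metis
  define n where "n = prod n0 X"
  have n: "n > 0" using ne0(1) fin by (auto simp: n_def intro: prod_pos)
  define e where "e a b = int (prod n0 (X - {a})) * e0 a b" for a b
  have e: "real n * x a i = (\<Sum>b\<in>G. of_int (e a b) * g b i)" if "a \<in> X" "i \<in> K" for a i
  proof -
    have "n = prod n0 (X - {a}) * n0 a" using fin that by (simp add: n_def prod.remove mult.commute)
    then have "real n * x a i = real (prod n0 (X - {a})) * (real (n0 a) * x a i)" by simp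
    also have "\<dots> = (\<Sum>b\<in>G. of_int (e a b) * g b i)"
      unfolding ne0(2)[OF that] by (simp add: e_def sum_distrib_left mult.assoc)
    finally show ?thesis .
  qed
  define M where "M = (\<Sum>a\<in>X. \<Sum>b\<in>G. \<bar>e a b\<bar>)"
  have M: "\<bar>e a b\<bar> \<le> M" if "a \<in> X" "b \<in> G" for a b
  proof -
    have "\<bar>e a b\<bar> \<le> (\<Sum>b\<in>G. \<bar>e a b\<bar>)" using that fin by (intro member_le_sum) auto
    also have "\<dots> \<le> M" unfolding M_def
      using that fin by (intro member_le_sum[where f = "\<lambda>a. \<Sum>b\<in>G. \<bar>e a b\<bar>"]) (auto intro: sum_nonneg)
    finally show ?thesis .
  qed
  have M0: "M \<ge> 0" by (auto simp: M_def intro!: sum_nonneg)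
  have bound: "card X ^ k \<le> nat (2 * M + 1) ^ card G * (t ^ card G) ^ k" for k
  proof -
    define E where "E f = (\<lambda>b\<in>G. \<Sum>j<k. int t ^ j * e (f j) b)" for f
    have tk: "(\<Sum>j<k. int t ^ j) \<le> int t ^ k"
    proof (induction k)
      case (Suc k)
      then have "(\<Sum>j<Suc k. int t ^ j) \<le> 2 * int t ^ k" by simp
      also have "\<dots> \<le> int t * int t ^ k" using t by (intro mult_right_mono) auto
      finally show ?case by simp
    qed simp
    define L where "L = M * int t ^ k"
    have "inj_on E ({..<k} \<rightarrow>\<^sub>E X)"
    proof (rule inj_onI)
      fix f h assume f: "f \<in> {..<k} \<rightarrow>\<^sub>E X" and h: "h \<in> {..<k} \<rightarrow>\<^sub>E X" and eq: "E f = E h"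
      have comb: "real n * (\<Sum>j<k. real t ^ j * x (f j) i) = (\<Sum>b\<in>G. of_int (E f b) * g b i)"
        if f: "f \<in> {..<k} \<rightarrow>\<^sub>E X" and i: "i \<in> K" for f i
      proof -
        have "real n * (\<Sum>j<k. real t ^ j * x (f j) i) = (\<Sum>j<k. real t ^ j * (real n * x (f j) i))"
          by (simp add: sum_distrib_left algebra_simps)
        also have "\<dots> = (\<Sum>j<k. real t ^ j * (\<Sum>b\<in>G. of_int (e (f j) b) * g b i))"
          using f i e by (intro sum.cong refl) (auto simp: PiE_def Pi_def)
        also have "\<dots> = (\<Sum>b\<in>G. (\<Sum>j<k. real t ^ j * of_int (e (f j) b)) * g b i)"
          by (simp add: sum_distrib_left sum_distrib_right mult.assoc) (rule sum.swap)
        also have "\<dots> = (\<Sum>b\<in>G. of_int (E f b) * g b i)"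
          by (intro sum.cong refl) (simp add: E_def)
        finally show ?thesis .
      qed
      have "\<forall>j<k. f j = h j"
      proof (rule separated_words_injective[where x = x and K = K and X = X and \<epsilon> = \<epsilon> and t = "real t"])
        fix i assume i: "i \<in> K"
        have "real n * (\<Sum>j<k. real t ^ j * x (f j) i) = real n * (\<Sum>j<k. real t ^ j * x (h j) i)"
          unfolding comb[OF f i] comb[OF h i] eq ..
        then show "(\<Sum>j<k. real t ^ j * x (f j) i) = (\<Sum>j<k. real t ^ j * x (h j) i)"
          using n by simp
      next
        show "f j \<in> X" "h j \<in> X" if "j < k" for j using f h that by auto
      qed (use fin(1) t \<epsilon> in \<open>auto intro: sep diam\<close>)
      then show "f = h" using f h by (intro PiE_ext) auto
    qed
    moreover have "E ` ({..<k} \<rightarrow>\<^sub>E X) \<subseteq> G \<rightarrow>\<^sub>E {- L..L}"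
    proof -
      have "(\<Sum>j<k. int t ^ j * e (f j) b) \<in> {- L..L}" if "f \<in> {..<k} \<rightarrow>\<^sub>E X" "b \<in> G" for f b
      proof -
        have "\<bar>\<Sum>j<k. int t ^ j * e (f j) b\<bar> \<le> (\<Sum>j<k. \<bar>int t ^ j * e (f j) b\<bar>)" by (rule sum_abs)
        also have "\<dots> \<le> (\<Sum>j<k. int t ^ j * M)"
          using that M by (intro sum_mono) (auto simp: abs_mult intro!: mult_left_mono)
        also have "\<dots> = M * (\<Sum>j<k. int t ^ j)" by (simp add: sum_distrib_left mult.commute)
        also have "\<dots> \<le> L" unfolding L_def using M0 tk by (intro mult_left_mono)
        finally show ?thesis by (simp add: abs_le_iff)
      qed
      then show ?thesis by (auto simp: E_def)
    qed
    ultimately have "card ({..<k} \<rightarrow>\<^sub>E X) \<le> card (G \<rightarrow>\<^sub>E {- L..L})"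
      using fin by (intro card_inj_on_le) (auto intro: finite_PiE)
    then have "card X ^ k \<le> nat (2 * L + 1) ^ card G"
      using fin by (simp add: card_PiE)
    also have "nat (2 * L + 1) \<le> nat (2 * M + 1) * t ^ k"
    proof -
      have "int t ^ k \<ge> 1" using t by (simp add: one_le_power)
      then have "2 * L + 1 \<le> (2 * M + 1) * int t ^ k" by (simp add: L_def algebra_simps)
      then have "nat (2 * L + 1) \<le> nat ((2 * M + 1) * int t ^ k)" by (rule nat_mono)
      also have "\<dots> = nat (2 * M + 1) * t ^ k" using M0 by (simp add: nat_mult_distrib nat_power_eq)
      finally show ?thesis .
    qed
    finally have "card X ^ k \<le> (nat (2 * M + 1) * t ^ k) ^ card G"
      by (meson order.trans power_mono zero_le)
    then show ?thesis by (simp add: power_mult_distrib power_mult[symmetric] mult.commute)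
  qed
  show ?thesis using bound by (rule bounded_powers_imp_le)
qed

section \<open>Heights and the gap principle\<close>

lemma ln_max_eq:
  assumes "a > 0" "b > (0 :: real)"
  shows "ln (max a b) = (ln a + ln b + \<bar>ln a - ln b\<bar>) / 2"
  using assms by (cases "a \<le> b") (auto simp: max_def)

context height_system
begin

definition hdist :: "complex \<Rightarrow> complex \<Rightarrow> real" where
  "hdist x y = (\<Sum>i\<in>I \<union> J. \<bar>ln (v i x) - ln (v i y)\<bar>) / (2 * card I)"

lemma card_I: "real (card I) > 0"
  using finite arch by (simp add: card_gt_0_iff)

lemma hdist_commute: "hdist x y = hdist y x"
  by (simp add: hdist_def abs_minus_commute)

lemma hdist_refl [simp]: "hdist x x = 0"
  by (simp add: hdist_def)

lemma hdist_nonneg: "hdist x y \<ge> 0"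
  by (auto simp: hdist_def intro!: sum_nonneg divide_nonneg_nonneg)

lemma hdist_triangle: "hdist x z \<le> hdist x y + hdist y z"
proof -
  have "(\<Sum>i\<in>I \<union> J. \<bar>ln (v i x) - ln (v i z)\<bar>) \<le>
      (\<Sum>i\<in>I \<union> J. \<bar>ln (v i x) - ln (v i y)\<bar> + \<bar>ln (v i y) - ln (v i z)\<bar>)"
    by (intro sum_mono) simp
  then show ?thesis
    unfolding hdist_def add_divide_distrib[symmetric] sum.distrib[symmetric] by (intro divide_right_mono) auto
qed

lemma sum_ln_unit:
  assumes "u \<in> U"
  shows "(\<Sum>i\<in>I \<union> J. ln (v i u)) = 0"
proof -
  have "v i u \<noteq> 0" if "i \<in> I \<union> J" for i using U(2)[OF that assms] by simp
  then show ?thesis using ln_prod[of "I \<union> J" "\<lambda>i. v i u"] unit_product[OF assms] finite by simp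
qed

text \<open>
  The left-hand side is \<open>card I\<close> times the logarithmic height of \<open>(x : y)\<close>. It is a distance because
  the coordinates of the logarithmic vector of an element of \<open>U\<close> sum up to 0.
\<close>

lemma sum_ln_max:
  assumes "x \<in> U" "y \<in> U"
  shows "(\<Sum>i\<in>I \<union> J. ln (max (v i x) (v i y))) = card I * hdist x y"
proof -
  have "(\<Sum>i\<in>I \<union> J. ln (max (v i x) (v i y))) =
      (\<Sum>i\<in>I \<union> J. (ln (v i x) + ln (v i y) + \<bar>ln (v i x) - ln (v i y)\<bar>) / 2)"
    using U(2) assms by (intro sum.cong ln_max_eq) auto
  also have "\<dots> = (\<Sum>i\<in>I \<union> J. \<bar>ln (v i x) - ln (v i y)\<bar>) / 2"
    by (simp add: sum_divide_distrib[symmetric] sum.distrib sum_ln_unit assms)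
  finally show ?thesis using card_I by (simp add: hdist_def)
qed

lemma sum_ln_le:
  assumes "\<And>i. i \<in> I \<union> J \<Longrightarrow> f i > 0" "\<And>i. i \<in> I \<union> J \<Longrightarrow> g i > 0" "c > 0"
    and "\<And>i. i \<in> I \<Longrightarrow> f i \<le> c * g i" "\<And>i. i \<in> J \<Longrightarrow> f i \<le> g i"
  shows "(\<Sum>i\<in>I \<union> J. ln (f i)) \<le> card I * ln c + (\<Sum>i\<in>I \<union> J. ln (g i))"
proof -
  have split: "(\<Sum>i\<in>I \<union> J. h i) = (\<Sum>i\<in>I. h i) + (\<Sum>i\<in>J. h i)" for h :: "'i \<Rightarrow> real"
    using finite disjoint by (intro sum.union_disjoint)
  have "(\<Sum>i\<in>I. ln (f i)) \<le> (\<Sum>i\<in>I. ln c + ln (g i))"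
  proof (intro sum_mono)
    fix i assume "i \<in> I"
    then have "ln (f i) \<le> ln (c * g i)" using assms by (subst ln_le_cancel_iff) auto
    then show "ln (f i) \<le> ln c + ln (g i)" using assms(2)[of i] assms(3) \<open>i \<in> I\<close> by (simp add: ln_mult_pos)
  qed
  moreover have "(\<Sum>i\<in>J. ln (f i)) \<le> (\<Sum>i\<in>J. ln (g i))"
    using assms by (intro sum_mono) (subst ln_le_cancel_iff, auto)
  ultimately show ?thesis by (simp add: split sum.distrib)
qed

lemma product_pos:
  assumes "x \<in> R" "x \<in> N" "x \<noteq> 0" "i \<in> I \<union> J"
  shows "v i x > 0"
proof -
  have "v i x \<noteq> 0"
  proof
    assume "v i x = 0"
    then have "(\<Prod>i\<in>I \<union> J. v i x) = 0" using finite assms(4) by auto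
    then show False using product[OF assms(1-3)] by simp
  qed
  then show ?thesis using nonneg[OF assms(4,1)] by simp
qed

lemma sum_ln_nonneg:
  assumes "x \<in> R" "x \<in> N" "x \<noteq> 0"
  shows "(\<Sum>i\<in>I \<union> J. ln (v i x)) \<ge> 0"
proof -
  have "v i x \<noteq> 0" if "i \<in> I \<union> J" for i using product_pos[OF assms that] by simp
  then have "(\<Sum>i\<in>I \<union> J. ln (v i x)) = ln (\<Prod>i\<in>I \<union> J. v i x)"
    using finite by (intro ln_prod[symmetric]) auto
  then show ?thesis using product[OF assms] by simp
qed

lemma diff_le:
  assumes "x \<in> R" "y \<in> R"
  shows "i \<in> I \<Longrightarrow> v i (x - y) \<le> v i x + v i y" "i \<in> J \<Longrightarrow> v i (x - y) \<le> max (v i x) (v i y)"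
  using triangle[of i x "- y"] ultrametric[of i x "- y"] uminus[of i y] assms csubring_uminus[OF ring] by auto

lemma hdist_add_le:
  assumes "a \<in> U" "b \<in> U" "a + b \<in> U"
  shows "hdist (a + b) a \<le> ln 2 + hdist a b"
proof -
  have R: "a \<in> R" "b \<in> R" using assms U(1) by auto
  have "(\<Sum>i\<in>I \<union> J. ln (max (v i (a + b)) (v i a))) \<le>
      card I * ln 2 + (\<Sum>i\<in>I \<union> J. ln (max (v i a) (v i b)))"
    using assms R U(2) triangle[OF _ R] ultrametric[OF _ R] nonneg
    by (intro sum_ln_le) (auto simp: less_max_iff_disj, fastforce+)
  then have "card I * hdist (a + b) a \<le> card I * (ln 2 + hdist a b)"
    using assms by (simp add: sum_ln_max algebra_simps)
  then show ?thesis using card_I by simp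
qed

text \<open>
  Cramer's rule for \<open>a + b = s\<close>, \<open>a + c = t\<close>: \<open>a * (b - c) = b * t - c * s\<close> and
  \<open>b * (b - c) = b * s - b * t\<close>. By the product formula the common factor \<open>b - c\<close> contributes
  at least 0 to the sum of the logarithms.
\<close>

lemma gap_principle:
  assumes abc: "a \<in> U" "b \<in> U" "c \<in> U" and st: "a + b \<in> U" "a + c \<in> U"
    and bc: "b \<noteq> c" "b - c \<in> N"
  shows "hdist a b \<le> ln 2 + hdist b c + hdist (a + b) (a + c)"
proof -
  have R: "a \<in> R" "b \<in> R" "c \<in> R" "a + b \<in> R" "a + c \<in> R" using assms U(1) by auto
  have bcR: "b - c \<in> R" using R csubring_diff[OF ring] by auto
  note m = csubring_mult[OF ring]
  define f where "f i = max (v i a) (v i b) * v i (b - c)" for i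
  define g where "g i = max (v i b) (v i c) * max (v i (a + b)) (v i (a + c))" for i
  have pos: "v i (b - c) > 0" if "i \<in> I \<union> J" for i
    using product_pos[OF bcR bc(2) _ that] bc(1) by simp
  have f: "f i > 0" and g: "g i > 0" if "i \<in> I \<union> J" for i
    using pos[OF that] U(2)[OF that] assms by (auto simp: f_def g_def less_max_iff_disj intro!: mult_pos_pos)
  have fe: "f i = max (v i (b * (a + c) - c * (a + b))) (v i (b * (a + b) - b * (a + c)))" if "i \<in> I \<union> J" for i
  proof -
    have "f i = max (v i (a * (b - c))) (v i (b * (b - c)))"
      using mult[OF that] R bcR nonneg[OF that bcR] by (simp add: f_def max_mult_distrib_right)
    then show ?thesis by (simp add: algebra_simps)
  qed
  have prods: "v i (x * y) \<le> g i" if "i \<in> I \<union> J" "x = b \<or> x = c" "y = a + b \<or> y = a + c" for i x y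
  proof -
    have "v i x \<le> max (v i b) (v i c)" "v i y \<le> max (v i (a + b)) (v i (a + c))" "v i x \<ge> 0" "v i y \<ge> 0" "x \<in> R" "y \<in> R"
      using that R nonneg by auto
    then show ?thesis using mult[OF that(1)] by (auto simp: g_def intro!: mult_mono)
  qed
  have "(\<Sum>i\<in>I \<union> J. ln (f i)) \<le> card I * ln 2 + (\<Sum>i\<in>I \<union> J. ln (g i))"
  proof (intro sum_ln_le f g)
    fix i assume i: "i \<in> I"
    show "f i \<le> 2 * g i" unfolding fe[OF UnI1[OF i]]
      using diff_le(1)[OF m[OF R(2,5)] m[OF R(3,4)] i] diff_le(1)[OF m[OF R(2,4)] m[OF R(2,5)] i]
        prods[OF UnI1[OF i], of b "a + c"] prods[OF UnI1[OF i], of c "a + b"] prods[OF UnI1[OF i], of b "a + b"]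
      by auto
  next
    fix i assume i: "i \<in> J"
    show "f i \<le> g i" unfolding fe[OF UnI2[OF i]]
      using diff_le(2)[OF m[OF R(2,5)] m[OF R(3,4)] i] diff_le(2)[OF m[OF R(2,4)] m[OF R(2,5)] i]
        prods[OF UnI2[OF i], of b "a + c"] prods[OF UnI2[OF i], of c "a + b"] prods[OF UnI2[OF i], of b "a + b"]
      by auto
  qed auto
  moreover have "(\<Sum>i\<in>I \<union> J. ln (f i)) = card I * hdist a b + (\<Sum>i\<in>I \<union> J. ln (v i (b - c)))"
    unfolding sum_ln_max[OF abc(1,2), symmetric] sum.distrib[symmetric] f_def
    using pos U(2) abc by (intro sum.cong refl ln_mult_pos) (auto simp: less_max_iff_disj)
  moreover have "(\<Sum>i\<in>I \<union> J. ln (g i)) = card I * hdist b c + card I * hdist (a + b) (a + c)"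
    unfolding sum_ln_max[OF abc(2,3), symmetric] sum_ln_max[OF st, symmetric] sum.distrib[symmetric] g_def
    using U(2) abc st by (intro sum.cong refl ln_mult_pos) (auto simp: less_max_iff_disj)
  moreover have "(\<Sum>i\<in>I \<union> J. ln (v i (b - c))) \<ge> 0" using sum_ln_nonneg[OF bcR bc(2)] bc(1) by simp
  ultimately have "card I * hdist a b \<le> card I * (ln 2 + hdist b c + hdist (a + b) (a + c))"
    by (simp add: algebra_simps)
  then show ?thesis using card_I by simp
qed

text \<open>
  The gain of a factor \<open>4 / c < 1\<close> at each archimedean place exceeds the height of the point
  \<open>(m1 : m2 : m3 : m4)\<close>, which is at most \<open>3 * \<delta>\<close>; so the product of the absolute values of \<open>f\<close> is
  less than 1.
\<close>

lemma small_height_vanishes: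
  assumes m: "m1 \<in> U" "m2 \<in> U" "m3 \<in> U" "m4 \<in> U"
    and close: "hdist m1 m2 \<le> \<delta>" "hdist m1 m3 \<le> \<delta>" "hdist m1 m4 \<le> \<delta>"
    and f: "f \<in> R" "f \<in> N" and c: "c > 0"
    and arch_le: "\<And>i. i \<in> I \<Longrightarrow> c * v i f \<le> 4 * max (max (v i m1) (v i m2)) (max (v i m3) (v i m4)) ^ n"
    and nonarch_le: "\<And>i. i \<in> J \<Longrightarrow> v i f \<le> max (max (v i m1) (v i m2)) (max (v i m3) (v i m4)) ^ n"
    and small: "ln (4 / c) + 3 * real n * \<delta> < 0"
  shows "f = 0"
proof (rule ccontr)
  assume f0: "f \<noteq> 0"
  define M where "M i = max (max (v i m1) (v i m2)) (max (v i m3) (v i m4))" for i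
  have Mpos: "M i > 0" if "i \<in> I \<union> J" for i using U(2)[OF that m(1)] by (simp add: M_def less_max_iff_disj)
  have "0 \<le> (\<Sum>i\<in>I \<union> J. ln (v i f))" by (rule sum_ln_nonneg[OF f f0])
  also have "\<dots> \<le> card I * ln (4 / c) + (\<Sum>i\<in>I \<union> J. ln (M i ^ n))"
    using product_pos[OF f f0] Mpos c arch_le nonarch_le
    by (intro sum_ln_le) (auto simp: M_def field_simps)
  also have "(\<Sum>i\<in>I \<union> J. ln (M i ^ n)) = n * (\<Sum>i\<in>I \<union> J. ln (M i))"
    using Mpos by (simp add: ln_realpow sum_distrib_left)
  also have "(\<Sum>i\<in>I \<union> J. ln (M i)) \<le> (\<Sum>i\<in>I \<union> J. ln (max (v i m1) (v i m2)) + ln (max (v i m1) (v i m3))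
      + ln (max (v i m1) (v i m4)) - 2 * ln (v i m1))"
  proof (intro sum_mono)
    fix i assume i: "i \<in> I \<union> J"
    have pos: "v i m1 > 0" "v i m2 > 0" "v i m3 > 0" "v i m4 > 0" using U(2)[OF i] m by auto
    have mono: "ln (v i m1) \<le> ln (max (v i m1) y)" "y > 0 \<Longrightarrow> ln y \<le> ln (max (v i m1) y)" for y
      using pos by (subst ln_le_cancel_iff; simp add: less_max_iff_disj)+
    have "ln (M i) = ln (v i m1) \<or> ln (M i) = ln (v i m2) \<or> ln (M i) = ln (v i m3) \<or> ln (M i) = ln (v i m4)"
      unfolding M_def max_def by auto
    then show "ln (M i) \<le> ln (max (v i m1) (v i m2)) + ln (max (v i m1) (v i m3)) + ln (max (v i m1) (v i m4)) - 2 * ln (v i m1)"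
      using mono(1)[of "v i m2"] mono(1)[of "v i m3"] mono(1)[of "v i m4"]
        mono(2)[OF pos(2)] mono(2)[OF pos(3)] mono(2)[OF pos(4)] by linarith
  qed
  also have "\<dots> = card I * (hdist m1 m2 + hdist m1 m3 + hdist m1 m4)"
    by (simp add: sum.distrib sum_subtractf sum_ln_max m sum_ln_unit sum_distrib_left[symmetric] algebra_simps)
  finally have "0 \<le> card I * ln (4 / c) + n * (card I * (hdist m1 m2 + hdist m1 m3 + hdist m1 m4))"
    by (simp add: mult_left_mono)
  also have "\<dots> \<le> card I * ln (4 / c) + n * (card I * (3 * \<delta>))"
    using close by (intro add_left_mono mult_left_mono) auto
  also have "\<dots> = card I * (ln (4 / c) + 3 * real n * \<delta>)" by (simp add: algebra_simps)
  also have "\<dots> < 0" using card_I small by (rule mult_pos_neg)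
  finally show False by simp
qed

end

section \<open>Rectangles of small height\<close>

text \<open>
  For \<open>p = 5, 7\<close> the form \<open>((x + y + z) ^ p - x ^ p - y ^ p - z ^ p) / p\<close> in a factorised shape.
\<close>

definition quintic :: "complex \<Rightarrow> complex \<Rightarrow> complex \<Rightarrow> complex" where
  "quintic x y z = (x + y) * (y + z) * (z + x) * (x * x + y * y + z * z + x * y + y * z + z * x)"

definition septic :: "complex \<Rightarrow> complex \<Rightarrow> complex \<Rightarrow> complex" where
  "septic x y z = (x + y) * (y + z) * (z + x) *
     ((x * x + y * y + z * z + x * y + y * z + z * x) * (x * x + y * y + z * z + x * y + y * z + z * x)
      + x * y * z * (x + y + z))"

lemma quintic_eq: "5 * quintic x y z = (x + y + z) ^ 5 + - (x ^ 5) + - (y ^ 5) + - (z ^ 5)"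
  unfolding quintic_def by algebra

lemma septic_eq: "7 * septic x y z = (x + y + z) ^ 7 + - (x ^ 7) + - (y ^ 7) + - (z ^ 7)"
  unfolding septic_def by algebra

context height_system
begin

lemma arch_power:
  assumes "i \<in> I" "x \<in> R"
  shows "v i (x ^ n) = v i x ^ n"
proof (induction n)
  case 0
  show ?case using arch_nat[OF assms(1), of 1] by simp
next
  case (Suc n)
  then show ?case using mult[of i x "x ^ n"] assms csubring_power[OF ring] by simp
qed

text \<open>
  At an archimedean place the factor \<open>c\<close> is a gain against the four terms.
\<close>

lemma arch_sum_of_powers:
  assumes i: "i \<in> I" and xyz: "x \<in> R" "y \<in> R" "z \<in> R"
    and M: "v i x \<le> M" "v i y \<le> M" "v i z \<le> M" "v i (x + y + z) \<le> M"
    and f: "f \<in> R" "of_nat c * f = (x + y + z) ^ n + - (x ^ n) + - (y ^ n) + - (z ^ n)"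
  shows "c * v i f \<le> 4 * M ^ n"
proof -
  note cl = csubring_closed[OF ring]
  have i': "i \<in> I \<union> J" using i by simp
  have pow: "v i (w ^ n) \<le> M ^ n" if "w \<in> R" "v i w \<le> M" for w
    unfolding arch_power[OF i that(1)] using that nonneg[OF i' that(1)] by (intro power_mono)
  have add: "v i (a + - (w ^ n)) \<le> B + M ^ n" if "a \<in> R" "v i a \<le> B" "w \<in> R" "v i w \<le> M" for a w B
    using triangle[OF i that(1) cl(5)[OF cl(7)[OF that(3)]]] uminus[OF i' cl(7)[OF that(3)]] pow[OF that(3,4)] that(2)
    by (metis add_mono order.trans)
  have w: "x + y + z \<in> R" by (intro cl xyz)
  have "v i ((x + y + z) ^ n + - (x ^ n) + - (y ^ n) + - (z ^ n)) \<le> M ^ n + M ^ n + M ^ n + M ^ n"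
    by (rule add[OF _ add[OF _ add[OF _ pow]]]) (use xyz w M in \<open>auto intro!: cl\<close>)
  also have "(x + y + z) ^ n + - (x ^ n) + - (y ^ n) + - (z ^ n) = of_nat c * f" using f by simp
  also have "v i (of_nat c * f) = c * v i f"
    using mult[OF i' csubring_of_nat[OF ring] f(1)] arch_nat[OF i] by simp
  finally show ?thesis by simp
qed

text \<open>
  At a nonarchimedean place only the integrality of the forms and their degrees matter.
\<close>

lemma nonarch_bounds:
  assumes j: "j \<in> J" and xyz: "x \<in> R" "y \<in> R" "z \<in> R"
    and M: "v j x \<le> M" "v j y \<le> M" "v j z \<le> M" "v j (x + y + z) \<le> M"
  shows "v j (quintic x y z) \<le> M ^ 5" "v j (septic x y z) \<le> M ^ 7"
proof -
  note cl = csubring_closed[OF ring]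
  have j': "j \<in> I \<union> J" using j by simp
  define P where "P n w \<longleftrightarrow> w \<in> R \<and> v j w \<le> M ^ n" for n w
  have add: "P n (a + b)" if "P n a" "P n b" for n a b
  proof -
    have "v j (a + b) \<le> max (v j a) (v j b)" using ultrametric[OF j] that by (simp add: P_def)
    then show ?thesis using that by (auto simp: P_def intro: cl)
  qed
  have mul: "P (m + n) (a * b)" if "P m a" "P n b" for m n a b
  proof -
    have ab: "a \<in> R" "b \<in> R" using that by (auto simp: P_def)
    have "v j a * v j b \<le> M ^ m * M ^ n"
      using that nonneg[OF j' ab(1)] nonneg[OF j' ab(2)] by (intro mult_mono) (auto simp: P_def)
    then show ?thesis using mult[OF j' ab] cl(3)[OF ab] by (simp add: P_def power_add)
  qed
  have x: "P 1 x" and y: "P 1 y" and z: "P 1 z" and w: "P 1 (x + y + z)"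
    using xyz M by (auto simp: P_def intro!: cl)
  have lin: "P (1 + 1 + 1) ((x + y) * (y + z) * (z + x))"
    by (intro mul add x y z)
  have quad: "P (1 + 1) (x * x + y * y + z * z + x * y + y * z + z * x)"
    by (intro mul add x y z)
  have "P (1 + 1 + 1 + (1 + 1)) (quintic x y z)" unfolding quintic_def by (intro mul[OF lin quad])
  then show "v j (quintic x y z) \<le> M ^ 5" by (simp add: P_def numeral_eq_Suc)
  have "P (1 + 1 + 1 + 1) (x * y * z * (x + y + z))" by (intro mul x y z w)
  moreover have "P (1 + 1 + (1 + 1)) ((x * x + y * y + z * z + x * y + y * z + z * x) * (x * x + y * y + z * z + x * y + y * z + z * x))"
    by (rule mul[OF quad quad])
  ultimately have "P (1 + 1 + (1 + 1)) ((x * x + y * y + z * z + x * y + y * z + z * x) * (x * x + y * y + z * z + x * y + y * z + z * x)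
      + x * y * z * (x + y + z))" by (intro add) (simp_all add: numeral_eq_Suc)
  from mul[OF lin this] show "v j (septic x y z) \<le> M ^ 7" by (simp add: septic_def P_def numeral_eq_Suc)
qed

text \<open>
  Both forms vanish. If \<open>z + x\<close> were nonzero, the quintic one would force the quadratic factor to vanish,
  and then the septic one would be a product of nonzero factors.
\<close>

lemma close_rectangle:
  assumes m: "m1 \<in> U" "m2 \<in> U" "m3 \<in> U" "m4 \<in> U" and m4: "m4 = m1 - m2 + m3"
    and close: "hdist m1 m2 \<le> 1/100" "hdist m1 m3 \<le> 1/100" "hdist m1 m4 \<le> 1/100"
    and N: "quintic m1 (- m2) m3 \<in> N" "septic m1 (- m2) m3 \<in> N"
    and ne: "m1 \<noteq> m2" "m3 \<noteq> m2"
  shows "m1 + m3 = 0"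
proof (rule ccontr)
  assume sum: "m1 + m3 \<noteq> 0"
  note cl = csubring_closed[OF ring]
  have R: "m1 \<in> R" "m2 \<in> R" "m3 \<in> R" "m4 \<in> R" "- m2 \<in> R" using m U(1) cl(5) by auto
  define x y z where "x = m1" and "y = - m2" and "z = m3"
  have xyz: "x \<in> R" "y \<in> R" "z \<in> R" "x + y + z = m4" using R m4 by (auto simp: x_def y_def z_def)
  define M where "M i = max (max (v i m1) (v i m2)) (max (v i m3) (v i m4))" for i
  have M: "v i x \<le> M i" "v i y \<le> M i" "v i z \<le> M i" "v i (x + y + z) \<le> M i" if "i \<in> I \<union> J" for i
    using uminus[OF that R(2)] unfolding xyz(4) by (auto simp: M_def x_def y_def z_def)
  have fR: "quintic x y z \<in> R" "septic x y z \<in> R"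
    unfolding quintic_def septic_def by (intro cl xyz(1-3))+
  have "quintic x y z = 0"
  proof (rule small_height_vanishes[OF m close fR(1), where c = 5 and n = 5])
    show "quintic x y z \<in> N" using N by (simp add: x_def y_def z_def)
    show "5 * v i (quintic x y z) \<le> 4 * max (max (v i m1) (v i m2)) (max (v i m3) (v i m4)) ^ 5" if "i \<in> I" for i
      using arch_sum_of_powers[OF that xyz(1-3) M fR(1), of 5 5] that quintic_eq[of x y z] by (simp add: M_def)
    show "v i (quintic x y z) \<le> max (max (v i m1) (v i m2)) (max (v i m3) (v i m4)) ^ 5" if "i \<in> J" for i
      using nonarch_bounds(1)[OF that xyz(1-3) M] that by (simp add: M_def)
    \<comment> \<open>This is where \<open>1/100\<close> is small enough: \<open>ln (4 / 5) \<le> - 1/5 < - 15/100\<close>.\<close>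
    show "ln (4 / 5) + 3 * real 5 * (1 / 100) < 0" using ln_le_minus_one[of "4 / 5"] by simp
  qed auto
  moreover have "septic x y z = 0"
  proof (rule small_height_vanishes[OF m close fR(2), where c = 7 and n = 7])
    show "septic x y z \<in> N" using N by (simp add: x_def y_def z_def)
    show "7 * v i (septic x y z) \<le> 4 * max (max (v i m1) (v i m2)) (max (v i m3) (v i m4)) ^ 7" if "i \<in> I" for i
      using arch_sum_of_powers[OF that xyz(1-3) M fR(2), of 7 7] that septic_eq[of x y z] by (simp add: M_def)
    show "v i (septic x y z) \<le> max (max (v i m1) (v i m2)) (max (v i m3) (v i m4)) ^ 7" if "i \<in> J" for i
      using nonarch_bounds(2)[OF that xyz(1-3) M] that by (simp add: M_def)
    show "ln (4 / 7) + 3 * real 7 * (1 / 100) < 0" using ln_le_minus_one[of "4 / 7"] by simp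
  qed auto
  moreover have "x \<noteq> 0" "y \<noteq> 0" "z \<noteq> 0" "x + y + z \<noteq> 0"
  proof -
    have "u \<noteq> 0" if "u \<in> U" for u
    proof
      assume "u = 0"
      obtain i where i: "i \<in> I" using arch by blast
      have "v i u > 0" using U(2)[of i] i that by blast
      then show False using arch_nat[OF i, of 0] \<open>u = 0\<close> by simp
    qed
    then show "x \<noteq> 0" "y \<noteq> 0" "z \<noteq> 0" "x + y + z \<noteq> 0" using m unfolding xyz(4) by (auto simp: x_def y_def z_def)
  qed
  moreover have "x + y \<noteq> 0" "y + z \<noteq> 0" "z + x \<noteq> 0"
    using ne sum by (auto simp: x_def y_def z_def add.commute)
  ultimately show False by (auto simp: quintic_def septic_def)
qed

text \<open>
  The logarithmic vectors of \<open>X\<close> are rational combinations of those of \<open>G\<close>, with coefficients that do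
  not depend on the place.
\<close>

definition spanned :: "complex set \<Rightarrow> complex set \<Rightarrow> bool" where
  "spanned G X \<longleftrightarrow> (\<forall>a\<in>X. \<exists>n>0. \<exists>e. \<forall>i\<in>I \<union> J. real n * ln (v i a) = (\<Sum>b\<in>G. of_int (e b) * ln (v i b)))"

lemma spanned_subset: "spanned G X \<Longrightarrow> Y \<subseteq> X \<Longrightarrow> spanned G Y"
  by (auto simp: spanned_def)

lemma hdist_separated_card_le:
  fixes t :: nat
  assumes fin: "finite X" "finite G" and span: "spanned G X"
    and sep: "\<And>a b. a \<in> X \<Longrightarrow> b \<in> X \<Longrightarrow> a \<noteq> b \<Longrightarrow> hdist a b > \<epsilon>"
    and diam: "\<And>a b. a \<in> X \<Longrightarrow> b \<in> X \<Longrightarrow> hdist a b \<le> (real t - 1) * \<epsilon>"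
    and t: "t \<ge> 2" and \<epsilon>: "\<epsilon> \<ge> 0"
  shows "card X \<le> t ^ card G"
proof (rule separated_card_le[where K = "I \<union> J" and x = "\<lambda>a i. ln (v i a)" and \<epsilon> = "2 * card I * \<epsilon>"
      and g = "\<lambda>b i. ln (v i b)"])
  have eq: "(\<Sum>i\<in>I \<union> J. \<bar>ln (v i a) - ln (v i b)\<bar>) = 2 * card I * hdist a b" for a b
    using card_I by (simp add: hdist_def)
  show "2 * card I * \<epsilon> < (\<Sum>i\<in>I \<union> J. \<bar>ln (v i a) - ln (v i b)\<bar>)" if "a \<in> X" "b \<in> X" "a \<noteq> b" for a b
    unfolding eq using sep[OF that] card_I by simp
  show "(\<Sum>i\<in>I \<union> J. \<bar>ln (v i a) - ln (v i b)\<bar>) \<le> (real t - 1) * (2 * card I * \<epsilon>)" if "a \<in> X" "b \<in> X" for a b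
    unfolding eq using mult_left_mono[OF diam[OF that], of "2 * card I"] by (simp add: algebra_simps)
qed (use fin finite t \<epsilon> span in \<open>auto simp: spanned_def\<close>)

text \<open>
  A maximal separated subset is a net.
\<close>

lemma hdist_net:
  fixes t :: nat
  assumes fin: "finite X" "finite G" and span: "spanned G X"
    and diam: "\<And>a b. a \<in> X \<Longrightarrow> b \<in> X \<Longrightarrow> hdist a b \<le> (real t - 1) * \<epsilon>"
    and t: "t \<ge> 2" and \<epsilon>: "\<epsilon> \<ge> 0"
  shows "\<exists>C\<subseteq>X. card C \<le> t ^ card G \<and> (\<forall>x\<in>X. \<exists>c\<in>C. hdist x c \<le> \<epsilon>)"
proof -
  define P where "P C \<longleftrightarrow> C \<subseteq> X \<and> (\<forall>a\<in>C. \<forall>b\<in>C. a \<noteq> b \<longrightarrow> hdist a b > \<epsilon>)" for C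
  have "P {}" by (simp add: P_def)
  moreover have "\<forall>C. P C \<longrightarrow> card C < Suc (card X)" using fin by (auto simp: P_def less_Suc_eq_le intro: card_mono)
  ultimately have "\<exists>C. P C \<and> (\<forall>C'. P C' \<longrightarrow> card C' \<le> card C)"
    by (rule Lattices_Big.ex_has_greatest_nat)
  then obtain C where C: "P C" "\<And>C'. P C' \<Longrightarrow> card C' \<le> card C" by blast
  have CX: "C \<subseteq> X" and finC: "finite C" using C(1) fin finite_subset by (auto simp: P_def)
  have "card C \<le> t ^ card G"
  proof (rule hdist_separated_card_le[OF finC fin(2) spanned_subset[OF span CX] _ _ t \<epsilon>])
    show "hdist a b > \<epsilon>" if "a \<in> C" "b \<in> C" "a \<noteq> b" for a b using C(1) that by (auto simp: P_def)
    show "hdist a b \<le> (real t - 1) * \<epsilon>" if "a \<in> C" "b \<in> C" for a b using diam CX that by blast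
  qed
  moreover have "\<exists>c\<in>C. hdist x c \<le> \<epsilon>" if x: "x \<in> X" for x
  proof (rule ccontr)
    assume no: "\<not> ?thesis"
    then have "x \<notin> C" using \<epsilon> by auto
    have far: "hdist x c > \<epsilon>" "hdist c x > \<epsilon>" if "c \<in> C" for c
      using no that hdist_commute[of c x] by auto
    then have "P (insert x C)" using C(1) x unfolding P_def by blast
    from C(2)[OF this] show False using \<open>x \<notin> C\<close> finC by simp
  qed
  ultimately show ?thesis using CX by blast
qed

end

section \<open>Sumsets and the pigeonhole principle\<close>

lemma large_fibre:
  assumes "finite X" "finite Y" "f ` X \<subseteq> Y" "card X > n * card Y"
  shows "\<exists>y\<in>Y. card {x \<in> X. f x = y} > n"
proof (rule ccontr)
  assume "\<not> ?thesis"
  then have le: "card {x \<in> X. f x = y} \<le> n" if "y \<in> Y" for y using that by auto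
  have "X = (\<Union>y\<in>Y. {x \<in> X. f x = y})" using assms(3) by auto
  then have "card X = card (\<Union>y\<in>Y. {x \<in> X. f x = y})" by (rule arg_cong)
  also have "\<dots> \<le> (\<Sum>y\<in>Y. card {x \<in> X. f x = y})" by (rule card_UN_le[OF assms(2)])
  also have "\<dots> \<le> card Y * n" using le by (intro order.trans[OF sum_bounded_above[of Y _ n]]) auto
  finally show False using assms(4) by (simp add: mult.commute)
qed

locale sumset_heights = height_system +
  fixes A G :: "complex set"
  assumes A: "finite A" "A \<subseteq> U" "\<And>a b. a \<in> A \<Longrightarrow> b \<in> A \<Longrightarrow> a + b \<in> U"
    and G: "finite G" "spanned G A" "spanned G {a + b | a b. a \<in> A \<and> b \<in> A}"
    and N_diff: "\<And>a b. a \<in> A \<Longrightarrow> b \<in> A \<Longrightarrow> a - b \<in> N"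
    and N_rect: "\<And>a b c d. a \<in> A \<Longrightarrow> b \<in> A \<Longrightarrow> c \<in> A \<Longrightarrow> d \<in> A \<Longrightarrow>
      quintic (a + c) (- (b + c)) (b + d) \<in> N \<and> septic (a + c) (- (b + c)) (b + d) \<in> N"
begin

lemma ln2_le_1: "ln 2 \<le> (1 :: real)"
  using ln_2_less_1 by simp

text \<open>
  The radius \<open>D / 24\<close> of the cluster and the accuracy \<open>(1 + D) / 8\<close> for the sums are such that the gap
  principle gives \<open>D / 2 \<le> 9 / 8 + D / 4\<close>. They lead to the parameters \<open>25\<close>, because
  \<open>D = (25 - 1) * (D / 24)\<close>, and \<open>17\<close>, because the sums \<open>k + a\<close> have diameter at most
  \<open>2 * (1 + D) = (17 - 1) * ((1 + D) / 8)\<close>.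
\<close>

lemma bounded_diameter:
  assumes large: "card A > 25 ^ card G * 17 ^ card G" and pq: "p \<in> A" "q \<in> A"
  shows "hdist p q \<le> 5"
proof -
  define D where "D = Max ((\<lambda>(a, b). hdist a b) ` (A \<times> A))"
  have "D \<in> (\<lambda>(a, b). hdist a b) ` (A \<times> A)"
    unfolding D_def using A(1) pq by (intro Max_in) auto
  then obtain p' q' where pq': "p' \<in> A" "q' \<in> A" "D = hdist p' q'" by auto
  have D: "hdist a b \<le> D" if "a \<in> A" "b \<in> A" for a b
    unfolding D_def using A(1) that by (intro Max_ge) auto
  have D0: "D \<ge> 0" using pq' hdist_nonneg by simp
  obtain C where C: "C \<subseteq> A" "card C \<le> 25 ^ card G" "\<forall>x\<in>A. \<exists>c\<in>C. hdist x c \<le> D / 24"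
    using hdist_net[OF A(1) G(1,2), of 25 "D / 24"] D D0 by auto
  then obtain ctr where ctr: "\<And>x. x \<in> A \<Longrightarrow> ctr x \<in> C \<and> hdist x (ctr x) \<le> D / 24" by metis
  have finC: "finite C" using C(1) A(1) finite_subset by blast
  have "17 ^ card G * card C \<le> 17 ^ card G * 25 ^ card G" by (rule mult_le_mono2[OF C(2)])
  also have "\<dots> < card A" using large by (simp only: mult.commute)
  finally have "17 ^ card G * card C < card A" .
  then obtain c where c: "c \<in> C" "card {x \<in> A. ctr x = c} > 17 ^ card G"
    using large_fibre[OF A(1) finC, of ctr] ctr by blast
  define B where "B = {x \<in> A. ctr x = c}"
  have B: "B \<subseteq> A" "\<And>x. x \<in> B \<Longrightarrow> hdist x c \<le> D / 24" "finite B" using ctr A(1) by (auto simp: B_def)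
  have "hdist p' c \<ge> D / 2 \<or> hdist q' c \<ge> D / 2"
    using hdist_triangle[of p' q' c] hdist_commute[of c q'] pq'(3) by linarith
  \<comment> \<open>An element far away from the whole cluster \<open>B\<close> around \<open>c\<close>.\<close>
  then obtain k where k: "k \<in> A" "hdist k c \<ge> D / 2" using pq' by blast
  have sk: "hdist (k + a) k \<le> 1 + D" if "a \<in> B" for a
  proof -
    have a: "a \<in> A" using that B(1) by blast
    have "hdist (k + a) k \<le> ln 2 + hdist k a"
      by (rule hdist_add_le[OF _ _ A(3)[OF k(1) a]]) (use A(2) k(1) a in blast)+
    then show ?thesis using D[OF k(1) a] ln2_le_1 by linarith
  qed
  define \<epsilon> where "\<epsilon> = (1 + D) / 8"
  have "\<exists>a\<in>B. \<exists>b\<in>B. a \<noteq> b \<and> hdist (k + a) (k + b) \<le> \<epsilon>"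
  proof (rule ccontr)
    assume no: "\<not> ?thesis"
    have "card ((+) k ` B) \<le> 17 ^ card G"
    proof (rule hdist_separated_card_le)
      show "finite ((+) k ` B)" "finite G" using B G by auto
      show "spanned G ((+) k ` B)" by (rule spanned_subset[OF G(3)]) (use k B in blast)
      show "\<epsilon> < hdist s t" if "s \<in> (+) k ` B" "t \<in> (+) k ` B" "s \<noteq> t" for s t
        using no that by force
      show "hdist s t \<le> (real 17 - 1) * \<epsilon>" if st: "s \<in> (+) k ` B" "t \<in> (+) k ` B" for s t
      proof -
        have "hdist s k \<le> 1 + D" "hdist t k \<le> 1 + D" using st sk by auto
        then show ?thesis using hdist_triangle[of s t k] hdist_commute[of k t] by (simp add: \<epsilon>_def)
      qed
    qed (use D0 in \<open>auto simp: \<epsilon>_def\<close>)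
    then show False using c(2) by (simp add: card_image B_def)
  qed
  then obtain a b where ab: "a \<in> B" "b \<in> B" "a \<noteq> b" "hdist (k + a) (k + b) \<le> \<epsilon>" by blast
  have "hdist k a \<le> ln 2 + hdist a b + hdist (k + a) (k + b)"
  proof -
    have abA: "a \<in> A" "b \<in> A" using ab B(1) by auto
    show ?thesis
      by (rule gap_principle[OF _ _ _ A(3)[OF k(1) abA(1)] A(3)[OF k(1) abA(2)] ab(3) N_diff[OF abA]])
        (use A(2) k(1) abA in blast)+
  qed
  moreover have "hdist a b \<le> D / 12"
    using hdist_triangle[of a b c] hdist_commute[of c b] B(2)[OF ab(1)] B(2)[OF ab(2)] by simp
  moreover have "hdist k c \<le> hdist k a + D / 24"
    using hdist_triangle[of k c a] B(2)[OF ab(1)] by simp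
  moreover have "hdist (k + a) (k + b) \<le> 1 / 8 + D / 8" using ab(4) by (simp add: \<epsilon>_def add_divide_distrib)
  moreover have "ln 2 \<le> (1 :: real)" by (rule ln2_le_1)
  ultimately have "hdist k c \<le> 9 / 8 + D / 12 + D / 8 + D / 24" by linarith
  with k(2) have "D \<le> 5" by linarith
  then show ?thesis using D[OF pq] by simp
qed

text \<open>
  Once the diameter of \<open>A\<close> is at most 5, that of the set of sums is at most \<open>6 + 5 + 6 = 17\<close>, and
  \<open>17 = (3401 - 1) / 200\<close>: the sums have a \<open>1/200\<close>-net of \<open>m\<close> points. Regard a net point close to
  a sum as the colour of the edge between its two summands. Among \<open>m + 1\<close> elements \<open>B\<close>, each \<open>k\<close> sees two in the
  same colour, and three different \<open>k\<close> share the pair and the colour.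
\<close>

theorem card_le:
  fixes m :: nat
  defines "m \<equiv> 3401 ^ card G"
  shows "card A \<le> 25 ^ card G * 17 ^ card G + 2 * ((m + 1) ^ 2 * m)"
proof (rule ccontr)
  assume "\<not> ?thesis"
  then have large: "card A > 25 ^ card G * 17 ^ card G" "card A > 2 * ((m + 1) ^ 2 * m)" by linarith+
  have m: "m \<ge> 1" by (simp add: m_def)
  have diam: "hdist a b \<le> 5" if "a \<in> A" "b \<in> A" for a b
    using bounded_diameter[OF large(1) that] .
  define S where "S = {a + b | a b. a \<in> A \<and> b \<in> A}"
  have S: "S = (\<lambda>(a, b). a + b) ` (A \<times> A)" by (auto simp: S_def)
  then have finS: "finite S" using A(1) by simp
  have toA: "hdist (a + b) a \<le> 6" if "a \<in> A" "b \<in> A" for a b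
  proof -
    have "hdist (a + b) a \<le> ln 2 + hdist a b"
      by (rule hdist_add_le[OF _ _ A(3)[OF that]]) (use A(2) that in blast)+
    then show ?thesis using diam[OF that] ln2_le_1 by linarith
  qed
  have "hdist s t \<le> (real 3401 - 1) * (1 / 200)" if st: "s \<in> S" "t \<in> S" for s t
  proof -
    obtain a b c d where "s = a + b" "t = c + d" "a \<in> A" "b \<in> A" "c \<in> A" "d \<in> A" using st by (auto simp: S_def)
    then show ?thesis
      using hdist_triangle[of s t a] hdist_triangle[of a t c] hdist_commute[of c t]
        toA[of a b] toA[of c d] diam[of a c] by simp
  qed
  then obtain C where C: "C \<subseteq> S" "card C \<le> m" "\<forall>s\<in>S. \<exists>c\<in>C. hdist s c \<le> 1 / 200"
    using hdist_net[OF finS G(1) G(3)[folded S_def], of 3401 "1 / 200"] by (auto simp: m_def)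
  then obtain ctr where ctr: "\<And>s. s \<in> S \<Longrightarrow> ctr s \<in> C \<and> hdist s (ctr s) \<le> 1 / 200" by metis
  have finC: "finite C" using C(1) finS finite_subset by blast
  have close: "hdist s t \<le> 1 / 100" if "s \<in> S" "t \<in> S" "ctr s = ctr t" for s t
    using hdist_triangle[of s t "ctr s"] hdist_commute[of "ctr s" t] ctr[OF that(1)] ctr[OF that(2)] that(3) by simp
  have "m + 1 \<le> 2 * ((m + 1) ^ 2 * m)"
  proof -
    have "(m + 1) * 1 \<le> (m + 1) * ((m + 1) * m)" using m by (intro mult_le_mono2) simp
    also have "\<dots> = (m + 1) ^ 2 * m" by (simp only: power2_eq_square mult.assoc)
    finally have "m + 1 \<le> (m + 1) ^ 2 * m" by (simp only: mult_1_right)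
    then show ?thesis by (rule order.trans) simp
  qed
  then have "m + 1 \<le> card A" using large(2) by simp
  then obtain B where B: "B \<subseteq> A" "card B = m + 1" "finite B" by (rule obtain_subset_with_card_n)
  have "\<exists>a b. a \<in> B \<and> b \<in> B \<and> a \<noteq> b \<and> ctr (a + k) = ctr (b + k)" if k: "k \<in> A" for k
  proof (rule ccontr)
    assume no: "\<not> ?thesis"
    then have "inj_on (\<lambda>a. ctr (a + k)) B" by (auto simp: inj_on_def)
    moreover have "(\<lambda>a. ctr (a + k)) ` B \<subseteq> C" using ctr B(1) k by (auto simp: S_def)
    ultimately have "card B \<le> card C" using finC by (intro card_inj_on_le)
    then show False using B(2) C(2) by simp
  qed
  then obtain l r where lr: "\<And>k. k \<in> A \<Longrightarrow> l k \<in> B \<and> r k \<in> B \<and> l k \<noteq> r k \<and> ctr (l k + k) = ctr (r k + k)" by metis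
  define f where "f k = (l k, r k, ctr (l k + k))" for k
  have "card (B \<times> B \<times> C) \<le> (m + 1) ^ 2 * m"
    using B(2) C(2) by (simp add: card_cartesian_product power2_eq_square mult.assoc del: mult_Suc mult_Suc_right)
  then have "2 * card (B \<times> B \<times> C) < card A" using large(2) by linarith
  moreover have "f ` A \<subseteq> B \<times> B \<times> C"
  proof (rule image_subsetI)
    fix k assume k: "k \<in> A"
    then have "l k + k \<in> S" using lr[OF k] B(1) by (auto simp: S_def)
    then have "ctr (l k + k) \<in> C" using ctr by blast
    then show "f k \<in> B \<times> B \<times> C" using lr[OF k] unfolding f_def by blast
  qed
  ultimately obtain y where y: "card {k \<in> A. f k = y} > 2"
    using large_fibre[OF A(1), of "B \<times> B \<times> C" f 2] B(3) finC by blast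
  obtain a b s where abs: "y = (a, b, s)" by (cases y)
  have "3 \<le> card {k \<in> A. f k = y}" using y by simp
  then obtain T where T: "T \<subseteq> {k \<in> A. f k = y}" "card T = 3" "finite T"
    by (rule obtain_subset_with_card_n)
  then obtain c d e where cde: "T = {c, d, e}" "c \<noteq> d" "c \<noteq> e" "d \<noteq> e" by (auto simp: card_3_iff)
  have ker: "a \<in> A \<and> b \<in> A \<and> a \<noteq> b \<and> k \<in> A \<and> ctr (a + k) = s \<and> ctr (b + k) = s" if "k \<in> T" for k
  proof -
    have "k \<in> A" "l k = a" "r k = b" "ctr (l k + k) = s" using that T(1) by (auto simp: f_def abs)
    with lr[of k] B(1) show ?thesis by auto
  qed
  have rect: "(a + c) + (b + k) = 0" if k: "k \<in> T" "k \<noteq> c" for k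
  proof -
    have c: "c \<in> T" by (simp add: cde)
    note kc = ker[OF c] and kk = ker[OF k(1)]
    have mem: "a + c \<in> S" "b + c \<in> S" "b + k \<in> S" "a + k \<in> S" using kc kk unfolding S_def by blast+
    show ?thesis
    proof (rule close_rectangle)
      show "a + c \<in> U" "b + c \<in> U" "b + k \<in> U" "a + k \<in> U" using kc kk A(3) by auto
      show "a + k = a + c - (b + c) + (b + k)" by simp
      show "hdist (a + c) (b + c) \<le> 1 / 100" "hdist (a + c) (b + k) \<le> 1 / 100" "hdist (a + c) (a + k) \<le> 1 / 100"
        by (rule close; use mem kc kk in simp)+
      show "quintic (a + c) (- (b + c)) (b + k) \<in> N" "septic (a + c) (- (b + c)) (b + k) \<in> N"
        using N_rect kc kk by auto
      show "a + c \<noteq> b + c" "b + k \<noteq> b + c" using kc k(2) by auto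
    qed
  qed
  have "(a + c) + (b + d) = (a + c) + (b + e)" using rect[of d] rect[of e] cde by auto
  then show False using cde by simp
qed

end

section \<open>From the rank of the group to the span of the logarithms\<close>

context height_system
begin

lemma abs_one:
  assumes "u \<in> U" "i \<in> I \<union> J"
  shows "v i 1 = 1"
proof -
  have "u \<in> R" using assms U(1) by auto
  then have "v i u * 1 = v i u * v i 1"
    using mult[OF assms(2) _ csubring_one[OF ring], of u] by simp
  then show ?thesis using U(2)[OF assms(2,1)] by simp
qed

lemma abs_monomial:
  assumes T: "finite T" "T \<subseteq> U" "T \<noteq> {}" and i: "i \<in> I \<union> J"
  shows "v i (\<Prod>x\<in>T. x ^ e x) = (\<Prod>x\<in>T. v i x ^ e x)"
proof -
  obtain u where u: "u \<in> U" using T by blast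
  have pow: "v i (x ^ n) = v i x ^ n" if "x \<in> R" for x n
  proof (induction n)
    case 0
    show ?case using abs_one[OF u i] by simp
  next
    case (Suc n)
    then show ?case using mult[OF i that csubring_power[OF ring that]] by simp
  qed
  have TR: "T \<subseteq> R" using T(2) U(1) by blast
  have "(\<Prod>x\<in>S. x ^ e x) \<in> R \<and> v i (\<Prod>x\<in>S. x ^ e x) = (\<Prod>x\<in>S. v i x ^ e x)" if "finite S" "S \<subseteq> R" for S
    using that
  proof (induction S rule: finite_induct)
    case empty
    then show ?case using abs_one[OF u i] csubring_one[OF ring] by simp
  next
    case (insert x S)
    then have x: "x \<in> R" "x ^ e x \<in> R" and S: "(\<Prod>x\<in>S. x ^ e x) \<in> R" "v i (\<Prod>x\<in>S. x ^ e x) = (\<Prod>x\<in>S. v i x ^ e x)"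
      using csubring_power[OF ring] by auto
    show ?case using insert(1,2) mult[OF i x(2) S(1)] csubring_mult[OF ring x(2) S(1)] by (simp add: pow[OF x(1)] S(2))
  qed
  from this[OF T(1) TR] show ?thesis by blast
qed

text \<open>
  The absolute values are defined on a ring only, so the factors with negative exponents are moved to
  the other side first.
\<close>

lemma log_relation:
  assumes T: "finite T" "T \<subseteq> U" "0 \<notin> U" and rel: "(\<Prod>x\<in>T. x powi k x) = 1" and i: "i \<in> I \<union> J"
  shows "(\<Sum>x\<in>T. of_int (k x) * ln (v i x)) = 0"
proof (cases "T = {}")
  case False
  have T0: "x \<noteq> 0" if "x \<in> T" for x using that T by auto
  have "(\<Prod>x\<in>T. x powi k x) = (\<Prod>x\<in>T. x ^ nat (k x)) / (\<Prod>x\<in>T. x ^ nat (- k x))"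
    unfolding prod_dividef[symmetric]
    by (intro prod.cong refl) (auto simp: power_int_def power_inverse divide_inverse)
  with rel have "(\<Prod>x\<in>T. x ^ nat (k x)) = (\<Prod>x\<in>T. x ^ nat (- k x))"
    using T0 T(1) by (simp add: divide_eq_1_iff)
  then have "(\<Prod>x\<in>T. v i x ^ nat (k x)) = (\<Prod>x\<in>T. v i x ^ nat (- k x))"
    using abs_monomial[OF T(1,2) False i] by metis
  then have eq: "ln (\<Prod>x\<in>T. v i x ^ nat (k x)) = ln (\<Prod>x\<in>T. v i x ^ nat (- k x))" by (rule arg_cong)
  have pos: "v i x > 0" if "x \<in> T" for x using U(2)[OF i] T(2) that by blast
  have ln: "ln (\<Prod>x\<in>T. v i x ^ e x) = (\<Sum>x\<in>T. real (e x) * ln (v i x))" for e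
  proof -
    have "v i x ^ e x \<noteq> 0" if "x \<in> T" for x using pos[OF that] by simp
    then have "ln (\<Prod>x\<in>T. v i x ^ e x) = (\<Sum>x\<in>T. ln (v i x ^ e x))" using T(1) by (intro ln_prod) auto
    also have "\<dots> = (\<Sum>x\<in>T. real (e x) * ln (v i x))" by (intro sum.cong refl ln_realpow)
    finally show ?thesis .
  qed
  have "(\<Sum>x\<in>T. of_int (k x) * ln (v i x)) = (\<Sum>x\<in>T. real (nat (k x)) * ln (v i x) - real (nat (- k x)) * ln (v i x))"
  proof (intro sum.cong refl)
    fix x
    have "of_int (k x) = real (nat (k x)) - real (nat (- k x))" by (cases "k x \<ge> 0") auto
    then show "of_int (k x) * ln (v i x) = real (nat (k x)) * ln (v i x) - real (nat (- k x)) * ln (v i x)"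
      by (simp add: left_diff_distrib)
  qed
  also have "\<dots> = 0" using eq unfolding ln by (simp add: sum_subtractf)
  finally show ?thesis .
qed simp

end

text \<open>
  A maximal independent subset \<open>H\<close> of \<open>W\<close>: each other element of \<open>W\<close> occurs with a nonzero exponent
  in a relation with elements of \<open>H\<close>.
\<close>

lemma maximal_independent:
  assumes \<Gamma>: "subgroup \<Gamma> complex_units" and rank: "group_rank (complex_units\<lparr>carrier := \<Gamma>\<rparr>) \<le> enat r"
    and W: "finite W" "W \<subseteq> \<Gamma>"
  obtains H where "H \<subseteq> W" "card H \<le> r"
    "\<And>w. w \<in> W - H \<Longrightarrow> \<exists>T k. finite T \<and> T \<subseteq> insert w H \<and> w \<in> T \<and> k w \<noteq> 0 \<and>
      (\<Prod>x\<in>T. x powi (k x :: int)) = 1"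
proof -
  let ?G = "complex_units\<lparr>carrier := \<Gamma>\<rparr>"
  note iff = mult_independent_complex_iff[OF \<Gamma>]
  define P where "P H \<longleftrightarrow> H \<subseteq> W \<and> mult_independent ?G H" for H
  have "P {}" unfolding P_def iff by auto
  moreover have "\<forall>H. P H \<longrightarrow> card H < Suc (card W)"
    using W(1) by (auto simp: P_def less_Suc_eq_le intro: card_mono)
  ultimately have "\<exists>H. P H \<and> (\<forall>H'. P H' \<longrightarrow> card H' \<le> card H)" by (rule Lattices_Big.ex_has_greatest_nat)
  then obtain H where H: "P H" "\<And>H'. P H' \<Longrightarrow> card H' \<le> card H" by blast
  have HW: "H \<subseteq> W" "finite H" "mult_independent ?G H" using H(1) W(1) finite_subset by (auto simp: P_def)
  have "enat (card H) \<le> group_rank ?G" unfolding group_rank_def using HW by (intro Sup_upper) auto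
  then have card: "card H \<le> r" using rank by (metis enat_ord_simps(1) order.trans)
  have "\<exists>T k. finite T \<and> T \<subseteq> insert w H \<and> w \<in> T \<and> k w \<noteq> 0 \<and>
      (\<Prod>x\<in>T. x powi (k x :: int)) = 1" if wH: "w \<in> W - H" for w
  proof -
    have w: "w \<in> W" "w \<notin> H" using wH by auto
    have "\<not> P (insert w H)" using H(2)[of "insert w H"] w(2) HW(2) by auto
    then have "\<not> mult_independent ?G (insert w H)" using HW(1) w(1) by (auto simp: P_def)
    moreover have "insert w H \<subseteq> \<Gamma>" using HW(1) W(2) w(1) by blast
    ultimately have "\<not> (\<forall>T k. finite T \<longrightarrow> T \<subseteq> insert w H \<longrightarrow> (\<Prod>x\<in>T. x powi (k x :: int)) = 1 \<longrightarrow> (\<forall>x\<in>T. k x = 0))"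
      by (simp only: iff simp_thms)
    then obtain T and k :: "complex \<Rightarrow> int" where
      T: "finite T" "T \<subseteq> insert w H" "(\<Prod>x\<in>T. x powi k x) = 1" "\<not> (\<forall>x\<in>T. k x = 0)"
      unfolding not_all not_imp by (elim exE conjE) (rule that)
    have "w \<in> T \<and> k w \<noteq> 0"
    proof (rule ccontr)
      assume no: "\<not> (w \<in> T \<and> k w \<noteq> 0)"
      have "(\<Prod>x\<in>T - {w}. x powi k x) = (\<Prod>x\<in>T. x powi k x)"
        using T(1) no by (intro prod.mono_neutral_left) auto
      then have "(\<Prod>x\<in>T - {w}. x powi k x) = 1" "finite (T - {w})" "T - {w} \<subseteq> H" using T by auto
      moreover have "\<forall>T k. finite T \<longrightarrow> T \<subseteq> H \<longrightarrow> (\<Prod>x\<in>T. x powi (k x :: int)) = 1 \<longrightarrow> (\<forall>x\<in>T. k x = 0)"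
        using HW(3) unfolding iff by (rule conjunct2)
      ultimately have "\<forall>x\<in>T - {w}. k x = 0" by (elim allE[of _ "T - {w}"] allE[of _ k]) simp
      then show False using T(4) no by blast
    qed
    then show ?thesis using T(1-3) by (intro exI[of _ T] exI[of _ k]) simp
  qed
  with HW(1) card show ?thesis by (rule that)
qed

lemma (in height_system) relation_spanned:
  assumes T: "finite T" "T \<subseteq> insert w H" "w \<in> T" "k w \<noteq> 0" and H: "finite H" "H \<subseteq> G" "finite G" "w \<notin> H"
    and rel: "\<And>i. i \<in> I \<union> J \<Longrightarrow> (\<Sum>x\<in>T. of_int (k x) * ln (v i x)) = 0"
  shows "\<exists>n>0. \<exists>e. \<forall>i\<in>I \<union> J. real n * ln (v i w) = (\<Sum>b\<in>G. of_int (e b) * ln (v i b))"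
proof -
  define n where "n = nat \<bar>k w\<bar>"
  define e where "e b = (if b \<in> T - {w} then - sgn (k w) * k b else 0)" for b
  have n: "n > 0" "int n = sgn (k w) * k w" using T(4) by (auto simp: n_def sgn_if)
  have "real n * ln (v i w) = (\<Sum>b\<in>G. of_int (e b) * ln (v i b))" if i: "i \<in> I \<union> J" for i
  proof -
    have "of_int (k w) * ln (v i w) = - (\<Sum>x\<in>T - {w}. of_int (k x) * ln (v i x))"
      using rel[OF i] T(1,3) by (simp add: sum.remove[of T w] eq_neg_iff_add_eq_0)
    moreover have "real n = of_int (sgn (k w)) * of_int (k w)" using n(2) by (metis of_int_mult of_int_of_nat_eq)
    ultimately have "real n * ln (v i w) = (\<Sum>b\<in>T - {w}. of_int (e b) * ln (v i b))"
      by (simp add: e_def mult.assoc sum_distrib_left sum_negf)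
    also have "\<dots> = (\<Sum>b\<in>G. of_int (e b) * ln (v i b))"
      using T H by (intro sum.mono_neutral_left) (auto simp: e_def)
    finally show ?thesis .
  qed
  with n(1) show ?thesis by (intro exI[of _ n] exI[of _ e] conjI ballI)
qed

definition sumset_bound :: "nat \<Rightarrow> nat" where
  "sumset_bound g = 25 ^ g * 17 ^ g + 2 * ((3401 ^ g + 1) ^ 2 * 3401 ^ g)"

lemma sumset_bound_mono: "g \<le> h \<Longrightarrow> sumset_bound g \<le> sumset_bound h"
  unfolding sumset_bound_def by (intro add_mono mult_le_mono power_mono power_increasing) auto

text \<open>
  The number 2 is added to the generators since \<open>A\<close> itself need not lie in \<open>\<Gamma>\<close>, whereas \<open>2 * a\<close> does.
  The set \<open>D \<union> Q \<union> S\<close> collects all numbers to which the product formula is going to be applied.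
\<close>

lemma card_le_sumset_bound:
  assumes \<Gamma>: "subgroup \<Gamma> complex_units" and rank: "group_rank (complex_units\<lparr>carrier := \<Gamma>\<rparr>) \<le> enat r"
    and A: "finite A" "A + A \<subseteq> \<Gamma>"
  shows "card A \<le> sumset_bound (r + 1)"
proof -
  define W where "W = {a + b | a b. a \<in> A \<and> b \<in> A}"
  have W: "finite W" "W \<subseteq> \<Gamma>"
  proof -
    have "W = (\<lambda>(a, b). a + b) ` (A \<times> A)" by (auto simp: W_def)
    then show "finite W" using A by simp
    show "W \<subseteq> \<Gamma>" using A(2) by (auto simp: W_def set_plus_def)
  qed
  have "0 \<notin> \<Gamma>" using subgroup.subset[OF \<Gamma>] by auto
  then have W0: "0 \<notin> W" using W by blast
  have A0: "0 \<notin> A"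
  proof
    assume "0 \<in> A"
    then have "0 + 0 \<in> W" unfolding W_def by blast
    with W0 show False by simp
  qed
  obtain H where H: "H \<subseteq> W" "card H \<le> r"
    and rel: "\<And>w. w \<in> W - H \<Longrightarrow> \<exists>T k. finite T \<and> T \<subseteq> insert w H \<and> w \<in> T \<and> k w \<noteq> 0 \<and>
      (\<Prod>x\<in>T. x powi (k x :: int)) = 1"
    by (rule maximal_independent[OF \<Gamma> rank W]) (rule that)
  have finH: "finite H" using H W finite_subset by blast
  define G where "G = insert 2 H"
  have G: "finite G" "card G \<le> r + 1" "H \<subseteq> G" using finH H(2) by (auto simp: G_def card_insert_if)
  have cardG: "card G \<le> r + 1" by (rule G(2))
  define U where "U = insert 2 (A \<union> W)"
  define D where "D = (\<lambda>(a, b). a - b) ` (A \<times> A)"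
  define Q where "Q = (\<lambda>(a, b, c, d). quintic (a + c) (- (b + c)) (b + d)) ` (A \<times> A \<times> A \<times> A)"
  define S where "S = (\<lambda>(a, b, c, d). septic (a + c) (- (b + c)) (b + d)) ` (A \<times> A \<times> A \<times> A)"
  have fin: "finite U" "finite (D \<union> Q \<union> S)" using A W by (auto simp: U_def D_def Q_def S_def)
  have U0: "0 \<notin> U" using A0 W0 by (simp add: U_def)
  obtain R I J and v :: "nat \<times> nat \<Rightarrow> complex \<Rightarrow> real" where "height_system R I J v U (D \<union> Q \<union> S)"
    using height_system_exists[OF fin U0] by blast
  then interpret height_system R I J v U "D \<union> Q \<union> S" .
  have HU: "H \<subseteq> U" using H by (auto simp: U_def)
  have span: "\<exists>n>0. \<exists>e. \<forall>i\<in>I \<union> J. real n * ln (v i w) = (\<Sum>b\<in>G. of_int (e b) * ln (v i b))" if w: "w \<in> W" for w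
  proof (cases "w \<in> H")
    case True
    then have wG: "w \<in> G" using G by blast
    have "ln (v i w) = (\<Sum>b\<in>G. of_int (if b = w then 1 else 0) * ln (v i b))" for i
    proof -
      have "(\<Sum>b\<in>G. of_int (if b = w then 1 else 0) * ln (v i b)) = (\<Sum>b\<in>G. if b = w then ln (v i b) else 0)"
        by (intro sum.cong) auto
      then show ?thesis using G(1) wG by simp
    qed
    then show ?thesis by (intro exI[of _ 1] conjI exI[of _ "\<lambda>b. if b = w then 1 else 0"]) auto
  next
    case False
    then have "w \<in> W - H" using w by simp
    from rel[OF this] obtain T and k :: "complex \<Rightarrow> int" where
      T: "finite T" "T \<subseteq> insert w H" "w \<in> T" "k w \<noteq> 0" "(\<Prod>x\<in>T. x powi k x) = 1"
      by (elim exE conjE) (rule that)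
    have TU: "T \<subseteq> U" using T(2) HU w by (auto simp: U_def)
    show ?thesis
      by (rule relation_spanned[OF T(1-4) finH G(3,1) False log_relation[OF T(1) TU U0 T(5)]])
  qed
  have "sumset_heights R I J v U (D \<union> Q \<union> S) A G"
  proof unfold_locales
    show "finite A" "A \<subseteq> U" "finite G" using A G by (auto simp: U_def)
    show "a + b \<in> U" if "a \<in> A" "b \<in> A" for a b using that by (auto simp: U_def W_def)
    show "spanned G {a + b |a b. a \<in> A \<and> b \<in> A}"
      unfolding spanned_def W_def[symmetric] by (intro ballI span)
    show "spanned G A"
      unfolding spanned_def
    proof
      fix a assume a: "a \<in> A"
      then have aW: "a + a \<in> W" unfolding W_def by blast
      from span[OF aW] obtain n e where n: "n > 0"
        and ne: "\<forall>i\<in>I \<union> J. real n * ln (v i (a + a)) = (\<Sum>b\<in>G. of_int (e b) * ln (v i b))"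
        by (elim exE conjE) (rule that)
      have "real n * ln (v i a) = (\<Sum>b\<in>G. of_int (e b - (if b = 2 then int n else 0)) * ln (v i b))" if i: "i \<in> I \<union> J" for i
      proof -
        have aU: "a \<in> U" "2 \<in> U" using a by (auto simp: U_def)
        then have "v i (2 * a) = v i 2 * v i a" using mult[OF i] U(1) by blast
        then have "ln (v i (a + a)) = ln (v i 2) + ln (v i a)"
          using U(2)[OF i aU(1)] U(2)[OF i aU(2)] by (simp add: mult_2[symmetric] ln_mult_pos)
        then have "real n * ln (v i a) = (\<Sum>b\<in>G. of_int (e b) * ln (v i b)) - real n * ln (v i 2)"
          using bspec[OF ne i] by (simp add: algebra_simps)
        also have "real n * ln (v i 2) = (\<Sum>b\<in>G. if b = 2 then real n * ln (v i b) else 0)"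
          using G(1) by (simp add: G_def)
        also have "(\<Sum>b\<in>G. of_int (e b) * ln (v i b)) - \<dots> =
            (\<Sum>b\<in>G. of_int (e b - (if b = 2 then int n else 0)) * ln (v i b))"
          unfolding sum_subtractf[symmetric] by (intro sum.cong) (auto simp: algebra_simps)
        finally show ?thesis .
      qed
      with n show "\<exists>n>0. \<exists>e. \<forall>i\<in>I \<union> J. real n * ln (v i a) = (\<Sum>b\<in>G. of_int (e b) * ln (v i b))"
        by (intro exI[of _ n] exI[of _ "\<lambda>b. e b - (if b = 2 then int n else 0)"] conjI ballI)
    qed
    show "a - b \<in> D \<union> Q \<union> S" if "a \<in> A" "b \<in> A" for a b using that by (auto simp: D_def)
    show "quintic (a + c) (- (b + c)) (b + d) \<in> D \<union> Q \<union> S \<and> septic (a + c) (- (b + c)) (b + d) \<in> D \<union> Q \<union> S"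
      if "a \<in> A" "b \<in> A" "c \<in> A" "d \<in> A" for a b c d
    proof
      have mem: "(a, b, c, d) \<in> A \<times> A \<times> A \<times> A" using that by simp
      show "quintic (a + c) (- (b + c)) (b + d) \<in> D \<union> Q \<union> S"
        using imageI[OF mem, of "\<lambda>(a, b, c, d). quintic (a + c) (- (b + c)) (b + d)"] by (simp add: Q_def)
      show "septic (a + c) (- (b + c)) (b + d) \<in> D \<union> Q \<union> S"
        using imageI[OF mem, of "\<lambda>(a, b, c, d). septic (a + c) (- (b + c)) (b + d)"] by (simp add: S_def)
    qed
  qed
  then interpret sumset_heights R I J v U "D \<union> Q \<union> S" A G .
  have "card A \<le> sumset_bound (card G)" using card_le unfolding sumset_bound_def .
  also have "\<dots> \<le> sumset_bound (r + 1)" by (rule sumset_bound_mono[OF cardG])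
  finally show ?thesis .
qed

theorem corollary10:
  shows "\<exists>f :: nat \<Rightarrow> nat.
    (\<forall>r\<ge>1. f r \<ge> 1) \<and>
    (\<forall>r\<ge>1. \<forall>\<Gamma> A :: complex set.
       subgroup \<Gamma> complex_units \<longrightarrow>
       group_rank (complex_units\<lparr>carrier := \<Gamma>\<rparr>) \<le> enat r \<longrightarrow>
       finite A \<longrightarrow>
       A + A \<subseteq> \<Gamma> \<longrightarrow>
       card A \<le> f r)"
proof (intro exI[of _ "\<lambda>r. sumset_bound (r + 1)"] conjI allI impI)
  show "sumset_bound (r + 1) \<ge> 1" for r
  proof -
    have "1 \<le> (25 ^ (r + 1) * 17 ^ (r + 1) :: nat)" by simp
    then show ?thesis unfolding sumset_bound_def by (rule trans_le_add1)
  qed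
qed (rule card_le_sumset_bound)

end
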